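(* Let $\mu$ be a symmetric Lévy measure on $\mathbb{R}$ and $m:\mathbb{R}\times\mathbb{R}\to\mathbb{R}$ a Borel measurable function such that: (A1) there exists $\beta>1$ such that $q^U(\xi)\le \beta q^L(\xi)$ for all sufficiently large $|\xi|$; (A2) $m(x,u)\ge 0$ and $m(x,-u)=m(x,u)$ for all $x,u\in\mathbb{R}$; (A3) there exist $c,\epsilon>0$ such that $\sup_x m(x,u)\le c(1\wedge|u|^\epsilon)$ for all $u$, where $\epsilon$ is small enough that $\int_{\mathbb{R}}(|u|^\epsilon\wedge 1)\,\mu(du)=\infty$. Then the function $$p_t(x,y)=p_t^0(x,y)+(p^0\star\Psi)_t(x,y),\qquad \Psi_t(x,y)=\sum_{k=1}^\infty\Phi_t^{\star k}(x,y),$$ is well defined for $t>0$, $x,y\in\mathbb{R}$; that is, all the convolutions $\Phi^{\star k}$, $k\ge1$, are well defined, the series defining $\Psi_t(x,y)$ converges, and the convolution $p^0\star\Psi$ is well defined.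
   Context: A Lévy measure $\mu$ on $\mathbb{R}$ satisfies $\mu(\{0\})=0$ and $\int_{\mathbb{R}}(1\wedge u^2)\,\mu(du)<\infty$; symmetric means invariant under $u\mapsto -u$. Notation: $a\wedge b=\min(a,b)$. $q(\xi)=\int_{\mathbb{R}}(1-\cos(\xi u))\,\mu(du)$, $\quad q^U(\xi)=\int_{\mathbb{R}}((\xi u)^2\wedge1)\,\mu(du)$, $\quad q^L(\xi)=\int_{|u\xi|\le1}(\xi u)^2\,\mu(du)$. Under (A1), $p_t(x)=\frac1{2\pi}\int_{\mathbb{R}}e^{-ix\xi-tq(\xi)}\,d\xi$ is the transition density of the Lévy process with characteristic exponent $q$, and $p_t^0(x,y):=p_t(y-x)$ (the one-argument function $p_t(\cdot)$ is distinct from $p_t(x,y)$). The perturbation operator is $\mathfrak{L}(x,D)f(x)=\int_{\mathbb{R}}(f(x+u)-f(x))\,m(x,u)\,\mu(du)$; integrals of this kind against kernels symmetric in $u$ are understood in the symmetric (principal value) sense, i.e. as $\frac12\int(f(x+u)+f(x-u)-2f(x))\,m(x,u)\,\mu(du)$. Put $\Phi_t(x,y)=\mathfrak{L}(x,D)p_t^0(x,y)$, the operator acting in the variable $x$. Space-time convolution: $(f\star g)_t(x,y)=\int_0^t\int_{\mathbb{R}}f_{t-\tau}(x,z)\,g_\tau(z,y)\,dz\,d\tau$. Convolution powers: $\Phi^{\star1}=\Phi$, $\Phi^{\star(k+1)}=\Phi^{\star k}\star\Phi$. *)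

theory Defs
  imports "HOL-Analysis.Analysis"
begin

definition levy_measure :: "real measure \<Rightarrow> bool" where
  "levy_measure \<mu> \<longleftrightarrow>
     sets \<mu> = sets borel \<and> emeasure \<mu> {0} = 0 \<and> (\<integral>\<^sup>+u. ennreal (min 1 (u\<^sup>2)) \<partial>\<mu>) < \<infinity>"

definition symmetric_measure :: "real measure \<Rightarrow> bool" where
  "symmetric_measure \<mu> \<longleftrightarrow> distr \<mu> borel (\<lambda>u. - u) = \<mu>"

definition levy_exponent :: "real measure \<Rightarrow> real \<Rightarrow> real" where
  "levy_exponent \<mu> \<xi> = (\<integral>u. 1 - cos (\<xi> * u) \<partial>\<mu>)"

definition q_upper :: "real measure \<Rightarrow> real \<Rightarrow> real" where
  "q_upper \<mu> \<xi> = (\<integral>u. min ((\<xi> * u)\<^sup>2) 1 \<partial>\<mu>)"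

definition q_lower :: "real measure \<Rightarrow> real \<Rightarrow> real" where
  "q_lower \<mu> \<xi> = set_lebesgue_integral \<mu> {u. \<bar>u * \<xi>\<bar> \<le> 1} (\<lambda>u. (\<xi> * u)\<^sup>2)"

definition fourier_integrand :: "real measure \<Rightarrow> real \<Rightarrow> real \<Rightarrow> real \<Rightarrow> complex" where
  "fourier_integrand \<mu> t x \<xi> =
     exp (- \<i> * of_real x * of_real \<xi> - of_real t * of_real (levy_exponent \<mu> \<xi>))"

text \<open>The exponent is even, so the Fourier integral is real; taking the real part only changes
  the type.\<close>

definition levy_density :: "real measure \<Rightarrow> real \<Rightarrow> real \<Rightarrow> real" where
  "levy_density \<mu> t x = Re (1 / (2 * of_real pi) * (\<integral>\<xi>. fourier_integrand \<mu> t x \<xi> \<partial>lborel))"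

definition p_zero :: "real measure \<Rightarrow> real \<Rightarrow> real \<Rightarrow> real \<Rightarrow> real" where
  "p_zero \<mu> t x y = levy_density \<mu> t (y - x)"

text \<open>The perturbation operator in its symmetric (principal value) form, and absolute convergence
  of the integral defining it at a point.\<close>

definition perturb_integrand ::
  "(real \<Rightarrow> real \<Rightarrow> real) \<Rightarrow> (real \<Rightarrow> real) \<Rightarrow> real \<Rightarrow> real \<Rightarrow> real" where
  "perturb_integrand m f x u = (f (x + u) + f (x - u) - 2 * f x) * m x u"

definition perturb_op ::
  "real measure \<Rightarrow> (real \<Rightarrow> real \<Rightarrow> real) \<Rightarrow> (real \<Rightarrow> real) \<Rightarrow> real \<Rightarrow> real" where
  "perturb_op \<mu> m f x = 1 / 2 * (\<integral>u. perturb_integrand m f x u \<partial>\<mu>)"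

definition perturb_op_defined ::
  "real measure \<Rightarrow> (real \<Rightarrow> real \<Rightarrow> real) \<Rightarrow> (real \<Rightarrow> real) \<Rightarrow> real \<Rightarrow> bool" where
  "perturb_op_defined \<mu> m f x \<longleftrightarrow> integrable \<mu> (perturb_integrand m f x)"

definition Phi ::
  "real measure \<Rightarrow> (real \<Rightarrow> real \<Rightarrow> real) \<Rightarrow> real \<Rightarrow> real \<Rightarrow> real \<Rightarrow> real" where
  "Phi \<mu> m t x y = perturb_op \<mu> m (\<lambda>z. p_zero \<mu> t z y) x"

text \<open>A kernel is a function of time and two space points. The endpoints of the time interval are
  left out because kernels are meaningful for positive times only.\<close>

type_synonym kernel = "real \<Rightarrow> real \<Rightarrow> real \<Rightarrow> real"

definition st_conv :: "kernel \<Rightarrow> kernel \<Rightarrow> kernel" where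
  "st_conv f g t x y =
     set_lebesgue_integral lborel {0<..<t} (\<lambda>\<tau>. \<integral>z. f (t - \<tau>) x z * g \<tau> z y \<partial>lborel)"

text \<open>Absolute convergence of the double integral; by Fubini the iterated integral then exists.\<close>

definition st_conv_defined :: "kernel \<Rightarrow> kernel \<Rightarrow> real \<Rightarrow> real \<Rightarrow> real \<Rightarrow> bool" where
  "st_conv_defined f g t x y \<longleftrightarrow>
     set_integrable (lborel \<Otimes>\<^sub>M lborel) ({0<..<t} \<times> UNIV) (\<lambda>(\<tau>, z). f (t - \<tau>) x z * g \<tau> z y)"

text \<open>Only exponents at least one are meaningful; the value at zero is a placeholder.\<close>

primrec st_power :: "kernel \<Rightarrow> nat \<Rightarrow> kernel" where
  "st_power F 0 = (\<lambda>t x y. 0)"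
| "st_power F (Suc k) = (if k = 0 then F else st_conv (st_power F k) F)"

definition Psi :: "real measure \<Rightarrow> (real \<Rightarrow> real \<Rightarrow> real) \<Rightarrow> kernel" where
  "Psi \<mu> m t x y = (\<Sum>k. st_power (Phi \<mu> m) (Suc k) t x y)"

end

theory Submission
  imports Defs "HOL-Probability.Sinc_Integral" "HOL-Real_Asymp.Real_Asymp"
begin

text \<open>
  Write $p_t$ for the density, $D^2_u f(x) = f(x+u) + f(x-u) - 2f(x)$ and $w(u) = 1 \wedge |u|^\epsilon$.
  By (A2) and (A3), $|\Phi_t(x,y)|$ is at most $G_t(y-x)$ with
  $G_t(x) = c \int |D^2_u p_t(x)|\, w(u)\, \mu(du)$, so all convolutions can be controlled by
  convolutions of a translation invariant kernel. Everything then rests on two estimates, valid for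
  $0 < t \le T$: the supremum of $G_t$ is at most a power of $1/t$, and $\|G_t\|_1$ is integrable in time,
  in fact $\|G_t\|_1 \le N t^{\eta-1}$ for some $\eta > 0$ (\<open>heat_kernel_bounds\<close>).

  The estimates live on the spatial scale $1/\rho$ with $q^U(\rho)$ comparable to $1/t$. Condition (A1) makes
  $q^U$ grow by a fixed factor from $\xi$ to $2\xi$ (\<open>q_upper_doubling\<close>), hence $e^{-tq(\xi)}$
  decays faster than any power of $\rho/|\xi|$ (\<open>exp_levy_exponent_decay\<close>). The exponent of the
  jumps of size at most $1/\rho$ is twice differentiable, with derivatives of the order dictated by the scale,
  so two integrations by parts bound the Fourier integral of $e^{-tq}$, restricted to these jumps, in $L^1$
  (\<open>cos_transform_decay\<close>). The larger jumps have total rate at most $q^U(\rho)$; their contribution is the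
  multiplier of a compound Poisson law, a contraction of $L^1$ (\<open>L1_cos_transform_compound_poisson\<close>). The
  outcome is $\|D^2_u p_t\|_1 \le K (1 \wedge \rho^2u^2)$, and the same bound times $\rho$ for the supremum.

  To integrate over $u$, note that $1 \wedge \rho^2u^2$ is at most a multiple of $1/(t\, q^U(1/|u|))$, and that
  $\int_{|u|\le1} |u|^\delta / q^U(1/|u|)\, \mu(du)$ is finite for every $\delta > 0$, since each dyadic shell
  $|u| \approx 2^{-n}$ has mass at most a multiple of $q^U(2^n)$. The positive power of $|u|$ in (A3)
  pays for $\delta$ and for a gain $t^\eta$ over $1/t$ (\<open>weight_integral_bound\<close>).

  For the series, put the weight $e^{-lt}$ on the majorant. Its mass on $(0,T]$ tends to $0$ as
  $l \to \infty$, so the masses of the convolution powers decay geometrically. For the suprema, in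
  each convolution one of the two factors is evaluated at a time at least $t/2$; bounding that factor by its
  supremum and the other one by its mass propagates the bound $t^{-\kappa}$ at the cost of a factor $2^\kappa$,
  which a small mass absorbs (\<open>nn_conv_le\<close>, \<open>nn_power_le\<close>, \<open>parametrix_series\<close>).
\<close>

section \<open>Elementary bounds and the functions $q$, $q^U$, $q^L$\<close>

lemma one_minus_cos_le_2: "1 - cos (y::real) \<le> 2"
  using cos_ge_minus_one[of y] by linarith

lemma one_minus_cos_le_half_square: "1 - cos (y::real) \<le> y\<^sup>2 / 2"
proof -
  have "1 - cos y = 2 * (sin (y/2))\<^sup>2"
    using cos_double_sin[of "y/2"] by simp
  also have "(sin (y/2))\<^sup>2 \<le> (y/2)\<^sup>2"
    using abs_sin_x_le_abs_x[of "y/2"] by (simp only: abs_le_square_iff)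
  finally show ?thesis by (simp add: power_divide)
qed

lemma quarter_square_le_one_minus_cos:
  assumes "\<bar>y::real\<bar> \<le> 1"
  shows "y\<^sup>2 / 4 \<le> 1 - cos y"
proof -
  obtain t where t: "cos y = (\<Sum>m<4. cos_coeff m * y ^ m) + cos (t + 1/2 * real 4 * pi) / fact 4 * y ^ 4"
    using Maclaurin_cos_expansion[of y 4] by blast
  have "(\<Sum>m<4. cos_coeff m * y ^ m) = 1 - y\<^sup>2 / 2"
    by (simp add: lessThan_nat_numeral lessThan_Suc cos_coeff_def)
  moreover have "cos (t + 1/2 * real 4 * pi) / fact 4 * y ^ 4 \<le> 1 / 24 * y ^ 4"
    by (intro mult_right_mono) (auto simp: fact_numeral divide_simps)
  moreover have "y ^ 4 \<le> y\<^sup>2"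
    using assms power_decreasing[of 2 4 "\<bar>y\<bar>"] by simp
  ultimately show ?thesis using t zero_le_power2[of y] by linarith
qed

locale levy_setting =
  fixes \<mu> :: "real measure"
  assumes levy: "levy_measure \<mu>"
begin

lemma sets_\<mu> [measurable_cong, simp]: "sets \<mu> = sets borel"
  using levy by (simp add: levy_measure_def)

lemma space_\<mu> [simp]: "space \<mu> = UNIV"
  using sets_eq_imp_space_eq[OF sets_\<mu>] by simp

lemma integrable_min_1_square: "integrable \<mu> (\<lambda>u. min 1 (u\<^sup>2))"
  using levy by (intro integrableI_nonneg) (auto simp: levy_measure_def)

lemma integrable_if_le_min_1_square:
  fixes f :: "real \<Rightarrow> real"
  assumes "f \<in> borel_measurable borel" "\<And>u. \<bar>f u\<bar> \<le> K * min 1 (u\<^sup>2)"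
  shows "integrable \<mu> f"
  by (rule Bochner_Integration.integrable_bound[OF integrable_mult_right[OF integrable_min_1_square, of K]])
     (use assms in \<open>auto intro: order_trans abs_ge_self\<close>)

lemma min_square_le: "min ((a * u)\<^sup>2) 1 \<le> max 1 (a\<^sup>2) * min 1 (u\<^sup>2)" for a u :: real
proof (cases "u\<^sup>2 \<le> 1")
  case True
  have "(a * u)\<^sup>2 \<le> max 1 (a\<^sup>2) * u\<^sup>2"
    unfolding power_mult_distrib by (intro mult_right_mono) auto
  with True show ?thesis by (simp add: min.coboundedI1)
next
  case False
  then show ?thesis by (auto simp: min_def max_def)
qed

lemma integrable_q_upper: "integrable \<mu> (\<lambda>u. min ((\<xi> * u)\<^sup>2) 1)"
  by (rule integrable_if_le_min_1_square[of _ "max 1 (\<xi>\<^sup>2)"]) (use min_square_le in auto)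

lemma integrable_q_lower: "set_integrable \<mu> {u. \<bar>u * \<xi>\<bar> \<le> 1} (\<lambda>u. (\<xi> * u)\<^sup>2)"
  unfolding set_integrable_def
proof (rule Bochner_Integration.integrable_bound[OF integrable_q_upper[of \<xi>]])
  show "AE u in \<mu>. norm (indicat_real {u. \<bar>u * \<xi>\<bar> \<le> 1} u *\<^sub>R (\<xi> * u)\<^sup>2) \<le> norm (min ((\<xi> * u)\<^sup>2) 1)"
    by (auto simp: indicator_def min_def abs_square_le_1 mult.commute)
qed measurable

lemma integrable_levy_exponent: "integrable \<mu> (\<lambda>u. 1 - cos (\<xi> * u))"
proof (rule Bochner_Integration.integrable_bound[OF integrable_mult_right[OF integrable_q_upper[of \<xi>], of 2]])
  show "AE u in \<mu>. norm (1 - cos (\<xi> * u)) \<le> norm (2 * min ((\<xi> * u)\<^sup>2) 1)"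
  proof (rule AE_I2)
    fix u
    have "z \<le> 2 \<Longrightarrow> z \<le> w / 2 \<Longrightarrow> 0 \<le> w \<Longrightarrow> z \<le> 2 * min w 1" for z w :: real
      by (simp add: min_def)
    then have "1 - cos (\<xi> * u) \<le> 2 * min ((\<xi> * u)\<^sup>2) 1"
      using one_minus_cos_le_2[of "\<xi> * u"] one_minus_cos_le_half_square[of "\<xi> * u"] zero_le_power2[of "\<xi> * u"] by blast
    then show "norm (1 - cos (\<xi> * u)) \<le> norm (2 * min ((\<xi> * u)\<^sup>2) 1)"
      by simp
  qed
qed measurable

lemma q_upper_nonneg: "0 \<le> q_upper \<mu> \<xi>"
  unfolding q_upper_def by (intro integral_nonneg_AE) auto

lemma levy_exponent_nonneg: "0 \<le> levy_exponent \<mu> \<xi>"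
  unfolding levy_exponent_def by (intro integral_nonneg_AE) auto

lemma q_upper_mono:
  assumes "\<bar>a\<bar> \<le> \<bar>b\<bar>"
  shows "q_upper \<mu> a \<le> q_upper \<mu> b"
  unfolding q_upper_def
proof (rule integral_mono[OF integrable_q_upper integrable_q_upper])
  fix u
  have "(a * u)\<^sup>2 \<le> (b * u)\<^sup>2"
    using assms by (simp add: power_mult_distrib mult_right_mono abs_le_square_iff)
  then show "min ((a * u)\<^sup>2) 1 \<le> min ((b * u)\<^sup>2) 1" by auto
qed

lemma q_upper_scale_le:
  assumes "1 \<le> a"
  shows "q_upper \<mu> (a * \<xi>) \<le> a\<^sup>2 * q_upper \<mu> \<xi>"
proof -
  have "q_upper \<mu> (a * \<xi>) \<le> (\<integral>u. a\<^sup>2 * min ((\<xi> * u)\<^sup>2) 1 \<partial>\<mu>)"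
    unfolding q_upper_def
  proof (intro integral_mono integrable_q_upper integrable_mult_right)
    fix u
    have "1 \<le> a\<^sup>2" using assms by simp
    moreover have "(a * \<xi> * u)\<^sup>2 = a\<^sup>2 * (\<xi> * u)\<^sup>2" by (simp add: power_mult_distrib)
    ultimately show "min ((a * \<xi> * u)\<^sup>2) 1 \<le> a\<^sup>2 * min ((\<xi> * u)\<^sup>2) 1"
      by (auto simp: min_def)
  qed
  then show ?thesis by (simp add: q_upper_def)
qed

lemma q_lower_le_levy_exponent: "q_lower \<mu> \<xi> / 4 \<le> levy_exponent \<mu> \<xi>"
proof -
  have "(\<integral>u. indicat_real {u. \<bar>u * \<xi>\<bar> \<le> 1} u *\<^sub>R (\<xi> * u)\<^sup>2 / 4 \<partial>\<mu>) \<le> levy_exponent \<mu> \<xi>"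
    unfolding levy_exponent_def
  proof (intro integral_mono integrable_levy_exponent)
    show "integrable \<mu> (\<lambda>u. indicat_real {u. \<bar>u * \<xi>\<bar> \<le> 1} u *\<^sub>R (\<xi> * u)\<^sup>2 / 4)"
      using integrable_q_lower[of \<xi>] unfolding set_integrable_def by simp
    show "indicat_real {u. \<bar>u * \<xi>\<bar> \<le> 1} u *\<^sub>R (\<xi> * u)\<^sup>2 / 4 \<le> 1 - cos (\<xi> * u)" for u
      using quarter_square_le_one_minus_cos[of "\<xi> * u"] by (auto simp: indicator_def mult.commute)
  qed
  then show ?thesis by (simp add: q_lower_def set_lebesgue_integral_def)
qed

text \<open>The discrete form of $\xi \frac{d}{d\xi} q^U = 2 q^L$: on $|2\xi u| \le 1$ passing from $\xi$ to $2\xi$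
  multiplies the integrand of $q^U$ by four, which leaves three quarters of the new value as increment.\<close>

lemma q_lower_le_increment: "3 / 4 * q_lower \<mu> (2 * \<xi>) \<le> q_upper \<mu> (2 * \<xi>) - q_upper \<mu> \<xi>"
proof -
  have "(\<integral>u. 3 / 4 * (indicat_real {u. \<bar>u * (2 * \<xi>)\<bar> \<le> 1} u *\<^sub>R (2 * \<xi> * u)\<^sup>2) \<partial>\<mu>)
      \<le> (\<integral>u. min ((2 * \<xi> * u)\<^sup>2) 1 - min ((\<xi> * u)\<^sup>2) 1 \<partial>\<mu>)"
  proof (intro integral_mono)
    show "integrable \<mu> (\<lambda>u. 3 / 4 * (indicat_real {u. \<bar>u * (2 * \<xi>)\<bar> \<le> 1} u *\<^sub>R (2 * \<xi> * u)\<^sup>2))"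
      using integrable_q_lower[of "2 * \<xi>"] unfolding set_integrable_def by simp
    show "integrable \<mu> (\<lambda>u. min ((2 * \<xi> * u)\<^sup>2) 1 - min ((\<xi> * u)\<^sup>2) 1)"
      by (intro Bochner_Integration.integrable_diff integrable_q_upper)
    fix u
    show "3 / 4 * (indicat_real {u. \<bar>u * (2 * \<xi>)\<bar> \<le> 1} u *\<^sub>R (2 * \<xi> * u)\<^sup>2)
        \<le> min ((2 * \<xi> * u)\<^sup>2) 1 - min ((\<xi> * u)\<^sup>2) 1"
    proof (cases "\<bar>u * (2 * \<xi>)\<bar> \<le> 1")
      case True
      then have "(2 * \<xi> * u)\<^sup>2 \<le> 1" by (simp add: abs_square_le_1 mult.commute mult.left_commute)
      moreover have "(2 * \<xi> * u)\<^sup>2 = 4 * (\<xi> * u)\<^sup>2" by (simp add: power_mult_distrib)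
      ultimately show ?thesis using True zero_le_power2[of "\<xi> * u"] by (auto simp: min_def)
    next
      case False
      have "(2 * \<xi> * u)\<^sup>2 = 4 * (\<xi> * u)\<^sup>2" by (simp add: power_mult_distrib)
      then show ?thesis using False zero_le_power2[of "\<xi> * u"] by (auto simp: min_def)
    qed
  qed
  then show ?thesis
    by (simp add: q_upper_def q_lower_def set_lebesgue_integral_def integrable_q_upper
        Bochner_Integration.integral_diff)
qed

lemma min_square_eq_1:
  assumes "0 < \<rho>" "\<bar>u\<bar> > 1 / \<rho>"
  shows "min ((\<rho> * u)\<^sup>2) 1 = (1::real)"
proof -
  have "1 < \<bar>\<rho> * u\<bar>" using assms by (simp add: abs_mult field_simps)
  then have "1 < (\<rho> * u)\<^sup>2" by (metis abs_square_le_1 not_le)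
  then show ?thesis by simp
qed

lemma emeasure_outside_le_q_upper:
  assumes "\<rho> > 0"
  shows "emeasure \<mu> {u. \<bar>u\<bar> > 1 / \<rho>} \<le> ennreal (q_upper \<mu> \<rho>)"
proof -
  have "emeasure \<mu> {u. \<bar>u\<bar> > 1 / \<rho>} = (\<integral>\<^sup>+u. indicator {u. \<bar>u\<bar> > 1 / \<rho>} u \<partial>\<mu>)"
    by (rule nn_integral_indicator[symmetric]) auto
  also have "\<dots> \<le> (\<integral>\<^sup>+u. ennreal (min ((\<rho> * u)\<^sup>2) 1) \<partial>\<mu>)"
    by (intro nn_integral_mono) (auto simp: indicator_def min_square_eq_1[OF assms])
  also have "\<dots> = ennreal (q_upper \<mu> \<rho>)"
    unfolding q_upper_def by (rule nn_integral_eq_integral[OF integrable_q_upper]) auto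
  finally show ?thesis .
qed

text \<open>A Levy measure may be infinite only near the origin; sigma-finiteness makes Fubini's theorem available.\<close>

sublocale sigma_finite_measure \<mu>
proof
  let ?A = "insert {0} ((\<lambda>n::nat. {u. \<bar>u\<bar> > 1 / real (Suc n)}) ` UNIV)"
  have "\<Union>?A = UNIV"
  proof (rule UNIV_eq_I[symmetric])
    fix u :: real
    show "u \<in> \<Union>?A"
    proof (cases "u = 0")
      case False
      then obtain n where "inverse (real (Suc n)) < \<bar>u\<bar>" using reals_Archimedean[of "\<bar>u\<bar>"] by auto
      then show ?thesis by (auto simp: inverse_eq_divide)
    qed simp
  qed
  moreover have "\<forall>a\<in>?A. emeasure \<mu> a \<noteq> \<infinity>"
  proof -
    have "emeasure \<mu> {u. \<bar>u\<bar> > 1 / real (Suc n)} \<noteq> \<infinity>" for n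
      using emeasure_outside_le_q_upper[of "real (Suc n)"] by (auto simp: top_unique)
    moreover have "emeasure \<mu> {0} \<noteq> \<infinity>" using levy by (simp add: levy_measure_def)
    ultimately show ?thesis by auto
  qed
  ultimately show "\<exists>A. countable A \<and> A \<subseteq> sets \<mu> \<and> \<Union>A = space \<mu> \<and> (\<forall>a\<in>A. emeasure \<mu> a \<noteq> \<infinity>)"
    by (intro exI[of _ ?A]) auto
qed

lemma measurable_levy_exponent [measurable]: "levy_exponent \<mu> \<in> borel_measurable borel"
  unfolding levy_exponent_def[abs_def] by measurable

end

section \<open>Dyadic growth of $q^U$ and decay of $e^{-tq}$\<close>

lemma dyadic_bracket:
  fixes x :: real
  assumes "1 \<le> x"
  obtains n where "2 ^ n \<le> x" "x < 2 ^ Suc n"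
proof -
  obtain k where k: "x < 2 ^ k" using real_arch_pow[of 2 x] by auto
  define l where "l = (LEAST k. x < 2 ^ k)"
  have l: "x < 2 ^ l" unfolding l_def using k by (rule LeastI)
  then have "l \<noteq> 0" using assms by (intro notI) simp
  then obtain n where n: "l = Suc n" by (cases l) auto
  have "\<not> x < 2 ^ n" using not_less_Least[of n "\<lambda>k. x < 2 ^ k"] n by (simp add: l_def)
  then show ?thesis using that[of n] l n by simp
qed

lemma power_over_fact_le_exp:
  assumes "0 \<le> (x::real)"
  shows "x ^ n / fact n \<le> exp x"
proof -
  have "(\<Sum>k\<in>{n}. x ^ k /\<^sub>R fact k) \<le> (\<Sum>k. x ^ k /\<^sub>R fact k)"
    using assms by (intro sum_le_suminf summable_exp_generic) auto
  then show ?thesis by (simp add: exp_def divide_inverse mult.commute)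
qed

locale levy_scaling = levy_setting +
  fixes \<beta> \<xi>0 :: real
  assumes \<beta>_gt_1: "1 < \<beta>" and \<xi>0_pos: "0 < \<xi>0" and q_upper_pos: "0 < q_upper \<mu> \<xi>0"
    and upper_le_lower: "\<And>\<xi>. \<xi>0 \<le> \<bar>\<xi>\<bar> \<Longrightarrow> q_upper \<mu> \<xi> \<le> \<beta> * q_lower \<mu> \<xi>"
begin

text \<open>The factor by which $q^U$ increases from $\xi$ to $2\xi$: solving $q^U(2\xi) - q^U(\xi) \ge \frac34 q^L(2\xi)
  \ge \frac{3}{4\beta} q^U(2\xi)$ for $q^U(2\xi)$.\<close>

definition growth :: real where "growth = 1 / (1 - 3 / (4 * \<beta>))"

lemma growth_gt_1: "1 < growth"
  using \<beta>_gt_1 by (simp add: growth_def field_simps)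

lemma q_upper_doubling:
  assumes "\<xi>0 \<le> \<xi>"
  shows "growth * q_upper \<mu> \<xi> \<le> q_upper \<mu> (2 * \<xi>)"
proof -
  have "q_upper \<mu> (2 * \<xi>) \<le> \<beta> * q_lower \<mu> (2 * \<xi>)"
    using assms \<xi>0_pos by (intro upper_le_lower) auto
  then have "3 / (4 * \<beta>) * q_upper \<mu> (2 * \<xi>) \<le> 3 / 4 * q_lower \<mu> (2 * \<xi>)"
    using \<beta>_gt_1 by (simp add: field_simps)
  also have "\<dots> \<le> q_upper \<mu> (2 * \<xi>) - q_upper \<mu> \<xi>"
    by (rule q_lower_le_increment)
  finally have "q_upper \<mu> \<xi> \<le> (1 - 3 / (4 * \<beta>)) * q_upper \<mu> (2 * \<xi>)"
    by (simp add: algebra_simps)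
  moreover have "0 < 1 - 3 / (4 * \<beta>)" using \<beta>_gt_1 by (simp add: field_simps)
  ultimately show ?thesis by (simp add: growth_def field_simps)
qed

lemma q_upper_dyadic_growth:
  assumes "\<xi>0 \<le> \<xi>"
  shows "growth ^ n * q_upper \<mu> \<xi> \<le> q_upper \<mu> (2 ^ n * \<xi>)"
proof (induction n)
  case (Suc n)
  have "\<xi>0 \<le> 2 ^ n * \<xi>"
    using assms \<xi>0_pos mult_mono[of 1 "2 ^ n" \<xi>0 \<xi>] by simp
  have "growth ^ Suc n * q_upper \<mu> \<xi> \<le> growth * q_upper \<mu> (2 ^ n * \<xi>)"
    using Suc growth_gt_1 by (simp add: mult.assoc)
  also have "\<dots> \<le> q_upper \<mu> (2 * (2 ^ n * \<xi>))"
    by (rule q_upper_doubling) fact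
  finally show ?case by (simp add: mult.assoc)
qed simp

lemma q_upper_pos_above: "\<xi>0 \<le> \<xi> \<Longrightarrow> 0 < q_upper \<mu> \<xi>"
  using q_upper_pos q_upper_mono[of \<xi>0 \<xi>] \<xi>0_pos by simp

text \<open>The scale $\rho$ belonging to the time $t$. It is found among $2^n \xi_0$ by taking the first $n$ with
  $q^U(2^n\xi_0) \ge 1/t$; either $n = 0$, which accounts for the term with $T$, or $q^U$ was below $1/t$ one
  dyadic step before, and a step multiplies $q^U$ by at most four.\<close>

lemma exists_scale:
  assumes "0 < t" "t \<le> T"
  shows "\<exists>\<rho>\<ge>\<xi>0. 1 / t \<le> q_upper \<mu> \<rho> \<and> q_upper \<mu> \<rho> \<le> (4 + T * q_upper \<mu> \<xi>0) / t"
proof -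
  let ?Q = "\<lambda>n. q_upper \<mu> (2 ^ n * \<xi>0)"
  obtain k where "1 / t / q_upper \<mu> \<xi>0 < growth ^ k"
    using real_arch_pow[OF growth_gt_1] by blast
  then have "1 / t < growth ^ k * q_upper \<mu> \<xi>0"
    using q_upper_pos by (simp only: pos_divide_less_eq)
  also have "\<dots> \<le> ?Q k"
    by (rule q_upper_dyadic_growth) simp
  finally have ex: "1 / t \<le> ?Q k" by simp
  define n where "n = (LEAST n. 1 / t \<le> ?Q n)"
  have n: "1 / t \<le> ?Q n" unfolding n_def using ex by (rule LeastI)
  have "?Q n \<le> (4 + T * q_upper \<mu> \<xi>0) / t"
  proof (cases n)
    case 0
    have "t * q_upper \<mu> \<xi>0 \<le> 4 + T * q_upper \<mu> \<xi>0"
      using assms q_upper_pos mult_right_mono[of t T "q_upper \<mu> \<xi>0"] by linarith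
    then show ?thesis using 0 assms by (simp add: field_simps)
  next
    case (Suc l)
    have "\<not> 1 / t \<le> ?Q l"
      using not_less_Least[of l "\<lambda>n. 1 / t \<le> ?Q n"] Suc by (simp add: n_def)
    moreover have "?Q (Suc l) \<le> 4 * ?Q l"
      using q_upper_scale_le[of 2 "2 ^ l * \<xi>0"] by (simp add: mult.assoc)
    ultimately have "?Q n \<le> 4 / t" using Suc by simp
    also have "\<dots> \<le> (4 + T * q_upper \<mu> \<xi>0) / t"
      using assms q_upper_pos by (intro divide_right_mono) auto
    finally show ?thesis .
  qed
  moreover have "\<xi>0 \<le> 2 ^ n * \<xi>0" using \<xi>0_pos by simp
  ultimately show ?thesis using n by blast
qed

text \<open>Doubling the argument multiplies $q^U$ by a factor greater than $1$, so a power of $q^U$ dominates the argument.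
  This turns bounds in terms of $\rho$ into powers of $1/t$.\<close>

lemma scale_le_power_q_upper: "\<exists>m. \<forall>\<rho>\<ge>\<xi>0. \<rho> \<le> 2 * \<xi>0 * (q_upper \<mu> \<rho> / q_upper \<mu> \<xi>0) ^ m"
proof -
  obtain m where m: "2 < growth ^ m" using real_arch_pow[OF growth_gt_1] by blast
  have "\<rho> \<le> 2 * \<xi>0 * (q_upper \<mu> \<rho> / q_upper \<mu> \<xi>0) ^ m" if "\<xi>0 \<le> \<rho>" for \<rho>
  proof -
    have "1 \<le> \<rho> / \<xi>0" using that \<xi>0_pos by simp
    then obtain n where n: "2 ^ n \<le> \<rho> / \<xi>0" "\<rho> / \<xi>0 < 2 ^ Suc n" by (rule dyadic_bracket)
    have "growth ^ n * q_upper \<mu> \<xi>0 \<le> q_upper \<mu> (2 ^ n * \<xi>0)"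
      by (rule q_upper_dyadic_growth) simp
    also have "\<dots> \<le> q_upper \<mu> \<rho>"
      using n \<xi>0_pos that by (intro q_upper_mono) (simp add: field_simps)
    finally have g: "growth ^ n \<le> q_upper \<mu> \<rho> / q_upper \<mu> \<xi>0"
      using q_upper_pos by (simp add: field_simps)
    have "(2::real) ^ n \<le> (growth ^ m) ^ n" using m by (intro power_mono) auto
    also have "\<dots> = (growth ^ n) ^ m" by (simp add: power_mult[symmetric] mult.commute)
    also have "\<dots> \<le> (q_upper \<mu> \<rho> / q_upper \<mu> \<xi>0) ^ m"
      using g growth_gt_1 by (intro power_mono) auto
    finally have "2 ^ n \<le> (q_upper \<mu> \<rho> / q_upper \<mu> \<xi>0) ^ m" .
    moreover have "\<rho> \<le> 2 * \<xi>0 * 2 ^ n" using n \<xi>0_pos by (simp add: field_simps)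
    ultimately show ?thesis using \<xi>0_pos by (smt (verit) mult_left_mono)
  qed
  then show ?thesis by blast
qed

text \<open>With $\eta = |\xi|/\rho \approx 2^n$ one has $t q(\xi) \ge t q^U(\xi)/(4\beta) \ge s^n/(4\beta)$, where $s$ is the
  dyadic growth factor, and $e^{-s^n/(4\beta)}$ beats every power of $2^n$. The third power of $1 + \eta^2$
  leaves one factor for integrability after two are spent on the polynomials produced by differentiation.\<close>

lemma exp_levy_exponent_decay:
  "\<exists>D\<ge>1. \<forall>t \<rho> \<xi>. 0 < t \<longrightarrow> \<xi>0 \<le> \<rho> \<longrightarrow> 1 / t \<le> q_upper \<mu> \<rho> \<longrightarrow>
     exp (- t * levy_exponent \<mu> \<xi>) \<le> D / (1 + (\<xi> / \<rho>)\<^sup>2) ^ 3"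
proof -
  \<comment> \<open>$64 = 2^6$ is the growth of $\eta^6$ in one dyadic step.\<close>
  obtain N where N: "64 < growth ^ N" using real_arch_pow[OF growth_gt_1] by blast
  define D where "D = 512 * ((4 * \<beta>) ^ N * fact N)"
  have D: "512 \<le> D"
  proof -
    have "1 \<le> (4 * \<beta>) ^ N" using \<beta>_gt_1 by (intro one_le_power) auto
    moreover have "(1::real) \<le> fact N" by (rule fact_ge_1)
    ultimately show ?thesis unfolding D_def using mult_mono[of 1 "(4*\<beta>)^N" 1 "fact N::real"] by simp
  qed
  have "exp (- t * levy_exponent \<mu> \<xi>) * (1 + (\<xi> / \<rho>)\<^sup>2) ^ 3 \<le> D"
    if t: "0 < t" and \<rho>: "\<xi>0 \<le> \<rho>" "1 / t \<le> q_upper \<mu> \<rho>" for t \<rho> \<xi>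
  proof (cases "\<bar>\<xi>\<bar> \<le> \<rho>")
    case True
    have "\<rho> > 0" using \<rho> \<xi>0_pos by simp
    then have "(\<xi> / \<rho>)\<^sup>2 \<le> 1" using True by (simp add: abs_square_le_1)
    then have "(1 + (\<xi> / \<rho>)\<^sup>2) ^ 3 \<le> 2 ^ 3" by (intro power_mono) auto
    moreover have "exp (- t * levy_exponent \<mu> \<xi>) \<le> 1"
      using t levy_exponent_nonneg[of \<xi>] by simp
    ultimately have "exp (- t * levy_exponent \<mu> \<xi>) * (1 + (\<xi> / \<rho>)\<^sup>2) ^ 3 \<le> 1 * 2 ^ 3"
      by (intro mult_mono) auto
    then show ?thesis using D by simp
  next
    case False
    have \<rho>_pos: "\<rho> > 0" using \<rho> \<xi>0_pos by simp
    define \<eta> where "\<eta> = \<bar>\<xi>\<bar> / \<rho>"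
    have "1 \<le> \<eta>" using False \<rho>_pos by (simp add: \<eta>_def)
    then obtain n where n: "2 ^ n \<le> \<eta>" "\<eta> < 2 ^ Suc n" by (rule dyadic_bracket)
    define y where "y = growth ^ n / (4 * \<beta>)"
    have y: "0 \<le> y" using growth_gt_1 \<beta>_gt_1 by (simp add: y_def)
    have "growth ^ n * (1 / t) \<le> growth ^ n * q_upper \<mu> \<rho>"
      using \<rho> growth_gt_1 by (intro mult_left_mono) auto
    also have "\<dots> \<le> q_upper \<mu> (2 ^ n * \<rho>)"
      by (rule q_upper_dyadic_growth) fact
    also have "\<dots> \<le> q_upper \<mu> \<xi>"
      using n \<rho>_pos by (intro q_upper_mono) (simp add: \<eta>_def field_simps)
    also have "\<dots> \<le> \<beta> * q_lower \<mu> \<xi>"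
      using False \<rho> by (intro upper_le_lower) auto
    also have "\<dots> \<le> \<beta> * (4 * levy_exponent \<mu> \<xi>)"
      using q_lower_le_levy_exponent[of \<xi>] \<beta>_gt_1 by (intro mult_left_mono) auto
    finally have "y \<le> t * levy_exponent \<mu> \<xi>"
      using t \<beta>_gt_1 by (simp add: y_def field_simps)
    then have e: "exp (- t * levy_exponent \<mu> \<xi>) \<le> exp (- y)" by simp
    have "1 + (\<xi> / \<rho>)\<^sup>2 \<le> 2 * \<eta>\<^sup>2"
      using one_le_power[OF \<open>1 \<le> \<eta>\<close>, of 2] by (simp add: \<eta>_def power_divide)
    then have "(1 + (\<xi> / \<rho>)\<^sup>2) ^ 3 \<le> (2 * \<eta>\<^sup>2) ^ 3" by (intro power_mono) auto
    also have "\<dots> = 8 * \<eta> ^ 6" by (simp add: power_mult_distrib power_mult[symmetric])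
    also have "\<dots> \<le> 8 * (2 ^ Suc n) ^ 6"
      using n \<open>1 \<le> \<eta>\<close> by (intro mult_left_mono power_mono) auto
    also have "\<dots> = 512 * 64 ^ n"
    proof -
      have "((2::real) ^ n) ^ 6 = (2 ^ 6) ^ n"
        by (simp only: power_mult[symmetric] mult.commute)
      then show ?thesis by (simp add: power_mult_distrib)
    qed
    also have "\<dots> \<le> 512 * (growth ^ N) ^ n"
      using N by (intro mult_left_mono power_mono) auto
    also have "(growth ^ N) ^ n = (4 * \<beta>) ^ N * y ^ N"
      using \<beta>_gt_1 unfolding y_def power_divide
      by (simp add: power_mult[symmetric] mult.commute)
    also have "512 * ((4 * \<beta>) ^ N * y ^ N) \<le> 512 * ((4 * \<beta>) ^ N * (fact N * exp y))"
      using power_over_fact_le_exp[OF y, of N] \<beta>_gt_1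
      by (intro mult_left_mono) (auto simp: field_simps)
    finally have "(1 + (\<xi> / \<rho>)\<^sup>2) ^ 3 \<le> D * exp y" by (simp add: D_def mult.assoc)
    then have "exp (- t * levy_exponent \<mu> \<xi>) * (1 + (\<xi> / \<rho>)\<^sup>2) ^ 3 \<le> exp (- y) * (D * exp y)"
      using e by (intro mult_mono) auto
    also have "\<dots> = D * (exp (- y) * exp y)" by (simp only: mult.left_commute)
    also have "exp (- y) * exp y = 1" by (simp add: exp_add[symmetric])
    finally show ?thesis by simp
  qed
  moreover have "0 < (1 + (\<xi> / \<rho>)\<^sup>2) ^ 3" for \<xi> \<rho> :: real
    by (intro zero_less_power add_pos_nonneg) auto
  ultimately have "exp (- t * levy_exponent \<mu> \<xi>) \<le> D / (1 + (\<xi> / \<rho>)\<^sup>2) ^ 3"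
    if "0 < t" "\<xi>0 \<le> \<rho>" "1 / t \<le> q_upper \<mu> \<rho>" for t \<rho> \<xi>
    using that by (simp add: pos_le_divide_eq)
  then show ?thesis using D by (intro exI[of _ D]) auto
qed

end

section \<open>The cosine transform\<close>

text \<open>The real part of $\frac{1}{2\pi}\int e^{-ix\xi}\psi(\xi)\,d\xi$ for real $\psi$.\<close>

definition cos_transform :: "(real \<Rightarrow> real) \<Rightarrow> real \<Rightarrow> real" where
  "cos_transform \<psi> x = (\<integral>\<xi>. cos (x * \<xi>) * \<psi> \<xi> \<partial>lborel) / (2 * pi)"

abbreviation L1_norm :: "(real \<Rightarrow> real) \<Rightarrow> ennreal" where
  "L1_norm f \<equiv> \<integral>\<^sup>+x. ennreal \<bar>f x\<bar> \<partial>lborel"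

lemma
  shows integrable_inverse_1_plus_square_lborel: "integrable lborel (\<lambda>x. 1 / (1 + (x::real)\<^sup>2))"
    and integral_inverse_1_plus_square_lborel: "(\<integral>x. 1 / (1 + (x::real)\<^sup>2) \<partial>lborel) = pi"
  using integrable_inverse_1_plus_square LBINT_inverse_1_plus_square
  by (auto simp: set_integrable_def interval_lebesgue_integral_def set_lebesgue_integral_def
      inverse_eq_divide)

lemma
  assumes "0 < (\<rho>::real)"
  shows integrable_inverse_square_scaled: "integrable lborel (\<lambda>x. 1 / (1 + (x / \<rho>)\<^sup>2))"
    and integral_inverse_square_scaled: "(\<integral>x. 1 / (1 + (x / \<rho>)\<^sup>2) \<partial>lborel) = \<rho> * pi"
proof -
  show "integrable lborel (\<lambda>x. 1 / (1 + (x / \<rho>)\<^sup>2))"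
    using lborel_integrable_real_affine[OF integrable_inverse_1_plus_square_lborel, of "1/\<rho>" 0] assms
    by simp
  show "(\<integral>x. 1 / (1 + (x / \<rho>)\<^sup>2) \<partial>lborel) = \<rho> * pi"
    using lborel_integral_real_affine[of "1/\<rho>" "\<lambda>x. 1 / (1 + x\<^sup>2)" 0] assms
    by (simp add: integral_inverse_1_plus_square_lborel field_simps)
qed

lemma integrable_of_inverse_square_bound:
  fixes f :: "real \<Rightarrow> real"
  assumes "0 < \<rho>" "f \<in> borel_measurable borel" "\<And>\<xi>. \<bar>f \<xi>\<bar> \<le> A / (1 + (\<xi> / \<rho>)\<^sup>2)"
  shows "integrable lborel f" "(\<integral>\<xi>. \<bar>f \<xi>\<bar> \<partial>lborel) \<le> A * (\<rho> * pi)"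
proof -
  have i: "integrable lborel (\<lambda>\<xi>. A * (1 / (1 + (\<xi> / \<rho>)\<^sup>2)))"
    by (intro integrable_mult_right integrable_inverse_square_scaled assms)
  show f: "integrable lborel f"
    by (rule Bochner_Integration.integrable_bound[OF i])
       (use assms(2) in \<open>auto intro!: AE_I2 order_trans[OF assms(3)] order_trans[OF _ abs_ge_self] simp del: abs_divide\<close>)
  have "(\<integral>\<xi>. \<bar>f \<xi>\<bar> \<partial>lborel) \<le> (\<integral>\<xi>. A * (1 / (1 + (\<xi> / \<rho>)\<^sup>2)) \<partial>lborel)"
    using assms f by (intro integral_mono i) auto
  then show "(\<integral>\<xi>. \<bar>f \<xi>\<bar> \<partial>lborel) \<le> A * (\<rho> * pi)"
    by (simp only: integral_mult_right_zero integral_inverse_square_scaled[OF assms(1)])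
qed

lemma integrable_cos_mult:
  fixes \<psi> :: "real \<Rightarrow> real"
  assumes "integrable M \<psi>" "(\<lambda>\<xi>. f \<xi>) \<in> borel_measurable M"
  shows "integrable M (\<lambda>\<xi>. cos (f \<xi>) * \<psi> \<xi>)"
proof (rule Bochner_Integration.integrable_bound[OF assms(1)])
  show "AE \<xi> in M. norm (cos (f \<xi>) * \<psi> \<xi>) \<le> norm (\<psi> \<xi>)"
    by (intro AE_I2) (auto simp: abs_mult intro!: mult_left_le_one_le)
qed (use assms in measurable)

lemma abs_cos_transform_le:
  assumes "integrable lborel \<psi>"
  shows "\<bar>cos_transform \<psi> x\<bar> \<le> (\<integral>\<xi>. \<bar>\<psi> \<xi>\<bar> \<partial>lborel) / (2 * pi)"
proof -
  have "\<bar>\<integral>\<xi>. cos (x * \<xi>) * \<psi> \<xi> \<partial>lborel\<bar> \<le> (\<integral>\<xi>. \<bar>\<psi> \<xi>\<bar> \<partial>lborel)"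
  proof (rule integral_abs_bound_integral)
    show "\<bar>cos (x * \<xi>) * \<psi> \<xi>\<bar> \<le> \<bar>\<psi> \<xi>\<bar>" for \<xi>
      by (auto simp: abs_mult intro!: mult_left_le_one_le)
  qed (use assms in \<open>auto intro!: integrable_cos_mult\<close>)
  then show ?thesis by (simp add: cos_transform_def divide_right_mono)
qed

lemma tendsto_zero_of_inverse_square_bound:
  fixes f :: "real \<Rightarrow> real"
  assumes "0 < \<rho>" "\<And>\<xi>. \<bar>f \<xi>\<bar> \<le> A / (1 + (\<xi> / \<rho>)\<^sup>2)"
  shows "(f \<longlongrightarrow> 0) at_top" "(f \<longlongrightarrow> 0) at_bot"
proof -
  have "((\<lambda>\<xi>. A / (1 + (\<xi> / \<rho>)\<^sup>2)) \<longlongrightarrow> 0) at_top"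
    using assms(1) by real_asymp
  then show "(f \<longlongrightarrow> 0) at_top"
    by (rule Lim_null_comparison[rotated]) (use assms(2) in auto)
  have "((\<lambda>\<xi>. A / (1 + (\<xi> / \<rho>)\<^sup>2)) \<longlongrightarrow> 0) at_bot"
    using assms(1) by real_asymp
  then show "(f \<longlongrightarrow> 0) at_bot"
    by (rule Lim_null_comparison[rotated]) (use assms(2) in auto)
qed

text \<open>Two integrations by parts at once: $H = \psi' \cos(x\xi) + x \psi \sin(x\xi)$ vanishes at both ends and has the
  derivative $\psi''\cos(x\xi) + x^2 \psi \cos(x\xi)$.\<close>

lemma cos_transform_mult_square:
  fixes \<psi> \<psi>' \<psi>'' :: "real \<Rightarrow> real"
  assumes \<rho>: "0 < \<rho>"
    and D1: "\<And>\<xi>. (\<psi> has_real_derivative \<psi>' \<xi>) (at \<xi>)"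
    and D2: "\<And>\<xi>. (\<psi>' has_real_derivative \<psi>'' \<xi>) (at \<xi>)"
    and cont: "continuous_on UNIV \<psi>''"
    and b0: "\<And>\<xi>. \<bar>\<psi> \<xi>\<bar> \<le> A0 / (1 + (\<xi> / \<rho>)\<^sup>2)"
    and b1: "\<And>\<xi>. \<bar>\<psi>' \<xi>\<bar> \<le> A1 / (1 + (\<xi> / \<rho>)\<^sup>2)"
    and b2: "\<And>\<xi>. \<bar>\<psi>'' \<xi>\<bar> \<le> A2 / (1 + (\<xi> / \<rho>)\<^sup>2)"
  shows "x\<^sup>2 * cos_transform \<psi> x = - cos_transform \<psi>'' x"
proof -
  define H where "H \<xi> = \<psi>' \<xi> * cos (x * \<xi>) + x * (\<psi> \<xi> * sin (x * \<xi>))" for \<xi>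
  define h where "h \<xi> = cos (x * \<xi>) * \<psi>'' \<xi> + x\<^sup>2 * (cos (x * \<xi>) * \<psi> \<xi>)" for \<xi>
  have c0: "continuous_on UNIV \<psi>" using D1 DERIV_continuous_on by (metis has_field_derivative_at_within)
  have m: "\<psi> \<in> borel_measurable borel" "\<psi>'' \<in> borel_measurable borel"
    using c0 cont by (auto intro: borel_measurable_continuous_onI)
  have i0: "integrable lborel \<psi>" and i2: "integrable lborel \<psi>''"
    using integrable_of_inverse_square_bound[OF \<rho>] m b0 b2 by blast+
  have ih: "integrable lborel h"
    unfolding h_def by (intro Bochner_Integration.integrable_add integrable_mult_right integrable_cos_mult i0 i2) auto
  have dH: "(H has_real_derivative h \<xi>) (at \<xi>)" for \<xi>
    unfolding H_def[abs_def] h_def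
    by (auto intro!: derivative_eq_intros D1[THEN DERIV_cong] D2[THEN DERIV_cong] simp: algebra_simps power2_eq_square)
  have lim: "(H \<longlongrightarrow> 0) F" if "(\<psi> \<longlongrightarrow> 0) F" "(\<psi>' \<longlongrightarrow> 0) F" for F
  proof -
    have "((\<lambda>\<xi>. \<bar>\<psi>' \<xi>\<bar> + \<bar>x\<bar> * \<bar>\<psi> \<xi>\<bar>) \<longlongrightarrow> 0) F"
      using tendsto_add[OF tendsto_rabs[OF that(2)] tendsto_mult_left[OF tendsto_rabs[OF that(1)], of "\<bar>x\<bar>"]] by simp
    then show ?thesis
    proof (rule Lim_null_comparison[rotated], intro always_eventually allI)
      fix \<xi>
      have "\<bar>H \<xi>\<bar> \<le> \<bar>\<psi>' \<xi> * cos (x * \<xi>)\<bar> + \<bar>x * (\<psi> \<xi> * sin (x * \<xi>))\<bar>"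
        unfolding H_def by (rule abs_triangle_ineq)
      also have "\<dots> \<le> \<bar>\<psi>' \<xi>\<bar> + \<bar>x\<bar> * \<bar>\<psi> \<xi>\<bar>"
        by (intro add_mono) (auto simp: abs_mult intro!: mult_left_mono mult_right_le_one_le)
      finally show "norm (H \<xi>) \<le> \<bar>\<psi>' \<xi>\<bar> + \<bar>x\<bar> * \<bar>\<psi> \<xi>\<bar>" by simp
    qed
  qed
  have ch: "isCont h \<xi>" for \<xi>
    using cont c0 unfolding h_def continuous_on_eq_continuous_at[OF open_UNIV]
    by (auto intro!: continuous_intros)
  have "(LBINT \<xi>=-\<infinity>..\<infinity>. h \<xi>) = 0 - 0"
  proof (rule interval_integral_FTC_integrable)
    show "((H \<circ> real_of_ereal) \<longlongrightarrow> 0) (at_right (-\<infinity>))"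
      using lim[OF tendsto_zero_of_inverse_square_bound(2)[OF \<rho> b0] tendsto_zero_of_inverse_square_bound(2)[OF \<rho> b1]]
      by (simp add: ereal_tendsto_simps)
    show "((H \<circ> real_of_ereal) \<longlongrightarrow> 0) (at_left \<infinity>)"
      using lim[OF tendsto_zero_of_inverse_square_bound(1)[OF \<rho> b0] tendsto_zero_of_inverse_square_bound(1)[OF \<rho> b1]]
      by (simp add: ereal_tendsto_simps)
    show "set_integrable lborel (einterval (-\<infinity>) \<infinity>) h"
      using ih by (simp add: set_integrable_def)
  qed (use dH ch in \<open>auto simp: has_real_derivative_iff_has_vector_derivative[symmetric]\<close>)
  then have "(\<integral>\<xi>. h \<xi> \<partial>lborel) = 0"
    by (simp add: interval_lebesgue_integral_def set_lebesgue_integral_def)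
  moreover have "(\<integral>\<xi>. h \<xi> \<partial>lborel) = (\<integral>\<xi>. cos (x * \<xi>) * \<psi>'' \<xi> \<partial>lborel) + x\<^sup>2 * (\<integral>\<xi>. cos (x * \<xi>) * \<psi> \<xi> \<partial>lborel)"
    unfolding h_def
    by (subst Bochner_Integration.integral_add)
       (auto intro!: integrable_cos_mult i0 i2 integrable_mult_right simp del: integral_mult_right_zero simp add: integral_mult_right_zero)
  ultimately show ?thesis by (simp add: cos_transform_def field_simps add_eq_0_iff)
qed

text \<open>The bound on $\psi$ controls the transform by $A\rho/2$, the bound on $\psi''$ controls $(\rho x)^2$ times the
  transform by the same quantity; their sum is a profile with integral $\pi A$ for every $\rho$.\<close>

lemma cos_transform_decay:
  fixes \<psi> \<psi>' \<psi>'' :: "real \<Rightarrow> real"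
  assumes \<rho>: "0 < \<rho>"
    and D1: "\<And>\<xi>. (\<psi> has_real_derivative \<psi>' \<xi>) (at \<xi>)"
    and D2: "\<And>\<xi>. (\<psi>' has_real_derivative \<psi>'' \<xi>) (at \<xi>)"
    and cont: "continuous_on UNIV \<psi>''"
    and b0: "\<And>\<xi>. \<bar>\<psi> \<xi>\<bar> \<le> A / (1 + (\<xi> / \<rho>)\<^sup>2)"
    and b1: "\<And>\<xi>. \<bar>\<psi>' \<xi>\<bar> \<le> A1 / (1 + (\<xi> / \<rho>)\<^sup>2)"
    and b2: "\<And>\<xi>. \<bar>\<psi>'' \<xi>\<bar> \<le> A / \<rho>\<^sup>2 / (1 + (\<xi> / \<rho>)\<^sup>2)"
  shows "\<bar>cos_transform \<psi> x\<bar> \<le> A * \<rho> * (1 / (1 + (\<rho> * x)\<^sup>2))"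
proof -
  have c0: "continuous_on UNIV \<psi>" using D1 DERIV_continuous_on by (metis has_field_derivative_at_within)
  have m: "\<psi> \<in> borel_measurable borel" "\<psi>'' \<in> borel_measurable borel"
    using c0 cont by (auto intro: borel_measurable_continuous_onI)
  have "\<bar>cos_transform \<psi> x\<bar> \<le> A * (\<rho> * pi) / (2 * pi)"
    using abs_cos_transform_le[of \<psi> x] integrable_of_inverse_square_bound[OF \<rho> m(1) b0]
    by (meson divide_right_mono order_trans pi_ge_zero mult_nonneg_nonneg zero_le_numeral)
  then have 1: "\<bar>cos_transform \<psi> x\<bar> \<le> A * \<rho> / 2" by simp
  have "\<bar>cos_transform \<psi>'' x\<bar> \<le> A / \<rho>\<^sup>2 * (\<rho> * pi) / (2 * pi)"
    using abs_cos_transform_le[of \<psi>'' x] integrable_of_inverse_square_bound[OF \<rho> m(2) b2]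
    by (meson divide_right_mono order_trans pi_ge_zero mult_nonneg_nonneg zero_le_numeral)
  then have "\<bar>x\<^sup>2 * cos_transform \<psi> x\<bar> \<le> A / \<rho>\<^sup>2 * (\<rho> * pi) / (2 * pi)"
    using cos_transform_mult_square[OF \<rho> D1 D2 cont b0 b1 b2, of x] by simp
  then have "\<rho>\<^sup>2 * (x\<^sup>2 * \<bar>cos_transform \<psi> x\<bar>) \<le> \<rho>\<^sup>2 * (A / \<rho>\<^sup>2 * (\<rho> * pi) / (2 * pi))"
    by (intro mult_left_mono) (auto simp: abs_mult)
  then have 2: "(\<rho> * x)\<^sup>2 * \<bar>cos_transform \<psi> x\<bar> \<le> A * \<rho> / 2"
    using \<rho> by (simp add: power_mult_distrib mult.assoc)
  have "(1 + (\<rho> * x)\<^sup>2) * \<bar>cos_transform \<psi> x\<bar> \<le> A * \<rho>"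
    using 1 2 by (simp add: algebra_simps)
  moreover have "0 < 1 + (\<rho> * x)\<^sup>2" by (intro add_pos_nonneg) auto
  ultimately show ?thesis by (simp add: field_simps)
qed

lemma nn_integral_abs_le_of_decay:
  fixes g :: "real \<Rightarrow> real"
  assumes \<rho>: "0 < \<rho>" and b: "\<And>x. \<bar>g x\<bar> \<le> A * \<rho> * (1 / (1 + (\<rho> * x)\<^sup>2))"
  shows "L1_norm g \<le> ennreal (A * pi)"
proof -
  have A: "0 \<le> A * \<rho>" using order_trans[OF abs_ge_zero b[of 0]] by simp
  have "L1_norm g \<le> (\<integral>\<^sup>+x. ennreal (A * \<rho> * (1 / (1 + (x / (1/\<rho>))\<^sup>2))) \<partial>lborel)"
    using b by (intro nn_integral_mono ennreal_leI) (simp add: mult.commute)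
  also have "\<dots> = ennreal (\<integral>x. A * \<rho> * (1 / (1 + (x / (1/\<rho>))\<^sup>2)) \<partial>lborel)"
    using \<rho> A by (intro nn_integral_eq_integral integrable_mult_right integrable_inverse_square_scaled) auto
  also have "\<dots> = ennreal (A * pi)"
    unfolding integral_mult_right_zero using \<rho> by (subst integral_inverse_square_scaled) auto
  finally show ?thesis .
qed

section \<open>The exponent of the small jumps\<close>

text \<open>A quadratic error in the first order expansion survives integration against a measure, which makes this form of
  differentiability convenient for parameter integrals.\<close>

lemma has_real_derivative_of_quadratic_error:
  fixes F :: "real \<Rightarrow> real"
  assumes "\<And>h. \<bar>F (x + h) - F x - h * d\<bar> \<le> K * h\<^sup>2"
  shows "(F has_real_derivative d) (at x)"
  unfolding DERIV_def
proof (rule LIM_I)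
  fix r :: real assume r: "0 < r"
  have K: "0 \<le> K" using order_trans[OF abs_ge_zero assms[of 1]] by simp
  show "\<exists>s>0. \<forall>h. h \<noteq> 0 \<and> norm (h - 0) < s \<longrightarrow> norm ((F (x + h) - F x) / h - d) < r"
  proof (intro exI[of _ "r / (K + 1)"] conjI allI impI)
    show "0 < r / (K + 1)" using r K by simp
    fix h :: real assume h: "h \<noteq> 0 \<and> norm (h - 0) < r / (K + 1)"
    have "\<bar>(F (x + h) - F x) / h - d\<bar> = \<bar>F (x + h) - F x - h * d\<bar> / \<bar>h\<bar>"
      using h by (simp add: abs_divide[symmetric] diff_divide_distrib)
    also have "\<dots> \<le> K * h\<^sup>2 / \<bar>h\<bar>" using assms by (intro divide_right_mono) auto
    also have "\<dots> = K * \<bar>h\<bar>" using h by (simp add: power2_eq_square abs_if)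
    also have "\<dots> \<le> (K + 1) * \<bar>h\<bar>" by (simp add: algebra_simps)
    also have "\<dots> < r" using h K by (simp add: field_simps)
    finally show "norm ((F (x + h) - F x) / h - d) < r" by simp
  qed
qed

lemma abs_sin_minus_self_le: "\<bar>sin k - k\<bar> \<le> (k::real)\<^sup>2 / 2"
  using Maclaurin_sin_bound[of k 2] by (simp add: eval_nat_numeral sin_coeff_def)

lemma abs_mult_le_of_abs_le_1: "\<bar>a\<bar> \<le> 1 \<Longrightarrow> \<bar>b\<bar> \<le> c \<Longrightarrow> \<bar>a * b\<bar> \<le> (c::real)"
  by (simp add: abs_mult) (meson abs_ge_zero mult_left_le_one_le order_trans)

lemma cos_quadratic_error: "\<bar>(1 - cos (a + k)) - (1 - cos a) - k * sin a\<bar> \<le> (k::real)\<^sup>2"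
proof -
  have "(1 - cos (a + k)) - (1 - cos a) - k * sin a = cos a * (1 - cos k) + sin a * (sin k - k)"
    by (simp add: cos_add algebra_simps)
  moreover have "\<bar>cos a * (1 - cos k)\<bar> \<le> k\<^sup>2 / 2"
    using one_minus_cos_le_half_square[of k] by (intro abs_mult_le_of_abs_le_1) auto
  moreover have "\<bar>sin a * (sin k - k)\<bar> \<le> k\<^sup>2 / 2"
    by (intro abs_mult_le_of_abs_le_1 abs_sin_minus_self_le) auto
  ultimately show ?thesis by linarith
qed

lemma sin_quadratic_error: "\<bar>sin (a + k) - sin a - k * cos a\<bar> \<le> (k::real)\<^sup>2"
proof -
  have "sin (a + k) - sin a - k * cos a = cos a * (sin k - k) - sin a * (1 - cos k)"
    by (simp add: sin_add algebra_simps)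
  moreover have "\<bar>sin a * (1 - cos k)\<bar> \<le> k\<^sup>2 / 2"
    using one_minus_cos_le_half_square[of k] by (intro abs_mult_le_of_abs_le_1) auto
  moreover have "\<bar>cos a * (sin k - k)\<bar> \<le> k\<^sup>2 / 2"
    by (intro abs_mult_le_of_abs_le_1 abs_sin_minus_self_le) auto
  ultimately show ?thesis by linarith
qed

lemma abs_cos_diff_le: "\<bar>cos x - cos y\<bar> \<le> \<bar>x - (y::real)\<bar>"
proof -
  have "cos x - cos y = 2 * (sin ((x + y) / 2) * sin ((y - x) / 2))"
    by (simp add: cos_diff_cos)
  moreover have "\<bar>sin ((x + y) / 2) * sin ((y - x) / 2)\<bar> \<le> \<bar>(y - x) / 2\<bar>"
    by (intro abs_mult_le_of_abs_le_1 abs_sin_x_le_abs_x) auto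
  ultimately show ?thesis by (simp add: abs_mult)
qed

lemma abs_mult_sin_le: "\<bar>u * sin (\<xi> * u)\<bar> \<le> \<bar>\<xi>\<bar> * (u::real)\<^sup>2"
proof -
  have "\<bar>u * sin (\<xi> * u)\<bar> \<le> \<bar>u\<bar> * \<bar>\<xi> * u\<bar>"
    unfolding abs_mult[of u] by (intro mult_left_mono abs_sin_x_le_abs_x) auto
  then show ?thesis
    by (simp add: abs_mult power2_eq_square mult.commute mult.left_commute)
qed

context levy_setting
begin

abbreviation small :: "real \<Rightarrow> real \<Rightarrow> real" where
  "small \<rho> u \<equiv> indicat_real {u. \<bar>u\<bar> \<le> 1 / \<rho>} u"

definition small_exponent :: "real \<Rightarrow> real \<Rightarrow> real" where
  "small_exponent \<rho> \<xi> = (\<integral>u. small \<rho> u * (1 - cos (\<xi> * u)) \<partial>\<mu>)"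

definition small_exponent' :: "real \<Rightarrow> real \<Rightarrow> real" where
  "small_exponent' \<rho> \<xi> = (\<integral>u. small \<rho> u * (u * sin (\<xi> * u)) \<partial>\<mu>)"

definition small_exponent'' :: "real \<Rightarrow> real \<Rightarrow> real" where
  "small_exponent'' \<rho> \<xi> = (\<integral>u. small \<rho> u * (u\<^sup>2 * cos (\<xi> * u)) \<partial>\<mu>)"

definition small_variance :: "real \<Rightarrow> real" where
  "small_variance \<rho> = (\<integral>u. small \<rho> u * u\<^sup>2 \<partial>\<mu>)"

lemma integrable_small:
  fixes f :: "real \<Rightarrow> real"
  assumes "0 < \<rho>" "f \<in> borel_measurable borel" "\<And>u. \<bar>u\<bar> \<le> 1 / \<rho> \<Longrightarrow> \<bar>f u\<bar> \<le> K * u\<^sup>2"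
  shows "integrable \<mu> (\<lambda>u. small \<rho> u * f u)"
proof (rule integrable_if_le_min_1_square[of _ "\<bar>K\<bar> * max 1 ((1/\<rho>)\<^sup>2)"])
  fix u
  show "\<bar>small \<rho> u * f u\<bar> \<le> \<bar>K\<bar> * max 1 ((1/\<rho>)\<^sup>2) * min 1 (u\<^sup>2)"
  proof (cases "\<bar>u\<bar> \<le> 1 / \<rho>")
    case True
    have "u\<^sup>2 \<le> (1/\<rho>)\<^sup>2" using True assms(1) unfolding abs_le_square_iff[symmetric] by simp
    then have "u\<^sup>2 \<le> max 1 ((1/\<rho>)\<^sup>2) * min 1 (u\<^sup>2)"
      using mult_right_mono[of 1 "max 1 ((1/\<rho>)\<^sup>2)" "u\<^sup>2"] by (cases "u\<^sup>2 \<le> 1") auto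
    then have "\<bar>K\<bar> * u\<^sup>2 \<le> \<bar>K\<bar> * (max 1 ((1/\<rho>)\<^sup>2) * min 1 (u\<^sup>2))"
      by (intro mult_left_mono) auto
    moreover have "\<bar>f u\<bar> \<le> \<bar>K\<bar> * u\<^sup>2"
      using assms(3)[OF True] by (meson abs_ge_self mult_right_mono order_trans zero_le_power2)
    ultimately show ?thesis using True by (simp add: mult.assoc)
  qed (simp add: mult_nonneg_nonneg)
qed (use assms in measurable)

text \<open>All integrals over the small jumps are measured by their variance $\int_{|u| \le 1/\rho} u^2\,\mu(du)$.\<close>

lemma integral_small_le:
  fixes f :: "real \<Rightarrow> real"
  assumes "0 < \<rho>" "f \<in> borel_measurable borel" "\<And>u. \<bar>u\<bar> \<le> 1 / \<rho> \<Longrightarrow> \<bar>f u\<bar> \<le> K * u\<^sup>2"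
  shows "\<bar>\<integral>u. small \<rho> u * f u \<partial>\<mu>\<bar> \<le> K * small_variance \<rho>"
proof -
  have "\<bar>\<integral>u. small \<rho> u * f u \<partial>\<mu>\<bar> \<le> (\<integral>u. K * (small \<rho> u * u\<^sup>2) \<partial>\<mu>)"
  proof (rule integral_abs_bound_integral)
    show "integrable \<mu> (\<lambda>u. small \<rho> u * f u)" by (rule integrable_small) fact+
    show "integrable \<mu> (\<lambda>u. K * (small \<rho> u * u\<^sup>2))"
      using assms(1) by (intro integrable_mult_right integrable_small[where K = 1]) auto
    show "\<bar>small \<rho> u * f u\<bar> \<le> K * (small \<rho> u * u\<^sup>2)" for u
      using assms(3)[of u] by (auto simp: indicator_def)
  qed
  then show ?thesis by (simp add: small_variance_def)
qed

lemma small_variance_nonneg: "0 \<le> small_variance \<rho>"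
  unfolding small_variance_def by (intro integral_nonneg_AE) auto

text \<open>On $|u| \le 1/\rho$ the integrand of $q^U(\rho)$ equals $\rho^2u^2$. At the right scale the variance of the small
  jumps over the time $t$ is therefore of order $\rho^{-2}$.\<close>

lemma small_variance_le:
  assumes "0 < \<rho>"
  shows "small_variance \<rho> \<le> q_upper \<mu> \<rho> / \<rho>\<^sup>2"
proof -
  have "small_variance \<rho> \<le> (\<integral>u. min ((\<rho> * u)\<^sup>2) 1 / \<rho>\<^sup>2 \<partial>\<mu>)"
    unfolding small_variance_def
  proof (rule integral_mono)
    show "integrable \<mu> (\<lambda>u. small \<rho> u * u\<^sup>2)"
      using assms by (intro integrable_small[where K = 1]) auto
    show "integrable \<mu> (\<lambda>u. min ((\<rho> * u)\<^sup>2) 1 / \<rho>\<^sup>2)" using integrable_q_upper by simp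
    fix u
    have "(\<rho> * u)\<^sup>2 \<le> 1" if "\<bar>u\<bar> \<le> 1 / \<rho>"
      using that assms unfolding abs_square_le_1 by (simp add: abs_mult field_simps)
    then show "small \<rho> u * u\<^sup>2 \<le> min ((\<rho> * u)\<^sup>2) 1 / \<rho>\<^sup>2"
      using assms by (auto simp: indicator_def power_mult_distrib)
  qed
  then show ?thesis by (simp add: q_upper_def)
qed

lemma abs_small_exponent'_le:
  assumes "0 < \<rho>"
  shows "\<bar>small_exponent' \<rho> \<xi>\<bar> \<le> \<bar>\<xi>\<bar> * small_variance \<rho>"
  unfolding small_exponent'_def
  by (rule integral_small_le[OF assms]) (auto intro: abs_mult_sin_le)

lemma abs_small_exponent''_le:
  assumes "0 < \<rho>"
  shows "\<bar>small_exponent'' \<rho> \<xi>\<bar> \<le> small_variance \<rho>"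
proof -
  have "\<bar>small_exponent'' \<rho> \<xi>\<bar> \<le> 1 * small_variance \<rho>"
    unfolding small_exponent''_def
    by (rule integral_small_le[OF assms]) (auto simp: abs_mult mult_left_le)
  then show ?thesis by simp
qed

lemma integrable_small_1_minus_cos:
  assumes "0 < \<rho>" shows "integrable \<mu> (\<lambda>u. small \<rho> u * (1 - cos (\<xi> * u)))"
proof (rule integrable_small[where K = "\<xi>\<^sup>2 / 2", OF assms])
  show "\<bar>1 - cos (\<xi> * u)\<bar> \<le> \<xi>\<^sup>2 / 2 * u\<^sup>2" for u
    using one_minus_cos_le_half_square[of "\<xi> * u"] by (simp add: power_mult_distrib)
qed measurable

lemma integrable_small_sin:
  assumes "0 < \<rho>" shows "integrable \<mu> (\<lambda>u. small \<rho> u * (u * sin (\<xi> * u)))"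
  by (rule integrable_small[where K = "\<bar>\<xi>\<bar>", OF assms]) (auto intro: abs_mult_sin_le)

lemma integrable_small_cos:
  assumes "0 < \<rho>" shows "integrable \<mu> (\<lambda>u. small \<rho> u * (u\<^sup>2 * cos (\<xi> * u)))"
  by (rule integrable_small[where K = 1, OF assms]) (auto simp: abs_mult mult_left_le)

lemma has_derivative_small_exponent:
  assumes \<rho>: "0 < \<rho>"
  shows "(small_exponent \<rho> has_real_derivative small_exponent' \<rho> \<xi>) (at \<xi>)"
proof (rule has_real_derivative_of_quadratic_error)
  fix h
  have "small_exponent \<rho> (\<xi> + h) - small_exponent \<rho> \<xi> - h * small_exponent' \<rho> \<xi>
      = (\<integral>u. small \<rho> u * (1 - cos ((\<xi> + h) * u)) - small \<rho> u * (1 - cos (\<xi> * u))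
              - h * (small \<rho> u * (u * sin (\<xi> * u))) \<partial>\<mu>)"
    unfolding small_exponent_def small_exponent'_def
    by (simp only: Bochner_Integration.integral_diff integral_mult_right_zero
        integrable_small_1_minus_cos[OF \<rho>] integrable_small_sin[OF \<rho>]
        Bochner_Integration.integrable_diff integrable_mult_right)
  also have "\<dots> = (\<integral>u. small \<rho> u * ((1 - cos (\<xi> * u + h * u)) - (1 - cos (\<xi> * u)) - h * u * sin (\<xi> * u)) \<partial>\<mu>)"
    by (intro Bochner_Integration.integral_cong refl) (simp add: algebra_simps)
  finally show "\<bar>small_exponent \<rho> (\<xi> + h) - small_exponent \<rho> \<xi> - h * small_exponent' \<rho> \<xi>\<bar>
      \<le> small_variance \<rho> * h\<^sup>2"
    using integral_small_le[OF \<rho>, of "\<lambda>u. (1 - cos (\<xi> * u + h * u)) - (1 - cos (\<xi> * u)) - h * u * sin (\<xi> * u)" "h\<^sup>2"]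
      cos_quadratic_error[of "\<xi> * _" "h * _"]
    by (simp add: power_mult_distrib mult.commute)
qed

lemma has_derivative_small_exponent':
  assumes \<rho>: "0 < \<rho>"
  shows "(small_exponent' \<rho> has_real_derivative small_exponent'' \<rho> \<xi>) (at \<xi>)"
proof (rule has_real_derivative_of_quadratic_error)
  fix h
  let ?e = "\<lambda>u. u * (sin (\<xi> * u + h * u) - sin (\<xi> * u) - h * u * cos (\<xi> * u))"
  have "small_exponent' \<rho> (\<xi> + h) - small_exponent' \<rho> \<xi> - h * small_exponent'' \<rho> \<xi>
      = (\<integral>u. small \<rho> u * (u * sin ((\<xi> + h) * u)) - small \<rho> u * (u * sin (\<xi> * u))
              - h * (small \<rho> u * (u\<^sup>2 * cos (\<xi> * u))) \<partial>\<mu>)"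
    unfolding small_exponent'_def small_exponent''_def
    by (simp only: Bochner_Integration.integral_diff integral_mult_right_zero
        integrable_small_cos[OF \<rho>] integrable_small_sin[OF \<rho>]
        Bochner_Integration.integrable_diff integrable_mult_right)
  also have "\<dots> = (\<integral>u. small \<rho> u * ?e u \<partial>\<mu>)"
    by (intro Bochner_Integration.integral_cong refl) (simp add: algebra_simps power2_eq_square)
  finally have *: "small_exponent' \<rho> (\<xi> + h) - small_exponent' \<rho> \<xi> - h * small_exponent'' \<rho> \<xi>
      = (\<integral>u. small \<rho> u * ?e u \<partial>\<mu>)" .
  have "\<bar>\<integral>u. small \<rho> u * ?e u \<partial>\<mu>\<bar> \<le> (1 / \<rho> * h\<^sup>2) * small_variance \<rho>"
  proof (rule integral_small_le[OF \<rho>])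
    fix u :: real assume u: "\<bar>u\<bar> \<le> 1 / \<rho>"
    have "\<bar>?e u\<bar> \<le> 1 / \<rho> * (h * u)\<^sup>2"
      unfolding abs_mult[of u] using u \<rho> by (intro mult_mono sin_quadratic_error) auto
    then show "\<bar>?e u\<bar> \<le> 1 / \<rho> * h\<^sup>2 * u\<^sup>2" by (simp add: power_mult_distrib)
  qed measurable
  then show "\<bar>small_exponent' \<rho> (\<xi> + h) - small_exponent' \<rho> \<xi> - h * small_exponent'' \<rho> \<xi>\<bar>
      \<le> (1 / \<rho> * small_variance \<rho>) * h\<^sup>2"
    unfolding * by (simp add: mult.commute mult.left_commute)
qed

lemma continuous_small_exponent'':
  assumes \<rho>: "0 < \<rho>"
  shows "continuous_on UNIV (small_exponent'' \<rho>)"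
proof (rule lipschitz_on_continuous_on)
  show "(1 / \<rho> * small_variance \<rho>)-lipschitz_on UNIV (small_exponent'' \<rho>)"
  proof (rule lipschitz_onI)
    fix \<xi> \<zeta> :: real
    let ?e = "\<lambda>u. u\<^sup>2 * (cos (\<xi> * u) - cos (\<zeta> * u))"
    have "small_exponent'' \<rho> \<xi> - small_exponent'' \<rho> \<zeta>
        = (\<integral>u. small \<rho> u * (u\<^sup>2 * cos (\<xi> * u)) - small \<rho> u * (u\<^sup>2 * cos (\<zeta> * u)) \<partial>\<mu>)"
      unfolding small_exponent''_def
      by (simp only: Bochner_Integration.integral_diff integrable_small_cos[OF \<rho>])
    also have "\<dots> = (\<integral>u. small \<rho> u * ?e u \<partial>\<mu>)"
      by (simp only: right_diff_distrib)
    also have "\<bar>\<dots>\<bar> \<le> (\<bar>\<xi> - \<zeta>\<bar> * (1 / \<rho>)) * small_variance \<rho>"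
    proof (rule integral_small_le[OF \<rho>])
      fix u :: real assume u: "\<bar>u\<bar> \<le> 1 / \<rho>"
      have "\<bar>cos (\<xi> * u) - cos (\<zeta> * u)\<bar> \<le> \<bar>\<xi> * u - \<zeta> * u\<bar>" by (rule abs_cos_diff_le)
      also have "\<dots> = \<bar>\<xi> - \<zeta>\<bar> * \<bar>u\<bar>" by (simp add: abs_mult[symmetric] left_diff_distrib)
      also have "\<dots> \<le> \<bar>\<xi> - \<zeta>\<bar> * (1 / \<rho>)" using u by (intro mult_left_mono) auto
      finally have "u\<^sup>2 * \<bar>cos (\<xi> * u) - cos (\<zeta> * u)\<bar> \<le> u\<^sup>2 * (\<bar>\<xi> - \<zeta>\<bar> * (1 / \<rho>))"
        by (intro mult_left_mono) auto
      then show "\<bar>?e u\<bar> \<le> \<bar>\<xi> - \<zeta>\<bar> * (1 / \<rho>) * u\<^sup>2" by (simp add: abs_mult mult.commute)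
    qed measurable
    finally show "dist (small_exponent'' \<rho> \<xi>) (small_exponent'' \<rho> \<zeta>) \<le> 1 / \<rho> * small_variance \<rho> * dist \<xi> \<zeta>"
      by (simp add: dist_real_def mult.commute mult.left_commute)
  qed (use \<rho> small_variance_nonneg in simp)
qed

text \<open>Dropping the jumps larger than $1/\rho$ changes $tq$ by at most a constant when $t q^U(\rho)$ is bounded, so
  the decay of $e^{-tq}$ is inherited by the small jumps.\<close>

lemma levy_exponent_le_small_exponent:
  assumes \<rho>: "0 < \<rho>"
  shows "levy_exponent \<mu> \<xi> \<le> small_exponent \<rho> \<xi> + 2 * q_upper \<mu> \<rho>"
proof -
  have "levy_exponent \<mu> \<xi> \<le> (\<integral>u. small \<rho> u * (1 - cos (\<xi> * u)) + 2 * min ((\<rho> * u)\<^sup>2) 1 \<partial>\<mu>)"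
    unfolding levy_exponent_def
  proof (intro integral_mono integrable_levy_exponent Bochner_Integration.integrable_add
      integrable_small_1_minus_cos \<rho> integrable_mult_right integrable_q_upper)
    fix u
    show "1 - cos (\<xi> * u) \<le> small \<rho> u * (1 - cos (\<xi> * u)) + 2 * min ((\<rho> * u)\<^sup>2) 1"
      using one_minus_cos_le_2[of "\<xi> * u"] min_square_eq_1[OF \<rho>, of u]
      by (cases "\<bar>u\<bar> \<le> 1 / \<rho>") auto
  qed
  also have "\<dots> = small_exponent \<rho> \<xi> + 2 * q_upper \<mu> \<rho>"
    unfolding small_exponent_def q_upper_def
    by (subst Bochner_Integration.integral_add)
       (auto intro!: integrable_small_1_minus_cos \<rho> integrable_mult_right integrable_q_upper)
  finally show ?thesis .
qed

end

section \<open>Finite measures of jumps contract $L^1$\<close>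

lemma measurable_cos_transform [measurable]:
  assumes [measurable]: "\<psi> \<in> borel_measurable borel"
  shows "cos_transform \<psi> \<in> borel_measurable borel"
  unfolding cos_transform_def[abs_def] by measurable

text \<open>A finite measure \<open>\<nu>\<close> with total mass $\Lambda$ and cosine transform \<open>ft\<close>. In the application it is
  the restriction of the jump measure to large jumps.\<close>

locale finite_borel_measure = finite_measure \<nu> for \<nu> :: "real measure" +
  assumes sets_\<nu> [measurable_cong, simp]: "sets \<nu> = sets borel"
begin

lemma space_\<nu> [simp]: "space \<nu> = UNIV"
  using sets_eq_imp_space_eq[OF sets_\<nu>] by simp

definition ft :: "real \<Rightarrow> real" where "ft \<xi> = (\<integral>v. cos (\<xi> * v) \<partial>\<nu>)"

lemma measurable_ft [measurable]: "ft \<in> borel_measurable borel"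
  unfolding ft_def[abs_def] by measurable

lemma abs_ft_le: "\<bar>ft \<xi>\<bar> \<le> measure \<nu> UNIV"
proof -
  have "\<bar>\<integral>v. cos (\<xi> * v) \<partial>\<nu>\<bar> \<le> (\<integral>v. 1 \<partial>\<nu>)"
    by (rule integral_abs_bound_integral) (auto intro!: integrable_const_bound[where B = 1])
  then show ?thesis by (simp add: ft_def)
qed

lemma integrable_mult_bounded_power:
  assumes "integrable lborel \<psi>"
  shows "integrable lborel (\<lambda>\<xi>. \<psi> \<xi> * ft \<xi> ^ k)"
proof (rule Bochner_Integration.integrable_bound[OF integrable_mult_right[OF assms, of "measure \<nu> UNIV ^ k"]])
  show "AE \<xi> in lborel. norm (\<psi> \<xi> * ft \<xi> ^ k) \<le> norm (measure \<nu> UNIV ^ k * \<psi> \<xi>)"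
  proof (rule AE_I2)
    fix \<xi>
    have "\<bar>ft \<xi>\<bar> ^ k \<le> measure \<nu> UNIV ^ k" by (intro power_mono abs_ft_le) auto
    then show "norm (\<psi> \<xi> * ft \<xi> ^ k) \<le> norm (measure \<nu> UNIV ^ k * \<psi> \<xi>)"
      by (simp add: abs_mult power_abs mult.commute mult_left_mono)
  qed
qed (use assms in measurable)

text \<open>Multiplication by the transform of a measure is averaging of translates, by
  $\cos(x\xi)\cos(\xi v) = \frac12(\cos((x+v)\xi) + \cos((x-v)\xi))$.\<close>

lemma cos_transform_mult_ft:
  assumes "integrable lborel \<psi>"
  shows "cos_transform (\<lambda>\<xi>. \<psi> \<xi> * ft \<xi>) x
    = (\<integral>v. (cos_transform \<psi> (x + v) + cos_transform \<psi> (x - v)) / 2 \<partial>\<nu>)"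
proof -
  have [measurable]: "\<psi> \<in> borel_measurable borel" using assms by auto
  interpret pair_sigma_finite lborel \<nu> ..
  have int: "integrable (lborel \<Otimes>\<^sub>M \<nu>) (\<lambda>(\<xi>, v). cos (x * \<xi>) * (\<psi> \<xi> * cos (\<xi> * v)))"
  proof (rule Bochner_Integration.integrable_bound)
    show "integrable (lborel \<Otimes>\<^sub>M \<nu>) (\<lambda>(\<xi>, v). \<psi> \<xi>)"
      by (rule Fubini_integrable) (auto simp: assms)
    show "AE p in lborel \<Otimes>\<^sub>M \<nu>. norm (case p of (\<xi>, v) \<Rightarrow> cos (x * \<xi>) * (\<psi> \<xi> * cos (\<xi> * v)))
        \<le> norm (case p of (\<xi>, v) \<Rightarrow> \<psi> \<xi>)"
      by (intro AE_I2) (auto simp: abs_mult split: prod.splits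
          intro!: mult_left_le_one_le mult_left_le order_trans[OF mult_left_le_one_le])
  qed measurable
  have "(\<integral>\<xi>. cos (x * \<xi>) * (\<psi> \<xi> * ft \<xi>) \<partial>lborel)
      = (\<integral>\<xi>. (\<integral>v. cos (x * \<xi>) * (\<psi> \<xi> * cos (\<xi> * v)) \<partial>\<nu>) \<partial>lborel)"
    by (simp add: ft_def)
  also have "\<dots> = (\<integral>v. (\<integral>\<xi>. cos (x * \<xi>) * (\<psi> \<xi> * cos (\<xi> * v)) \<partial>lborel) \<partial>\<nu>)"
    using Fubini_integral[OF int] by simp
  also have "\<dots> = (\<integral>v. ((\<integral>\<xi>. cos ((x + v) * \<xi>) * \<psi> \<xi> \<partial>lborel) + (\<integral>\<xi>. cos ((x - v) * \<xi>) * \<psi> \<xi> \<partial>lborel)) / 2 \<partial>\<nu>)"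
  proof (rule Bochner_Integration.integral_cong[OF refl])
    fix v
    have "(\<integral>\<xi>. cos ((x + v) * \<xi>) * \<psi> \<xi> \<partial>lborel) + (\<integral>\<xi>. cos ((x - v) * \<xi>) * \<psi> \<xi> \<partial>lborel)
      = (\<integral>\<xi>. cos ((x + v) * \<xi>) * \<psi> \<xi> + cos ((x - v) * \<xi>) * \<psi> \<xi> \<partial>lborel)"
      by (rule Bochner_Integration.integral_add[symmetric]) (auto intro!: integrable_cos_mult assms)
    also have "\<dots> = (\<integral>\<xi>. 2 * (cos (x * \<xi>) * (\<psi> \<xi> * cos (\<xi> * v))) \<partial>lborel)"
      by (intro Bochner_Integration.integral_cong refl)
         (simp add: cos_add cos_diff algebra_simps)
    finally show "(\<integral>\<xi>. cos (x * \<xi>) * (\<psi> \<xi> * cos (\<xi> * v)) \<partial>lborel)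
      = ((\<integral>\<xi>. cos ((x + v) * \<xi>) * \<psi> \<xi> \<partial>lborel) + (\<integral>\<xi>. cos ((x - v) * \<xi>) * \<psi> \<xi> \<partial>lborel)) / 2"
      by simp
  qed
  finally have "cos_transform (\<lambda>\<xi>. \<psi> \<xi> * ft \<xi>) x
      = (\<integral>v. ((\<integral>\<xi>. cos ((x + v) * \<xi>) * \<psi> \<xi> \<partial>lborel) + (\<integral>\<xi>. cos ((x - v) * \<xi>) * \<psi> \<xi> \<partial>lborel)) / 2 / (2 * pi) \<partial>\<nu>)"
    unfolding cos_transform_def by (simp only: integral_divide_zero)
  also have "(\<lambda>v. ((\<integral>\<xi>. cos ((x + v) * \<xi>) * \<psi> \<xi> \<partial>lborel) + (\<integral>\<xi>. cos ((x - v) * \<xi>) * \<psi> \<xi> \<partial>lborel)) / 2 / (2 * pi))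
      = (\<lambda>v. (cos_transform \<psi> (x + v) + cos_transform \<psi> (x - v)) / 2)"
    by (rule ext) (simp add: cos_transform_def add_divide_distrib)
  finally show ?thesis .
qed

lemma L1_cos_transform_mult_ft:
  assumes "integrable lborel \<psi>"
  shows "L1_norm (cos_transform (\<lambda>\<xi>. \<psi> \<xi> * ft \<xi>))
    \<le> ennreal (measure \<nu> UNIV) * L1_norm (cos_transform \<psi>)"
proof -
  have [measurable]: "\<psi> \<in> borel_measurable borel" using assms by auto
  interpret pair_sigma_finite lborel \<nu> ..
  define N where "N = L1_norm (cos_transform \<psi>)"
  let ?g = "\<lambda>x v. (cos_transform \<psi> (x + v) + cos_transform \<psi> (x - v)) / 2"
  have inner: "(\<integral>\<^sup>+x. ennreal \<bar>?g x v\<bar> \<partial>lborel) \<le> N" for v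
  proof -
    have shift: "(\<integral>\<^sup>+x. ennreal \<bar>cos_transform \<psi> (x + w)\<bar> \<partial>lborel) = N" for w
      unfolding N_def
      by (subst (2) nn_integral_real_affine[of _ 1 w]) (auto simp: add.commute)
    have "(\<integral>\<^sup>+x. ennreal \<bar>?g x v\<bar> \<partial>lborel)
      \<le> (\<integral>\<^sup>+x. ennreal (1/2) * (ennreal \<bar>cos_transform \<psi> (x + v)\<bar> + ennreal \<bar>cos_transform \<psi> (x + (- v))\<bar>) \<partial>lborel)"
    proof (intro nn_integral_mono)
      fix x
      have "\<bar>?g x v\<bar> \<le> 1 / 2 * (\<bar>cos_transform \<psi> (x + v)\<bar> + \<bar>cos_transform \<psi> (x + (- v))\<bar>)"
        by simp
      then have "ennreal \<bar>?g x v\<bar> \<le> ennreal (1 / 2 * (\<bar>cos_transform \<psi> (x + v)\<bar> + \<bar>cos_transform \<psi> (x + (- v))\<bar>))"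
        by (rule ennreal_leI)
      also have "\<dots> = ennreal (1/2) * (ennreal \<bar>cos_transform \<psi> (x + v)\<bar> + ennreal \<bar>cos_transform \<psi> (x + (- v))\<bar>)"
        by (subst ennreal_mult) auto
      finally show "ennreal \<bar>?g x v\<bar>
        \<le> ennreal (1/2) * (ennreal \<bar>cos_transform \<psi> (x + v)\<bar> + ennreal \<bar>cos_transform \<psi> (x + (- v))\<bar>)" .
    qed
    also have "\<dots> = ennreal (1/2) * (N + N)"
      by (subst nn_integral_cmult, measurable, subst nn_integral_add, measurable) (simp only: shift)
    also have "\<dots> = ennreal (1/2) * 2 * N"
      by (simp add: mult_2[symmetric] mult.assoc)
    also have "ennreal (1/2) * 2 = 1"
      by (metis ennreal_1 ennreal_mult ennreal_numeral mult.commute nonzero_eq_divide_eq zero_le_numeral zero_neq_numeral zero_le_divide_1_iff)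
    finally show ?thesis by simp
  qed
  have "L1_norm (cos_transform (\<lambda>\<xi>. \<psi> \<xi> * ft \<xi>)) \<le> (\<integral>\<^sup>+x. (\<integral>\<^sup>+v. ennreal \<bar>?g x v\<bar> \<partial>\<nu>) \<partial>lborel)"
    unfolding cos_transform_mult_ft[OF assms]
  proof (rule nn_integral_mono)
    fix x
    show "ennreal \<bar>\<integral>v. ?g x v \<partial>\<nu>\<bar> \<le> (\<integral>\<^sup>+v. ennreal \<bar>?g x v\<bar> \<partial>\<nu>)"
      using integral_norm_bound_ennreal[of \<nu> "?g x"] not_integrable_integral_eq[of \<nu> "?g x"]
      by (cases "integrable \<nu> (?g x)") auto
  qed
  also have "\<dots> = (\<integral>\<^sup>+v. (\<integral>\<^sup>+x. ennreal \<bar>?g x v\<bar> \<partial>lborel) \<partial>\<nu>)"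
    by (rule Fubini'[symmetric]) measurable
  also have "\<dots> \<le> (\<integral>\<^sup>+v. N \<partial>\<nu>)" by (intro nn_integral_mono inner)
  also have "\<dots> = ennreal (measure \<nu> UNIV) * N"
    by (simp add: emeasure_eq_measure mult.commute)
  finally show ?thesis by (simp add: N_def)
qed

lemma L1_cos_transform_mult_ft_power:
  assumes "integrable lborel \<psi>"
  shows "L1_norm (cos_transform (\<lambda>\<xi>. \<psi> \<xi> * ft \<xi> ^ k))
    \<le> ennreal (measure \<nu> UNIV ^ k) * L1_norm (cos_transform \<psi>)"
proof (induction k)
  case (Suc k)
  have "L1_norm (cos_transform (\<lambda>\<xi>. \<psi> \<xi> * ft \<xi> ^ Suc k))
    = L1_norm (cos_transform (\<lambda>\<xi>. (\<psi> \<xi> * ft \<xi> ^ k) * ft \<xi>))"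
    by (simp only: power_Suc2 mult.assoc)
  also have "\<dots> \<le> ennreal (measure \<nu> UNIV) * L1_norm (cos_transform (\<lambda>\<xi>. \<psi> \<xi> * ft \<xi> ^ k))"
    by (rule L1_cos_transform_mult_ft[OF integrable_mult_bounded_power[OF assms]])
  also have "\<dots> \<le> ennreal (measure \<nu> UNIV) * (ennreal (measure \<nu> UNIV ^ k) * L1_norm (cos_transform \<psi>))"
    by (intro mult_left_mono Suc) auto
  finally show ?case by (simp add: ennreal_mult mult.assoc)
qed simp

text \<open>Expanding $e^{-t(\Lambda - \hat\nu)} = e^{-t\Lambda}\sum_k t^k \hat\nu^k/k!$, the $k$-th term multiplies the $L^1$ norm by at
  most $\Lambda^k$, and $e^{-t\Lambda}\sum_k (t\Lambda)^k/k! = 1$. This is the contraction property of the convolution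
  with a compound Poisson law, obtained without constructing that law.\<close>

lemma L1_cos_transform_compound_poisson:
  assumes \<psi>: "integrable lborel \<psi>" and t: "0 \<le> t"
  shows "L1_norm (cos_transform (\<lambda>\<xi>. \<psi> \<xi> * exp (- t * (measure \<nu> UNIV - ft \<xi>))))
    \<le> L1_norm (cos_transform \<psi>)"
proof -
  have [measurable]: "\<psi> \<in> borel_measurable borel" using \<psi> by auto
  define \<Lambda> where "\<Lambda> = measure \<nu> UNIV"
  define N where "N = L1_norm (cos_transform \<psi>)"
  define g where "g k x = cos_transform (\<lambda>\<xi>. \<psi> \<xi> * ft \<xi> ^ k) x" for k x
  define c where "c k = exp (- t * \<Lambda>) * (t ^ k / fact k)" for k
  have c: "0 \<le> c k" for k using t by (simp add: c_def)
  have \<Lambda>: "0 \<le> \<Lambda>" by (simp add: \<Lambda>_def)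
  have csum: "(\<lambda>k. c k * \<Lambda> ^ k) sums 1"
  proof -
    have "(\<lambda>k. exp (- t * \<Lambda>) * ((t * \<Lambda>) ^ k /\<^sub>R fact k)) sums (exp (- t * \<Lambda>) * exp (t * \<Lambda>))"
      by (intro sums_mult exp_converges)
    then show ?thesis by (simp add: c_def power_mult_distrib exp_minus divide_inverse mult_ac)
  qed
  have ge: "\<bar>cos_transform (\<lambda>\<xi>. \<psi> \<xi> * exp (- t * (\<Lambda> - ft \<xi>))) x\<bar> \<le> (\<Sum>k. ennreal (c k) * ennreal \<bar>g k x\<bar>)" for x
  proof -
    let ?f = "\<lambda>k \<xi>. cos (x * \<xi>) * (c k * (\<psi> \<xi> * ft \<xi> ^ k))"
    have bound: "\<bar>?f k \<xi>\<bar> \<le> c k * \<Lambda> ^ k * \<bar>\<psi> \<xi>\<bar>" for k \<xi>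
    proof -
      have "\<bar>ft \<xi>\<bar> ^ k \<le> \<Lambda> ^ k" unfolding \<Lambda>_def by (intro power_mono abs_ft_le) auto
      then have "c k * (\<bar>\<psi> \<xi>\<bar> * \<bar>ft \<xi>\<bar> ^ k) \<le> c k * (\<bar>\<psi> \<xi>\<bar> * \<Lambda> ^ k)"
        by (intro mult_left_mono c) auto
      then have "\<bar>c k * (\<psi> \<xi> * ft \<xi> ^ k)\<bar> \<le> c k * \<Lambda> ^ k * \<bar>\<psi> \<xi>\<bar>"
        using c[of k] by (simp add: abs_mult power_abs mult_ac)
      then show ?thesis by (rule abs_mult_le_of_abs_le_1[OF abs_cos_le_one])
    qed
    have fi: "integrable lborel (?f k)" for k
      by (intro integrable_cos_mult integrable_mult_right integrable_mult_bounded_power \<psi>) auto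
    have lim: "(\<lambda>k. ?f k \<xi>) sums (cos (x * \<xi>) * (\<psi> \<xi> * exp (- t * (\<Lambda> - ft \<xi>))))" for \<xi>
    proof -
      have "(\<lambda>k. (cos (x * \<xi>) * \<psi> \<xi> * exp (- t * \<Lambda>)) * ((t * ft \<xi>) ^ k /\<^sub>R fact k))
          sums ((cos (x * \<xi>) * \<psi> \<xi> * exp (- t * \<Lambda>)) * exp (t * ft \<xi>))"
        by (intro sums_mult exp_converges)
      moreover have "exp (- t * (\<Lambda> - ft \<xi>)) = exp (- t * \<Lambda>) * exp (t * ft \<xi>)"
        by (simp add: exp_add[symmetric] algebra_simps)
      ultimately show ?thesis by (simp add: c_def power_mult_distrib divide_inverse mult_ac)
    qed
    have s1: "summable (\<lambda>k. norm (?f k \<xi>))" for \<xi>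
      by (rule summable_comparison_test'[OF summable_mult2[OF sums_summable[OF csum], of "\<bar>\<psi> \<xi>\<bar>"]])
         (use bound in auto)
    have s2: "summable (\<lambda>k. \<integral>\<xi>. norm (?f k \<xi>) \<partial>lborel)"
    proof (rule summable_comparison_test'[OF summable_mult2[OF sums_summable[OF csum], of "\<integral>\<xi>. \<bar>\<psi> \<xi>\<bar> \<partial>lborel"]])
      fix k
      have "(\<integral>\<xi>. norm (?f k \<xi>) \<partial>lborel) \<le> (\<integral>\<xi>. c k * \<Lambda> ^ k * \<bar>\<psi> \<xi>\<bar> \<partial>lborel)"
        using bound \<psi> by (intro integral_mono integrable_norm fi integrable_mult_right) auto
      then show "norm (\<integral>\<xi>. norm (?f k \<xi>) \<partial>lborel) \<le> c k * \<Lambda> ^ k * (\<integral>\<xi>. \<bar>\<psi> \<xi>\<bar> \<partial>lborel)"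
        by (simp add: integral_nonneg_AE)
    qed
    have "(\<lambda>k. \<integral>\<xi>. ?f k \<xi> \<partial>lborel) sums (\<integral>\<xi>. (\<Sum>k. ?f k \<xi>) \<partial>lborel)"
      by (intro sums_integral fi AE_I2 s1 s2)
    then have "(\<lambda>k. c k * g k x) sums cos_transform (\<lambda>\<xi>. \<psi> \<xi> * exp (- t * (\<Lambda> - ft \<xi>))) x"
      unfolding sums_unique[OF lim, symmetric] cos_transform_def g_def
      by (auto dest: sums_divide[where c = "2 * pi"] simp: mult.left_commute[of _ "c _"])
    moreover have "summable (\<lambda>k. norm (c k * g k x))"
    proof (rule summable_comparison_test'[OF summable_divide[OF s2, of "2 * pi"]])
      fix k
      have "c k * g k x = cos_transform (\<lambda>\<xi>. c k * (\<psi> \<xi> * ft \<xi> ^ k)) x"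
        by (simp only: g_def cos_transform_def mult.left_commute[of "cos _" "c k"] integral_mult_right_zero
            times_divide_eq_right)
      then have "norm (norm (c k * g k x)) = norm (\<integral>\<xi>. ?f k \<xi> \<partial>lborel) / (2 * pi)"
        by (simp only: cos_transform_def) simp
      also have "\<dots> \<le> (\<integral>\<xi>. norm (?f k \<xi>) \<partial>lborel) / (2 * pi)"
        by (intro divide_right_mono integral_norm_bound) auto
      finally show "norm (norm (c k * g k x)) \<le> (\<integral>\<xi>. norm (?f k \<xi>) \<partial>lborel) / (2 * pi)" .
    qed
    ultimately have "\<bar>cos_transform (\<lambda>\<xi>. \<psi> \<xi> * exp (- t * (\<Lambda> - ft \<xi>))) x\<bar> \<le> (\<Sum>k. \<bar>c k * g k x\<bar>)"
        and sm: "summable (\<lambda>k. \<bar>c k * g k x\<bar>)"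
      using summable_norm[of "\<lambda>k. c k * g k x"] by (auto simp: sums_iff)
    then have "ennreal \<bar>cos_transform (\<lambda>\<xi>. \<psi> \<xi> * exp (- t * (\<Lambda> - ft \<xi>))) x\<bar> \<le> (\<Sum>k. ennreal \<bar>c k * g k x\<bar>)"
      by (subst suminf_ennreal2) (auto intro: ennreal_leI)
    then show ?thesis using c by (simp add: abs_mult ennreal_mult)
  qed
  have [measurable]: "g k \<in> borel_measurable borel" for k
    unfolding g_def[abs_def] by measurable
  have "L1_norm (cos_transform (\<lambda>\<xi>. \<psi> \<xi> * exp (- t * (\<Lambda> - ft \<xi>))))
      \<le> (\<integral>\<^sup>+x. (\<Sum>k. ennreal (c k) * ennreal \<bar>g k x\<bar>) \<partial>lborel)"
    by (intro nn_integral_mono ge)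
  also have "\<dots> = (\<Sum>k. ennreal (c k) * L1_norm (g k))"
    by (subst nn_integral_suminf, measurable, subst nn_integral_cmult) auto
  also have "\<dots> \<le> (\<Sum>k. ennreal (c k * \<Lambda> ^ k) * N)"
  proof (intro suminf_le allI)
    fix k
    have "L1_norm (g k) \<le> ennreal (\<Lambda> ^ k) * N"
      unfolding g_def \<Lambda>_def N_def by (rule L1_cos_transform_mult_ft_power[OF \<psi>])
    then show "ennreal (c k) * L1_norm (g k) \<le> ennreal (c k * \<Lambda> ^ k) * N"
      using c[of k] \<Lambda> by (simp add: ennreal_mult mult.assoc mult_left_mono)
  qed (rule summableI)+
  also have "\<dots> = (\<Sum>k. ennreal (c k * \<Lambda> ^ k)) * N" by (rule ennreal_suminf_multc)
  also have "(\<Sum>k. ennreal (c k * \<Lambda> ^ k)) = ennreal 1"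
    by (rule suminf_ennreal_eq[OF _ csum]) (intro mult_nonneg_nonneg c zero_le_power \<Lambda>)
  also have "ennreal 1 * N = N" by simp
  finally show ?thesis by (simp add: N_def \<Lambda>_def)
qed

end

section \<open>The density and its second differences at one time\<close>

lemma levy_density_eq_cos_transform:
  assumes [measurable]: "levy_exponent \<mu> \<in> borel_measurable borel"
    and i: "integrable lborel (\<lambda>\<xi>. exp (- t * levy_exponent \<mu> \<xi>))"
  shows "integrable lborel (fourier_integrand \<mu> t x)"
    and "levy_density \<mu> t x = cos_transform (\<lambda>\<xi>. exp (- t * levy_exponent \<mu> \<xi>)) x"
proof -
  have [measurable]: "fourier_integrand \<mu> t x \<in> borel_measurable borel"
    unfolding fourier_integrand_def[abs_def] by measurable
  show int: "integrable lborel (fourier_integrand \<mu> t x)"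
    by (rule Bochner_Integration.integrable_bound[OF i]) (auto simp: fourier_integrand_def)
  have re: "Re (fourier_integrand \<mu> t x \<xi>) = cos (x * \<xi>) * exp (- t * levy_exponent \<mu> \<xi>)" for \<xi>
    by (simp add: fourier_integrand_def Re_exp mult.commute)
  have "1 / (2 * of_real pi) = (complex_of_real (1 / (2 * pi)))" by simp
  then have "levy_density \<mu> t x = Re (complex_of_real (1 / (2 * pi)) * (\<integral>\<xi>. fourier_integrand \<mu> t x \<xi> \<partial>lborel))"
    by (simp only: levy_density_def)
  then have "levy_density \<mu> t x = Re (\<integral>\<xi>. fourier_integrand \<mu> t x \<xi> \<partial>lborel) / (2 * pi)"
    by (simp only: Re_complex_of_real times_complex.sel Im_complex_of_real) simp
  also have "Re (\<integral>\<xi>. fourier_integrand \<mu> t x \<xi> \<partial>lborel) = (\<integral>\<xi>. Re (fourier_integrand \<mu> t x \<xi>) \<partial>lborel)"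
    by (rule integral_Re[OF int, symmetric])
  finally show "levy_density \<mu> t x = cos_transform (\<lambda>\<xi>. exp (- t * levy_exponent \<mu> \<xi>)) x"
    by (simp add: re cos_transform_def)
qed

definition second_diff :: "(real \<Rightarrow> real) \<Rightarrow> real \<Rightarrow> real \<Rightarrow> real" where
  "second_diff f u x = f (x + u) + f (x - u) - 2 * f x"

text \<open>In Fourier variables the second difference is multiplication by $-2(1 - \cos(\xi u))$.\<close>

lemma second_diff_cos_transform:
  assumes "integrable lborel \<psi>"
  shows "second_diff (cos_transform \<psi>) u x = - 2 * cos_transform (\<lambda>\<xi>. (1 - cos (\<xi> * u)) * \<psi> \<xi>) x"
proof -
  have i: "integrable lborel (\<lambda>\<xi>. cos (v * \<xi>) * \<psi> \<xi>)" for v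
    by (intro integrable_cos_mult assms) auto
  have "(\<integral>\<xi>. cos ((x + u) * \<xi>) * \<psi> \<xi> \<partial>lborel) + (\<integral>\<xi>. cos ((x - u) * \<xi>) * \<psi> \<xi> \<partial>lborel)
        - 2 * (\<integral>\<xi>. cos (x * \<xi>) * \<psi> \<xi> \<partial>lborel)
      = (\<integral>\<xi>. cos ((x + u) * \<xi>) * \<psi> \<xi> + cos ((x - u) * \<xi>) * \<psi> \<xi> - 2 * (cos (x * \<xi>) * \<psi> \<xi>) \<partial>lborel)"
    by (simp only: Bochner_Integration.integral_diff Bochner_Integration.integral_add integral_mult_right_zero
        Bochner_Integration.integrable_add integrable_mult_right i)
  also have "\<dots> = (\<integral>\<xi>. - 2 * (cos (x * \<xi>) * ((1 - cos (\<xi> * u)) * \<psi> \<xi>)) \<partial>lborel)"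
    by (intro Bochner_Integration.integral_cong refl) (simp add: cos_add cos_diff algebra_simps)
  also have "\<dots> = - 2 * (\<integral>\<xi>. cos (x * \<xi>) * ((1 - cos (\<xi> * u)) * \<psi> \<xi>) \<partial>lborel)"
    by (rule integral_mult_right_zero)
  finally have "- 2 * (\<integral>\<xi>. cos (x * \<xi>) * ((1 - cos (\<xi> * u)) * \<psi> \<xi>) \<partial>lborel) / (2 * pi)
      = ((\<integral>\<xi>. cos ((x + u) * \<xi>) * \<psi> \<xi> \<partial>lborel) + (\<integral>\<xi>. cos ((x - u) * \<xi>) * \<psi> \<xi> \<partial>lborel)
        - 2 * (\<integral>\<xi>. cos (x * \<xi>) * \<psi> \<xi> \<partial>lborel)) / (2 * pi)"
    by (simp only:)
  then show ?thesis
    by (simp add: second_diff_def cos_transform_def add_divide_distrib diff_divide_distrib)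
qed

lemma L1_second_diff_le:
  fixes f :: "real \<Rightarrow> real"
  assumes [measurable]: "f \<in> borel_measurable borel" and f: "L1_norm f \<le> ennreal K" and K: "0 \<le> K"
  shows "L1_norm (second_diff f u) \<le> ennreal (4 * K)"
proof -
  have shift: "(\<integral>\<^sup>+x. ennreal \<bar>f (x + w)\<bar> \<partial>lborel) \<le> ennreal K" for w
    using f by (subst (asm) nn_integral_real_affine[of _ 1 w]) (auto simp: add.commute)
  have "L1_norm (second_diff f u)
    \<le> (\<integral>\<^sup>+x. ennreal \<bar>f (x + u)\<bar> + (ennreal \<bar>f (x + (- u))\<bar> + ennreal 2 * ennreal \<bar>f x\<bar>) \<partial>lborel)"
  proof (rule nn_integral_mono)
    fix x
    have "\<bar>second_diff f u x\<bar> \<le> \<bar>f (x + u)\<bar> + (\<bar>f (x + (- u))\<bar> + 2 * \<bar>f x\<bar>)"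
      by (simp add: second_diff_def)
    then have "ennreal \<bar>second_diff f u x\<bar> \<le> ennreal (\<bar>f (x + u)\<bar> + (\<bar>f (x + (- u))\<bar> + 2 * \<bar>f x\<bar>))"
      by (rule ennreal_leI)
    also have "\<dots> = ennreal \<bar>f (x + u)\<bar> + (ennreal \<bar>f (x + (- u))\<bar> + ennreal 2 * ennreal \<bar>f x\<bar>)"
      by (simp add: ennreal_mult)
    finally show "ennreal \<bar>second_diff f u x\<bar>
      \<le> ennreal \<bar>f (x + u)\<bar> + (ennreal \<bar>f (x + (- u))\<bar> + ennreal 2 * ennreal \<bar>f x\<bar>)" .
  qed
  also have "\<dots> = (\<integral>\<^sup>+x. ennreal \<bar>f (x + u)\<bar> \<partial>lborel)
      + ((\<integral>\<^sup>+x. ennreal \<bar>f (x + (- u))\<bar> \<partial>lborel) + ennreal 2 * L1_norm f)"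
    by (subst nn_integral_add, measurable, subst nn_integral_add, measurable, subst nn_integral_cmult, measurable)
  also have "\<dots> \<le> ennreal K + (ennreal K + ennreal 2 * ennreal K)"
    by (intro add_mono mult_left_mono shift f) auto
  also have "\<dots> = ennreal (4 * K)"
  proof -
    have "K + (K + 2 * K) = 4 * K" by simp
    then show ?thesis
      using K by (metis add_nonneg_nonneg ennreal_mult ennreal_plus mult_nonneg_nonneg zero_le_numeral)
  qed
  finally show ?thesis .
qed

text \<open>A time $t$ together with a matching scale $\rho$. The constants \<open>C\<close> and \<open>D\<close> will be the same for all times in
  a bounded interval, so the bounds below are uniform in time when expressed through $\rho$.\<close>

locale scaled_time = levy_setting +
  fixes t \<rho> C D :: real
  assumes t: "0 < t" and \<rho>: "0 < \<rho>" and C: "0 \<le> C" and upper: "t * q_upper \<mu> \<rho> \<le> C"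
    and decay: "\<And>\<xi>. exp (- t * levy_exponent \<mu> \<xi>) \<le> D / (1 + (\<xi> / \<rho>)\<^sup>2) ^ 3"
begin

text \<open>All polynomial factors are measured in powers of $z = 1 + (\xi/\rho)^2$.\<close>

definition z :: "real \<Rightarrow> real" where "z \<xi> = 1 + (\<xi> / \<rho>)\<^sup>2"

lemma z_ge_1: "1 \<le> z \<xi>" by (simp add: z_def)

lemma square_eq_z: "\<xi>\<^sup>2 = \<rho>\<^sup>2 * (z \<xi> - 1)"
  using \<rho> by (simp add: z_def power_divide)

lemma abs_le_z: "\<bar>\<xi>\<bar> \<le> \<rho> * z \<xi>"
proof -
  have "\<bar>\<xi> / \<rho>\<bar> \<le> 1 + \<bar>\<xi> / \<rho>\<bar>\<^sup>2"
    using zero_le_power2[of "\<bar>\<xi> / \<rho>\<bar> - 1 / 2"] by (simp add: power2_eq_square algebra_simps)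
  then show ?thesis using \<rho> by (simp add: z_def field_simps)
qed

text \<open>The multiplier of the small jumps and its first two derivatives.\<close>

definition \<phi> :: "real \<Rightarrow> real" where "\<phi> \<xi> = exp (- t * small_exponent \<rho> \<xi>)"
definition \<phi>' :: "real \<Rightarrow> real" where "\<phi>' \<xi> = - (t * small_exponent' \<rho> \<xi>) * \<phi> \<xi>"
definition \<phi>'' :: "real \<Rightarrow> real" where
  "\<phi>'' \<xi> = ((t * small_exponent' \<rho> \<xi>)\<^sup>2 - t * small_exponent'' \<rho> \<xi>) * \<phi> \<xi>"
definition E where "E = exp (2 * C) * D"
definition M where "M = (1 + 3 * C + C\<^sup>2) * E"

lemma D_nonneg: "0 \<le> D"
  using order_trans[OF exp_ge_zero decay[of 0]] by simp

lemma E_nonneg: "0 \<le> E" using D_nonneg by (simp add: E_def)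

lemma D_le_E: "D \<le> E"
  using D_nonneg C mult_right_mono[of 1 "exp (2 * C)" D] by (simp add: E_def)

lemma E_le_M: "E \<le> M" "(C + C\<^sup>2) * E \<le> M"
proof -
  show "E \<le> M" unfolding M_def using C E_nonneg mult_right_mono[of 1 "1 + 3 * C + C\<^sup>2" E] by simp
  show "(C + C\<^sup>2) * E \<le> M" unfolding M_def using C by (intro mult_right_mono E_nonneg) auto
qed

lemma M_nonneg: "0 \<le> M" using E_nonneg E_le_M by linarith

lemma \<phi>_pos: "0 < \<phi> \<xi>" by (simp add: \<phi>_def)

lemma \<phi>_le: "\<phi> \<xi> * z \<xi> ^ 3 \<le> E"
proof -
  have "t * levy_exponent \<mu> \<xi> \<le> t * (small_exponent \<rho> \<xi> + 2 * q_upper \<mu> \<rho>)"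
    using t by (intro mult_left_mono levy_exponent_le_small_exponent \<rho>) auto
  then have "- t * small_exponent \<rho> \<xi> \<le> 2 * C + (- t * levy_exponent \<mu> \<xi>)"
    using upper by (simp add: algebra_simps)
  then have "\<phi> \<xi> \<le> exp (2 * C) * exp (- t * levy_exponent \<mu> \<xi>)"
    unfolding \<phi>_def exp_add[symmetric] by simp
  also have "\<dots> \<le> exp (2 * C) * (D / z \<xi> ^ 3)"
    using decay by (intro mult_left_mono) (auto simp: z_def)
  finally show ?thesis using z_ge_1[of \<xi>] by (simp add: E_def pos_le_divide_eq)
qed

text \<open>Since $\phi \le E z^{-3}$, a quantity bounded by $z^2 \phi$ is integrable with the profile $1/z$.\<close>

lemma le_of_\<phi>_bound:
  assumes "x \<le> k * (z \<xi>)\<^sup>2 * \<phi> \<xi>" "0 \<le> k"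
  shows "x \<le> k * E / z \<xi>"
proof -
  have zp: "0 < z \<xi>" using z_ge_1[of \<xi>] by simp
  have "x * z \<xi> \<le> k * (z \<xi>)\<^sup>2 * \<phi> \<xi> * z \<xi>"
    using assms zp by (intro mult_right_mono) auto
  also have "\<dots> = k * (\<phi> \<xi> * z \<xi> ^ 3)" by (simp add: power2_eq_square power3_eq_cube mult_ac)
  also have "\<dots> \<le> k * E" by (intro mult_left_mono \<phi>_le assms)
  finally show ?thesis using zp by (simp add: pos_le_divide_eq)
qed

lemma t_small_variance_le: "t * small_variance \<rho> \<le> C / \<rho>\<^sup>2"
proof -
  have "t * small_variance \<rho> \<le> t * (q_upper \<mu> \<rho> / \<rho>\<^sup>2)"
    using t by (intro mult_left_mono small_variance_le \<rho>) auto
  also have "\<dots> \<le> C / \<rho>\<^sup>2" using upper by (simp add: divide_right_mono)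
  finally show ?thesis .
qed

lemma abs_t_small_exponent': "\<bar>t * small_exponent' \<rho> \<xi>\<bar> \<le> C / \<rho>\<^sup>2 * \<bar>\<xi>\<bar>"
proof -
  have "\<bar>t * small_exponent' \<rho> \<xi>\<bar> \<le> t * (\<bar>\<xi>\<bar> * small_variance \<rho>)"
    using t abs_small_exponent'_le[OF \<rho>, of \<xi>] by (simp add: abs_mult)
  also have "\<dots> = (t * small_variance \<rho>) * \<bar>\<xi>\<bar>" by simp
  also have "\<dots> \<le> C / \<rho>\<^sup>2 * \<bar>\<xi>\<bar>" by (intro mult_right_mono t_small_variance_le) auto
  finally show ?thesis .
qed

lemma abs_t_small_exponent'': "\<bar>t * small_exponent'' \<rho> \<xi>\<bar> \<le> C / \<rho>\<^sup>2"
proof -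
  have "\<bar>t * small_exponent'' \<rho> \<xi>\<bar> \<le> t * small_variance \<rho>"
    using t abs_small_exponent''_le[OF \<rho>, of \<xi>] by (simp add: abs_mult)
  then show ?thesis using t_small_variance_le by linarith
qed

lemma abs_\<phi>'_le: "\<bar>\<phi>' \<xi>\<bar> \<le> C / \<rho>\<^sup>2 * \<bar>\<xi>\<bar> * \<phi> \<xi>"
proof -
  have "\<bar>\<phi>' \<xi>\<bar> = \<bar>t * small_exponent' \<rho> \<xi>\<bar> * \<phi> \<xi>"
    using \<phi>_pos[of \<xi>] by (simp add: \<phi>'_def abs_mult)
  also have "\<dots> \<le> C / \<rho>\<^sup>2 * \<bar>\<xi>\<bar> * \<phi> \<xi>"
    using \<phi>_pos[of \<xi>] by (intro mult_right_mono abs_t_small_exponent') auto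
  finally show ?thesis .
qed

lemma abs_\<phi>''_le: "\<bar>\<phi>'' \<xi>\<bar> \<le> (C + C\<^sup>2) / \<rho>\<^sup>2 * z \<xi> * \<phi> \<xi>"
proof -
  have "\<bar>t * small_exponent' \<rho> \<xi>\<bar>\<^sup>2 \<le> (C / \<rho>\<^sup>2 * \<bar>\<xi>\<bar>)\<^sup>2"
    by (intro power_mono abs_t_small_exponent') auto
  also have "\<dots> = C\<^sup>2 / \<rho>\<^sup>2 * (z \<xi> - 1)"
    using \<rho> by (simp add: power_mult_distrib power_divide square_eq_z[of \<xi>] field_simps)
  finally have "\<bar>(t * small_exponent' \<rho> \<xi>)\<^sup>2 - t * small_exponent'' \<rho> \<xi>\<bar> \<le> C\<^sup>2 / \<rho>\<^sup>2 * (z \<xi> - 1) + C / \<rho>\<^sup>2"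
    using abs_t_small_exponent''[of \<xi>] zero_le_power2[of "t * small_exponent' \<rho> \<xi>"]
    unfolding power2_abs by linarith
  also have "\<dots> \<le> C\<^sup>2 / \<rho>\<^sup>2 * z \<xi> + C / \<rho>\<^sup>2 * z \<xi>"
    using C z_ge_1[of \<xi>] mult_left_mono[of 1 "z \<xi>" "C / \<rho>\<^sup>2"] by (intro add_mono mult_left_mono) auto
  also have "\<dots> = (C + C\<^sup>2) / \<rho>\<^sup>2 * z \<xi>" by (simp add: add_divide_distrib algebra_simps)
  finally show ?thesis
    unfolding \<phi>''_def abs_mult abs_of_pos[OF \<phi>_pos]
    by (rule mult_right_mono) (rule less_imp_le[OF \<phi>_pos])
qed

lemma has_derivative_\<phi>: "(\<phi> has_real_derivative \<phi>' \<xi>) (at \<xi>)"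
  unfolding \<phi>_def[abs_def] \<phi>'_def
  by (auto intro!: derivative_eq_intros has_derivative_small_exponent[OF \<rho>, THEN DERIV_cong])

lemma has_derivative_\<phi>': "(\<phi>' has_real_derivative \<phi>'' \<xi>) (at \<xi>)"
  unfolding \<phi>'_def[abs_def] \<phi>''_def
  by (auto intro!: derivative_eq_intros has_derivative_small_exponent'[OF \<rho>, THEN DERIV_cong]
        has_derivative_\<phi>[THEN DERIV_cong] simp: \<phi>'_def power2_eq_square algebra_simps)

lemma continuous_\<phi>: "continuous_on A \<phi>" and continuous_\<phi>': "continuous_on A \<phi>'"
  using has_derivative_\<phi> has_derivative_\<phi>'
  by (meson DERIV_continuous_on has_field_derivative_at_within)+

lemma continuous_\<phi>'': "continuous_on UNIV \<phi>''"
proof -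
  have "continuous_on UNIV (small_exponent' \<rho>)"
    using has_derivative_small_exponent'[OF \<rho>]
    by (meson DERIV_continuous_on has_field_derivative_at_within)
  then show ?thesis
    unfolding \<phi>''_def[abs_def] by (intro continuous_intros continuous_small_exponent''[OF \<rho>] continuous_\<phi>)
qed

lemma measurable_\<phi> [measurable]: "\<phi> \<in> borel_measurable borel"
  by (intro borel_measurable_continuous_onI continuous_\<phi>)

lemma \<phi>_le_E: "\<bar>\<phi> \<xi>\<bar> \<le> E / z \<xi>"
  using le_of_\<phi>_bound[of "\<phi> \<xi>" 1 \<xi>] \<phi>_pos[of \<xi>] one_le_power[OF z_ge_1[of \<xi>], of 2]
    mult_right_mono[of 1 "(z \<xi>)\<^sup>2" "\<phi> \<xi>"] by simp

lemma \<phi>'_le_E: "\<bar>\<phi>' \<xi>\<bar> \<le> C / \<rho> * E / z \<xi>"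
proof (rule le_of_\<phi>_bound)
  have "\<bar>\<phi>' \<xi>\<bar> \<le> C / \<rho>\<^sup>2 * \<bar>\<xi>\<bar> * \<phi> \<xi>" by (rule abs_\<phi>'_le)
  also have "\<dots> \<le> C / \<rho>\<^sup>2 * (\<rho> * z \<xi>) * \<phi> \<xi>"
    using C \<phi>_pos[of \<xi>] by (intro mult_right_mono mult_left_mono abs_le_z) auto
  also have "\<dots> = C / \<rho> * z \<xi> * \<phi> \<xi>" using \<rho> by (simp add: power2_eq_square)
  also have "\<dots> \<le> C / \<rho> * (z \<xi>)\<^sup>2 * \<phi> \<xi>"
    using C \<rho> \<phi>_pos[of \<xi>] z_ge_1[of \<xi>] by (intro mult_right_mono mult_left_mono) (auto simp: power2_eq_square)
  finally show "\<bar>\<phi>' \<xi>\<bar> \<le> C / \<rho> * (z \<xi>)\<^sup>2 * \<phi> \<xi>" .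
qed (use C \<rho> in auto)

lemma \<phi>''_le_E: "\<bar>\<phi>'' \<xi>\<bar> \<le> (C + C\<^sup>2) / \<rho>\<^sup>2 * E / z \<xi>"
proof (rule le_of_\<phi>_bound)
  have "\<bar>\<phi>'' \<xi>\<bar> \<le> (C + C\<^sup>2) / \<rho>\<^sup>2 * z \<xi> * \<phi> \<xi>" by (rule abs_\<phi>''_le)
  also have "\<dots> \<le> (C + C\<^sup>2) / \<rho>\<^sup>2 * (z \<xi>)\<^sup>2 * \<phi> \<xi>"
    using C \<rho> \<phi>_pos[of \<xi>] z_ge_1[of \<xi>] by (intro mult_right_mono mult_left_mono) (auto simp: power2_eq_square)
  finally show "\<bar>\<phi>'' \<xi>\<bar> \<le> (C + C\<^sup>2) / \<rho>\<^sup>2 * (z \<xi>)\<^sup>2 * \<phi> \<xi>" .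
qed (use C \<rho> in auto)

lemma z_pos: "0 < z \<xi>" using z_ge_1[of \<xi>] by simp

lemma cos_transform_\<phi>_le: "\<bar>cos_transform \<phi> x\<bar> \<le> M * \<rho> * (1 / (1 + (\<rho> * x)\<^sup>2))"
proof (rule cos_transform_decay[OF \<rho> has_derivative_\<phi> has_derivative_\<phi>' continuous_\<phi>''])
  fix \<xi>
  have "E / z \<xi> \<le> M / z \<xi>" using z_pos[of \<xi>] E_le_M by (intro divide_right_mono) auto
  then show "\<bar>\<phi> \<xi>\<bar> \<le> M / (1 + (\<xi> / \<rho>)\<^sup>2)"
    using \<phi>_le_E[of \<xi>] unfolding z_def by linarith
  show "\<bar>\<phi>' \<xi>\<bar> \<le> C / \<rho> * E / (1 + (\<xi> / \<rho>)\<^sup>2)"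
    using \<phi>'_le_E[of \<xi>] unfolding z_def by linarith
  have "(C + C\<^sup>2) / \<rho>\<^sup>2 * E / z \<xi> \<le> M / \<rho>\<^sup>2 / z \<xi>"
    using z_pos[of \<xi>] E_le_M \<rho> by (intro divide_right_mono) (auto intro: divide_right_mono)
  then show "\<bar>\<phi>'' \<xi>\<bar> \<le> M / \<rho>\<^sup>2 / (1 + (\<xi> / \<rho>)\<^sup>2)"
    using \<phi>''_le_E[of \<xi>] unfolding z_def by linarith
qed

lemma one_minus_cos_bound: "1 - cos (\<xi> * u) \<le> \<rho>\<^sup>2 * u\<^sup>2 * (z \<xi> - 1) / 2"
  using one_minus_cos_le_half_square[of "\<xi> * u"] square_eq_z[of \<xi>] by (simp add: power_mult_distrib mult_ac)

text \<open>The factor $1 - \cos(\xi u)$ is at most $\rho^2u^2(z-1)/2$, and every term in the second derivative of the product carries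
  a factor $u^2$: from $u^2\cos(\xi u)$, from $|u \sin(\xi u)| \le u^2|\xi|$, or from $1 - \cos(\xi u)$ itself.\<close>

lemma cos_transform_one_minus_cos_\<phi>_le:
  "\<bar>cos_transform (\<lambda>\<xi>. (1 - cos (\<xi> * u)) * \<phi> \<xi>) x\<bar> \<le> M * (\<rho>\<^sup>2 * u\<^sup>2) * \<rho> * (1 / (1 + (\<rho> * x)\<^sup>2))"
proof (rule cos_transform_decay[OF \<rho>])
  let ?\<psi>' = "\<lambda>\<xi>. u * sin (\<xi> * u) * \<phi> \<xi> + (1 - cos (\<xi> * u)) * \<phi>' \<xi>"
  let ?\<psi>'' = "\<lambda>\<xi>. u\<^sup>2 * cos (\<xi> * u) * \<phi> \<xi> + 2 * (u * sin (\<xi> * u) * \<phi>' \<xi>) + (1 - cos (\<xi> * u)) * \<phi>'' \<xi>"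
  fix \<xi>
  show "((\<lambda>\<xi>. (1 - cos (\<xi> * u)) * \<phi> \<xi>) has_real_derivative ?\<psi>' \<xi>) (at \<xi>)"
    by (auto intro!: derivative_eq_intros has_derivative_\<phi>[THEN DERIV_cong] simp: algebra_simps)
  show "(?\<psi>' has_real_derivative ?\<psi>'' \<xi>) (at \<xi>)"
    by (auto intro!: derivative_eq_intros has_derivative_\<phi>[THEN DERIV_cong] has_derivative_\<phi>'[THEN DERIV_cong]
        simp: algebra_simps power2_eq_square)
  have p: "0 < \<phi> \<xi>" "1 \<le> z \<xi>" "0 < z \<xi>" by (auto simp: \<phi>_pos z_ge_1 z_pos)
  have zz: "z \<xi> \<le> (z \<xi>)\<^sup>2" using p by (simp add: power2_eq_square)
  have "\<bar>(1 - cos (\<xi> * u)) * \<phi> \<xi>\<bar> \<le> \<rho>\<^sup>2 * u\<^sup>2 * E / z \<xi>"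
  proof (rule le_of_\<phi>_bound)
    have "\<rho>\<^sup>2 * u\<^sup>2 * (z \<xi> - 1) / 2 \<le> \<rho>\<^sup>2 * u\<^sup>2 * (z \<xi>)\<^sup>2"
      unfolding times_divide_eq_right[symmetric] using zz p by (intro mult_left_mono) auto
    then have "1 - cos (\<xi> * u) \<le> \<rho>\<^sup>2 * u\<^sup>2 * (z \<xi>)\<^sup>2" using one_minus_cos_bound[of \<xi> u] by linarith
    then show "\<bar>(1 - cos (\<xi> * u)) * \<phi> \<xi>\<bar> \<le> \<rho>\<^sup>2 * u\<^sup>2 * (z \<xi>)\<^sup>2 * \<phi> \<xi>"
      using p by (simp add: abs_mult mult_right_mono)
  qed simp
  also have "\<rho>\<^sup>2 * u\<^sup>2 * E / z \<xi> \<le> \<rho>\<^sup>2 * u\<^sup>2 * M / z \<xi>"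
    using p E_le_M by (intro divide_right_mono mult_left_mono) auto
  finally show "\<bar>(1 - cos (\<xi> * u)) * \<phi> \<xi>\<bar> \<le> M * (\<rho>\<^sup>2 * u\<^sup>2) / (1 + (\<xi> / \<rho>)\<^sup>2)"
    by (simp add: z_def mult.commute)
  have "\<bar>?\<psi>' \<xi>\<bar> \<le> \<bar>u * sin (\<xi> * u) * \<phi> \<xi>\<bar> + \<bar>(1 - cos (\<xi> * u)) * \<phi>' \<xi>\<bar>" by (rule abs_triangle_ineq)
  also have "\<dots> \<le> \<bar>u\<bar> * (E / z \<xi>) + 2 * (C / \<rho> * E / z \<xi>)"
  proof (rule add_mono)
    have "\<bar>sin (\<xi> * u) * \<phi> \<xi>\<bar> \<le> E / z \<xi>" by (rule abs_mult_le_of_abs_le_1) (auto intro: \<phi>_le_E)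
    then show "\<bar>u * sin (\<xi> * u) * \<phi> \<xi>\<bar> \<le> \<bar>u\<bar> * (E / z \<xi>)"
      unfolding mult.assoc abs_mult[of u] by (rule mult_left_mono) simp
    show "\<bar>(1 - cos (\<xi> * u)) * \<phi>' \<xi>\<bar> \<le> 2 * (C / \<rho> * E / z \<xi>)"
      unfolding abs_mult[of "1 - cos (\<xi> * u)"] using one_minus_cos_le_2 by (intro mult_mono \<phi>'_le_E) auto
  qed
  finally show "\<bar>?\<psi>' \<xi>\<bar> \<le> (\<bar>u\<bar> * E + 2 * (C / \<rho> * E)) / (1 + (\<xi> / \<rho>)\<^sup>2)"
    by (simp add: z_def add_divide_distrib)
  have "\<bar>?\<psi>'' \<xi>\<bar> \<le> \<bar>u\<^sup>2 * cos (\<xi> * u) * \<phi> \<xi>\<bar> + \<bar>2 * (u * sin (\<xi> * u) * \<phi>' \<xi>)\<bar> + \<bar>(1 - cos (\<xi> * u)) * \<phi>'' \<xi>\<bar>"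
    by linarith
  also have "\<dots> \<le> u\<^sup>2 * (z \<xi>)\<^sup>2 * \<phi> \<xi> + (2 * C) * u\<^sup>2 * (z \<xi>)\<^sup>2 * \<phi> \<xi> + (C + C\<^sup>2) * u\<^sup>2 * (z \<xi>)\<^sup>2 * \<phi> \<xi>"
  proof (intro add_mono)
    have "\<bar>cos (\<xi> * u) * \<phi> \<xi>\<bar> \<le> (z \<xi>)\<^sup>2 * \<phi> \<xi>"
      using p one_le_power[OF p(2), of 2] by (intro abs_mult_le_of_abs_le_1) auto
    then show "\<bar>u\<^sup>2 * cos (\<xi> * u) * \<phi> \<xi>\<bar> \<le> u\<^sup>2 * (z \<xi>)\<^sup>2 * \<phi> \<xi>"
      unfolding mult.assoc abs_mult[of "u\<^sup>2"] by (simp add: mult_left_mono)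
    have "\<bar>u * sin (\<xi> * u)\<bar> * \<bar>\<phi>' \<xi>\<bar> \<le> (\<bar>\<xi>\<bar> * u\<^sup>2) * (C / \<rho>\<^sup>2 * \<bar>\<xi>\<bar> * \<phi> \<xi>)"
      by (intro mult_mono abs_\<phi>'_le abs_mult_sin_le) auto
    also have "\<dots> = C / \<rho>\<^sup>2 * u\<^sup>2 * \<xi>\<^sup>2 * \<phi> \<xi>"
      by (simp add: abs_mult power2_eq_square mult_ac)
    also have "\<dots> = C * u\<^sup>2 * (z \<xi> - 1) * \<phi> \<xi>" using \<rho> by (simp add: square_eq_z[of \<xi>])
    also have "\<dots> \<le> C * u\<^sup>2 * (z \<xi>)\<^sup>2 * \<phi> \<xi>" using C p zz by (intro mult_right_mono mult_left_mono) auto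
    finally show "\<bar>2 * (u * sin (\<xi> * u) * \<phi>' \<xi>)\<bar> \<le> (2 * C) * u\<^sup>2 * (z \<xi>)\<^sup>2 * \<phi> \<xi>"
      by (simp add: abs_mult mult.assoc)
    have "\<bar>(1 - cos (\<xi> * u)) * \<phi>'' \<xi>\<bar> \<le> (\<rho>\<^sup>2 * u\<^sup>2 * (z \<xi> - 1) / 2) * ((C + C\<^sup>2) / \<rho>\<^sup>2 * z \<xi> * \<phi> \<xi>)"
      unfolding abs_mult using one_minus_cos_bound[of \<xi> u] p by (intro mult_mono abs_\<phi>''_le) auto
    also have "\<dots> = (C + C\<^sup>2) * u\<^sup>2 * ((z \<xi> - 1) / 2 * z \<xi>) * \<phi> \<xi>" using \<rho> by simp
    also have "\<dots> \<le> (C + C\<^sup>2) * u\<^sup>2 * (z \<xi>)\<^sup>2 * \<phi> \<xi>"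
      using C p unfolding power2_eq_square[of "z \<xi>"] by (intro mult_right_mono mult_left_mono) auto
    finally show "\<bar>(1 - cos (\<xi> * u)) * \<phi>'' \<xi>\<bar> \<le> (C + C\<^sup>2) * u\<^sup>2 * (z \<xi>)\<^sup>2 * \<phi> \<xi>" .
  qed
  also have "\<dots> = ((1 + 3 * C + C\<^sup>2) * u\<^sup>2) * (z \<xi>)\<^sup>2 * \<phi> \<xi>" by (simp add: algebra_simps)
  finally have "\<bar>?\<psi>'' \<xi>\<bar> \<le> ((1 + 3 * C + C\<^sup>2) * u\<^sup>2) * E / z \<xi>"
    using C by (intro le_of_\<phi>_bound) auto
  then show "\<bar>?\<psi>'' \<xi>\<bar> \<le> M * (\<rho>\<^sup>2 * u\<^sup>2) / \<rho>\<^sup>2 / (1 + (\<xi> / \<rho>)\<^sup>2)"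
    using \<rho> by (simp add: M_def z_def mult_ac)
next
  show "continuous_on UNIV (\<lambda>\<xi>. u\<^sup>2 * cos (\<xi> * u) * \<phi> \<xi> + 2 * (u * sin (\<xi> * u) * \<phi>' \<xi>) + (1 - cos (\<xi> * u)) * \<phi>'' \<xi>)"
    by (intro continuous_intros continuous_\<phi> continuous_\<phi>' continuous_\<phi>'')
qed

text \<open>Splitting $q$ into small and large jumps and contracting away the large ones. The factor \<open>\<psi>\<close> is $1$ for
  the density and $1 - \cos(\xi u)$ for its second difference.\<close>

lemma L1_cos_transform_times_exp_le:
  assumes \<psi>: "integrable lborel (\<lambda>\<xi>. \<psi> \<xi> * \<phi> \<xi>)"
  shows "L1_norm (cos_transform (\<lambda>\<xi>. \<psi> \<xi> * exp (- t * levy_exponent \<mu> \<xi>)))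
    \<le> L1_norm (cos_transform (\<lambda>\<xi>. \<psi> \<xi> * \<phi> \<xi>))"
proof -
  define B where "B = {u::real. \<bar>u\<bar> > 1 / \<rho>}"
  have [measurable]: "B \<in> sets borel" unfolding B_def by measurable
  define \<nu> where "\<nu> = density \<mu> (\<lambda>u. ennreal (indicat_real B u))"
  have em: "emeasure \<nu> UNIV = emeasure \<mu> B"
    unfolding \<nu>_def by (subst emeasure_density) (auto simp: ennreal_indicator)
  interpret \<nu>: finite_borel_measure \<nu>
  proof (intro finite_borel_measure.intro finite_measureI finite_borel_measure_axioms.intro)
    have "emeasure \<mu> B < \<infinity>"
      using emeasure_outside_le_q_upper[OF \<rho>] unfolding B_def by (rule le_less_trans) simp
    then show "emeasure \<nu> (space \<nu>) \<noteq> \<infinity>" using em by (simp add: \<nu>_def)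
    show "sets \<nu> = sets borel" by (simp add: \<nu>_def)
  qed
  have int_cos: "integrable \<nu> (\<lambda>v. cos (\<xi> * v))" for \<xi>
    by (rule \<nu>.integrable_const_bound[where B = 1]) auto
  have split: "levy_exponent \<mu> \<xi> = small_exponent \<rho> \<xi> + (measure \<nu> UNIV - \<nu>.ft \<xi>)" for \<xi>
  proof -
    have "measure \<nu> UNIV - \<nu>.ft \<xi> = (\<integral>v. 1 - cos (\<xi> * v) \<partial>\<nu>)"
      unfolding \<nu>.ft_def using int_cos by (subst Bochner_Integration.integral_diff) auto
    also have "\<dots> = (\<integral>u. indicat_real B u * (1 - cos (\<xi> * u)) \<partial>\<mu>)"
      unfolding \<nu>_def by (subst integral_real_density) auto
    finally have "small_exponent \<rho> \<xi> + (measure \<nu> UNIV - \<nu>.ft \<xi>)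
        = (\<integral>u. small \<rho> u * (1 - cos (\<xi> * u)) + indicat_real B u * (1 - cos (\<xi> * u)) \<partial>\<mu>)"
      unfolding small_exponent_def
      using integrable_real_mult_indicator[of B \<mu> "\<lambda>u. 1 - cos (\<xi> * u)"] integrable_levy_exponent[of \<xi>]
      by (subst Bochner_Integration.integral_add) (auto simp: mult.commute[of "1 - cos _"] intro: integrable_small_1_minus_cos[OF \<rho>])
    also have "\<dots> = levy_exponent \<mu> \<xi>"
      unfolding levy_exponent_def
      by (intro Bochner_Integration.integral_cong refl) (auto simp: B_def indicator_def)
    finally show ?thesis by simp
  qed
  have eq: "\<psi> \<xi> * exp (- t * levy_exponent \<mu> \<xi>)
      = \<psi> \<xi> * \<phi> \<xi> * exp (- t * (measure \<nu> UNIV - \<nu>.ft \<xi>))" for \<xi>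
    unfolding split \<phi>_def by (simp add: exp_add[symmetric] algebra_simps)
  show ?thesis
    unfolding eq by (rule \<nu>.L1_cos_transform_compound_poisson[OF \<psi>]) (use t in simp)
qed

lemma exp_exponent_le: "\<bar>exp (- t * levy_exponent \<mu> \<xi>)\<bar> \<le> D / (1 + (\<xi> / \<rho>)\<^sup>2)"
proof -
  have "z \<xi> ^ 1 \<le> z \<xi> ^ 3" using z_ge_1 by (intro power_increasing) auto
  then have "D / z \<xi> ^ 3 \<le> D / z \<xi>"
    using D_nonneg z_pos[of \<xi>] by (intro divide_left_mono) auto
  then show ?thesis using decay[of \<xi>] by (simp add: z_def)
qed

lemma one_minus_cos_exp_le:
  "\<bar>(1 - cos (\<xi> * u)) * exp (- t * levy_exponent \<mu> \<xi>)\<bar> \<le> \<rho>\<^sup>2 * u\<^sup>2 * D / (1 + (\<xi> / \<rho>)\<^sup>2)"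
proof -
  have zz: "z \<xi> - 1 \<le> (z \<xi>)\<^sup>2" using z_ge_1[of \<xi>] self_le_power[of "z \<xi>" 2] by simp
  have "\<rho>\<^sup>2 * u\<^sup>2 * (z \<xi> - 1) / 2 \<le> \<rho>\<^sup>2 * u\<^sup>2 * (z \<xi>)\<^sup>2"
    unfolding times_divide_eq_right[symmetric] using zz z_ge_1[of \<xi>] by (intro mult_left_mono) auto
  then have "1 - cos (\<xi> * u) \<le> \<rho>\<^sup>2 * u\<^sup>2 * (z \<xi>)\<^sup>2" using one_minus_cos_bound[of \<xi> u] by linarith
  then have "(1 - cos (\<xi> * u)) * exp (- t * levy_exponent \<mu> \<xi>) \<le> \<rho>\<^sup>2 * u\<^sup>2 * (z \<xi>)\<^sup>2 * (D / z \<xi> ^ 3)"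
    using decay[of \<xi>] by (intro mult_mono) (auto simp: z_def)
  also have "\<dots> = \<rho>\<^sup>2 * u\<^sup>2 * D / z \<xi>"
    using z_pos[of \<xi>] by (simp add: power2_eq_square power3_eq_cube)
  finally show ?thesis by (simp add: z_def abs_mult)
qed

lemma integrable_exp: "integrable lborel (\<lambda>\<xi>. exp (- t * levy_exponent \<mu> \<xi>))"
  by (rule integrable_of_inverse_square_bound[OF \<rho> _ exp_exponent_le]) measurable

lemmas levy_density_eq = levy_density_eq_cos_transform[OF measurable_levy_exponent integrable_exp]

lemma L1_levy_density_le: "L1_norm (levy_density \<mu> t) \<le> ennreal (M * pi)"
proof -
  have "integrable lborel \<phi>"
    by (rule integrable_of_inverse_square_bound[OF \<rho> measurable_\<phi> \<phi>_le_E[unfolded z_def]])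
  then have "L1_norm (levy_density \<mu> t) \<le> L1_norm (cos_transform \<phi>)"
    using L1_cos_transform_times_exp_le[of "\<lambda>_. 1"] by (simp add: levy_density_eq)
  also have "\<dots> \<le> ennreal (M * pi)" by (rule nn_integral_abs_le_of_decay[OF \<rho> cos_transform_\<phi>_le])
  finally show ?thesis .
qed

lemma measurable_levy_density_t [measurable]: "levy_density \<mu> t \<in> borel_measurable borel"
  unfolding levy_density_eq(2)[abs_def] by measurable

lemma abs_levy_density_le: "\<bar>levy_density \<mu> t x\<bar> \<le> M * \<rho>"
proof -
  have "\<bar>levy_density \<mu> t x\<bar> \<le> (\<integral>\<xi>. \<bar>exp (- t * levy_exponent \<mu> \<xi>)\<bar> \<partial>lborel) / (2 * pi)"
    unfolding levy_density_eq by (rule abs_cos_transform_le[OF integrable_exp])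
  also have "\<dots> \<le> (D * (\<rho> * pi)) / (2 * pi)"
    by (intro divide_right_mono integrable_of_inverse_square_bound(2)[OF \<rho> _ exp_exponent_le]) auto
  also have "\<dots> \<le> D * \<rho>" using D_nonneg \<rho> by simp
  also have "\<dots> \<le> M * \<rho>" using D_le_E E_le_M \<rho> by (intro mult_right_mono) auto
  finally show ?thesis .
qed

lemma second_diff_levy_density_eq:
  "second_diff (levy_density \<mu> t) u x
    = - 2 * cos_transform (\<lambda>\<xi>. (1 - cos (\<xi> * u)) * exp (- t * levy_exponent \<mu> \<xi>)) x"
  unfolding levy_density_eq(2)[abs_def] by (rule second_diff_cos_transform[OF integrable_exp])

text \<open>For large $|u|$ the three translates are estimated separately; for small $|u|$ the second difference is the transform
  of $-2(1-\cos(\xi u))e^{-tq}$.\<close>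

lemma L1_second_diff_levy_density_le:
  "L1_norm (second_diff (levy_density \<mu> t) u) \<le> ennreal (4 * M * pi * min 1 (\<rho>\<^sup>2 * u\<^sup>2))"
proof -
  have 1: "L1_norm (second_diff (levy_density \<mu> t) u) \<le> ennreal (4 * (M * pi))"
    using M_nonneg by (intro L1_second_diff_le L1_levy_density_le) auto
  have "integrable lborel (\<lambda>\<xi>. (1 - cos (\<xi> * u)) * \<phi> \<xi>)"
  proof (rule integrable_of_inverse_square_bound(1)[OF \<rho>])
    fix \<xi>
    have "\<bar>(1 - cos (\<xi> * u)) * \<phi> \<xi>\<bar> \<le> 2 * (E / z \<xi>)"
      unfolding abs_mult using one_minus_cos_le_2 by (intro mult_mono \<phi>_le_E) auto
    then show "\<bar>(1 - cos (\<xi> * u)) * \<phi> \<xi>\<bar> \<le> 2 * E / (1 + (\<xi> / \<rho>)\<^sup>2)" by (simp add: z_def)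
  qed measurable
  then have "L1_norm (cos_transform (\<lambda>\<xi>. (1 - cos (\<xi> * u)) * exp (- t * levy_exponent \<mu> \<xi>)))
      \<le> L1_norm (cos_transform (\<lambda>\<xi>. (1 - cos (\<xi> * u)) * \<phi> \<xi>))"
    by (rule L1_cos_transform_times_exp_le)
  also have "\<dots> \<le> ennreal (M * (\<rho>\<^sup>2 * u\<^sup>2) * pi)"
    by (rule nn_integral_abs_le_of_decay[OF \<rho> cos_transform_one_minus_cos_\<phi>_le])
  finally have b: "L1_norm (cos_transform (\<lambda>\<xi>. (1 - cos (\<xi> * u)) * exp (- t * levy_exponent \<mu> \<xi>)))
      \<le> ennreal (M * (\<rho>\<^sup>2 * u\<^sup>2) * pi)" .
  have "L1_norm (second_diff (levy_density \<mu> t) u)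
      = ennreal 2 * L1_norm (cos_transform (\<lambda>\<xi>. (1 - cos (\<xi> * u)) * exp (- t * levy_exponent \<mu> \<xi>)))"
    by (subst nn_integral_cmult[symmetric]) (auto simp: second_diff_levy_density_eq abs_mult ennreal_mult)
  also have "\<dots> \<le> ennreal 2 * ennreal (M * (\<rho>\<^sup>2 * u\<^sup>2) * pi)" by (intro mult_left_mono b) auto
  also have "\<dots> = ennreal (2 * (M * (\<rho>\<^sup>2 * u\<^sup>2) * pi))" using M_nonneg by (intro ennreal_mult[symmetric]) auto
  also have "\<dots> \<le> ennreal (4 * (M * (\<rho>\<^sup>2 * u\<^sup>2) * pi))" using M_nonneg by (intro ennreal_leI mult_right_mono) auto
  finally show ?thesis using 1 by (auto simp: min_def mult_ac)
qed

lemma abs_second_diff_levy_density_le: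
  "\<bar>second_diff (levy_density \<mu> t) u x\<bar> \<le> 4 * M * \<rho> * min 1 (\<rho>\<^sup>2 * u\<^sup>2)"
proof -
  have 1: "\<bar>second_diff (levy_density \<mu> t) u x\<bar> \<le> 4 * M * \<rho>"
    unfolding second_diff_def
    using abs_levy_density_le[of "x + u"] abs_levy_density_le[of "x - u"] abs_levy_density_le[of x] by linarith
  let ?\<psi> = "\<lambda>\<xi>. (1 - cos (\<xi> * u)) * exp (- t * levy_exponent \<mu> \<xi>)"
  have i: "integrable lborel ?\<psi>" "(\<integral>\<xi>. \<bar>?\<psi> \<xi>\<bar> \<partial>lborel) \<le> \<rho>\<^sup>2 * u\<^sup>2 * D * (\<rho> * pi)"
    by (rule integrable_of_inverse_square_bound[OF \<rho> _ one_minus_cos_exp_le], measurable)+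
  have "\<bar>cos_transform ?\<psi> x\<bar> \<le> (\<integral>\<xi>. \<bar>?\<psi> \<xi>\<bar> \<partial>lborel) / (2 * pi)"
    by (rule abs_cos_transform_le[OF i(1)])
  also have "\<dots> \<le> \<rho>\<^sup>2 * u\<^sup>2 * D * (\<rho> * pi) / (2 * pi)"
    by (intro divide_right_mono i(2)) auto
  also have "\<dots> = \<rho>\<^sup>2 * u\<^sup>2 * \<rho> * D / 2" by simp
  finally have "\<bar>second_diff (levy_density \<mu> t) u x\<bar> \<le> \<rho>\<^sup>2 * u\<^sup>2 * \<rho> * D"
    unfolding second_diff_levy_density_eq by (simp add: abs_mult)
  also have "\<dots> \<le> \<rho>\<^sup>2 * u\<^sup>2 * \<rho> * (4 * M)"
    using D_le_E E_le_M D_nonneg \<rho> by (intro mult_left_mono) auto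
  finally show ?thesis using 1 by (auto simp: min_def mult_ac)
qed

end

section \<open>Convergence of the parametrix series\<close>

text \<open>Kernels are curried, while measurability is a property of the uncurried function.\<close>

definition kernel_measurable :: "kernel \<Rightarrow> bool" where
  "kernel_measurable f \<longleftrightarrow> (\<lambda>(t, x, y). f t x y) \<in> borel_measurable (borel \<Otimes>\<^sub>M borel \<Otimes>\<^sub>M borel)"

lemma kernel_measurableD:
  assumes "kernel_measurable f" "a \<in> borel_measurable M" "b \<in> borel_measurable M" "c \<in> borel_measurable M"
  shows "(\<lambda>w. f (a w) (b w) (c w)) \<in> borel_measurable M"
proof -
  have "(\<lambda>w. (a w, b w, c w)) \<in> M \<rightarrow>\<^sub>M borel \<Otimes>\<^sub>M borel \<Otimes>\<^sub>M borel" using assms by measurable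
  from measurable_compose[OF this assms(1)[unfolded kernel_measurable_def]] show ?thesis by simp
qed

lemma kernel_measurable_st_conv:
  assumes f: "kernel_measurable f" and g: "kernel_measurable g"
  shows "kernel_measurable (st_conv f g)"
proof -
  note [measurable (raw)] = kernel_measurableD[OF f] kernel_measurableD[OF g]
  have eq: "st_conv f g t x y = (\<integral>\<tau>. (if 0 < \<tau> \<and> \<tau> < t then (\<integral>z. f (t - \<tau>) x z * g \<tau> z y \<partial>lborel) else 0) \<partial>lborel)" for t x y
    unfolding st_conv_def set_lebesgue_integral_def
    by (intro Bochner_Integration.integral_cong refl) auto
  show ?thesis
    unfolding kernel_measurable_def eq by measurable
qed

lemma kernel_measurable_st_power:
  assumes "kernel_measurable F"
  shows "kernel_measurable (st_power F k)"
proof (induction k)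
  case 0
  then show ?case by (simp add: kernel_measurable_def)
qed (use assms in \<open>simp add: kernel_measurable_st_conv\<close>)

lemma kernel_measurable_suminf:
  assumes "\<And>k. kernel_measurable (f k)"
  shows "kernel_measurable (\<lambda>t x y. \<Sum>k::nat. f k t x y)"
proof -
  note [measurable (raw)] = kernel_measurableD[OF assms]
  show ?thesis unfolding kernel_measurable_def by measurable
qed

text \<open>A function of time and one space variable stands for the translation invariant kernel $(t,x,y) \mapsto f_t(y-x)$. Such
  majorants are set to $0$ for $t \le 0$; the convolution over all of $R^2$ then only sees the times between
  $0$ and $t$.\<close>

definition mass :: "(real \<Rightarrow> real \<Rightarrow> ennreal) \<Rightarrow> ennreal" where
  "mass f = (\<integral>\<^sup>+t. (\<integral>\<^sup>+x. f t x \<partial>lborel) \<partial>lborel)"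

definition nn_conv :: "(real \<Rightarrow> real \<Rightarrow> ennreal) \<Rightarrow> (real \<Rightarrow> real \<Rightarrow> ennreal) \<Rightarrow> real \<Rightarrow> real \<Rightarrow> ennreal" where
  "nn_conv f h t x = (\<integral>\<^sup>+\<tau>. (\<integral>\<^sup>+z. f (t - \<tau>) (x - z) * h \<tau> z \<partial>lborel) \<partial>lborel)"

definition nn_measurable :: "(real \<Rightarrow> real \<Rightarrow> ennreal) \<Rightarrow> bool" where
  "nn_measurable f \<longleftrightarrow> (\<lambda>(t, x). f t x) \<in> borel_measurable (borel \<Otimes>\<^sub>M borel)"

lemma nn_measurableD:
  assumes "nn_measurable f" "a \<in> borel_measurable M" "b \<in> borel_measurable M"
  shows "(\<lambda>w. f (a w) (b w)) \<in> borel_measurable M"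
proof -
  have "(\<lambda>w. (a w, b w)) \<in> M \<rightarrow>\<^sub>M borel \<Otimes>\<^sub>M borel" using assms by measurable
  from measurable_compose[OF this assms(1)[unfolded nn_measurable_def]] show ?thesis by simp
qed

lemma nn_measurable_conv:
  assumes f: "nn_measurable f" and h: "nn_measurable h"
  shows "nn_measurable (nn_conv f h)"
proof -
  note [measurable (raw)] = nn_measurableD[OF f] nn_measurableD[OF h]
  show ?thesis unfolding nn_measurable_def nn_conv_def by measurable
qed

lemma nn_integral_lborel_shift:
  fixes z :: real
  assumes [measurable]: "f \<in> borel_measurable borel"
  shows "(\<integral>\<^sup>+x. f (x - z) \<partial>lborel) = (\<integral>\<^sup>+x. f x \<partial>lborel)"
  using nn_integral_real_affine[OF assms, of 1 "- z"] by simp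

lemma nn_integral_lborel_reflect:
  fixes z :: real
  assumes [measurable]: "f \<in> borel_measurable borel"
  shows "(\<integral>\<^sup>+x. f (z - x) \<partial>lborel) = (\<integral>\<^sup>+x. f x \<partial>lborel)"
  using nn_integral_real_affine[OF assms, of "- 1" z] by simp

text \<open>Tonelli's theorem and translation invariance; this is Young's equality for nonnegative functions on the plane.\<close>

lemma mass_nn_conv:
  assumes f: "nn_measurable f" and h: "nn_measurable h"
  shows "mass (nn_conv f h) = mass f * mass h"
proof -
  note [measurable (raw)] = nn_measurableD[OF f] nn_measurableD[OF h]
  have "mass (nn_conv f h)
    = (\<integral>\<^sup>+t. (\<integral>\<^sup>+\<tau>. (\<integral>\<^sup>+x. (\<integral>\<^sup>+z. f (t - \<tau>) (x - z) * h \<tau> z \<partial>lborel) \<partial>lborel) \<partial>lborel) \<partial>lborel)"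
    unfolding mass_def nn_conv_def by (intro nn_integral_cong lborel_pair.Fubini') measurable
  also have "\<dots> = (\<integral>\<^sup>+t. (\<integral>\<^sup>+\<tau>. (\<integral>\<^sup>+z. (\<integral>\<^sup>+x. f (t - \<tau>) (x - z) * h \<tau> z \<partial>lborel) \<partial>lborel) \<partial>lborel) \<partial>lborel)"
    by (intro nn_integral_cong lborel_pair.Fubini') measurable
  also have "\<dots> = (\<integral>\<^sup>+t. (\<integral>\<^sup>+\<tau>. (\<integral>\<^sup>+z. (\<integral>\<^sup>+x. f (t - \<tau>) x \<partial>lborel) * h \<tau> z \<partial>lborel) \<partial>lborel) \<partial>lborel)"
    by (intro nn_integral_cong) (simp add: nn_integral_multc nn_integral_lborel_shift[of "f _"])
  also have "\<dots> = (\<integral>\<^sup>+t. (\<integral>\<^sup>+\<tau>. (\<integral>\<^sup>+x. f (t - \<tau>) x \<partial>lborel) * (\<integral>\<^sup>+z. h \<tau> z \<partial>lborel) \<partial>lborel) \<partial>lborel)"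
    by (intro nn_integral_cong) (simp add: nn_integral_cmult)
  also have "\<dots> = (\<integral>\<^sup>+\<tau>. (\<integral>\<^sup>+t. (\<integral>\<^sup>+x. f (t - \<tau>) x \<partial>lborel) * (\<integral>\<^sup>+z. h \<tau> z \<partial>lborel) \<partial>lborel) \<partial>lborel)"
    by (intro lborel_pair.Fubini') measurable
  also have "\<dots> = (\<integral>\<^sup>+\<tau>. mass f * (\<integral>\<^sup>+z. h \<tau> z \<partial>lborel) \<partial>lborel)"
    unfolding mass_def
    by (intro nn_integral_cong)
       (simp add: nn_integral_multc nn_integral_lborel_shift[of "\<lambda>t. \<integral>\<^sup>+x. f t x \<partial>lborel"])
  also have "\<dots> = mass f * mass h"
    unfolding mass_def[of h] by (rule nn_integral_cmult) measurable
  finally show ?thesis .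
qed

text \<open>Of the two factors in a convolution at time $t$, one is always evaluated at a time at least
  $t/2$, where its supremum is under control; the other one contributes its mass.\<close>

lemma nn_conv_le:
  assumes f: "nn_measurable f" and h: "nn_measurable h"
    and f0: "\<And>s x. s \<le> 0 \<Longrightarrow> f s x = 0" and h0: "\<And>s x. s \<le> 0 \<Longrightarrow> h s x = 0"
    and fb: "\<And>s x. 0 < s \<Longrightarrow> s \<le> T \<Longrightarrow> f s x \<le> ennreal (A / s ^ \<kappa>)"
    and hb: "\<And>s x. 0 < s \<Longrightarrow> s \<le> T \<Longrightarrow> h s x \<le> ennreal (B / s ^ \<kappa>)"
    and AB: "0 \<le> A" "0 \<le> B" and t: "0 < t" "t \<le> T"
  shows "nn_conv f h t x \<le> ennreal (A * 2 ^ \<kappa> / t ^ \<kappa>) * mass h + ennreal (B * 2 ^ \<kappa> / t ^ \<kappa>) * mass f"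
proof -
  note [measurable (raw)] = nn_measurableD[OF f] nn_measurableD[OF h]
  have half: "ennreal (K / s ^ \<kappa>) \<le> ennreal (K * 2 ^ \<kappa> / t ^ \<kappa>)" if "t / 2 \<le> s" "0 \<le> K" for s K
  proof (rule ennreal_leI)
    have "K / s ^ \<kappa> \<le> K / (t / 2) ^ \<kappa>"
      using that t by (intro divide_left_mono power_mono mult_pos_pos zero_less_power) auto
    then show "K / s ^ \<kappa> \<le> K * 2 ^ \<kappa> / t ^ \<kappa>" by (simp add: power_divide)
  qed
  have "f (t - \<tau>) (x - z) * h \<tau> z
      \<le> ennreal (A * 2 ^ \<kappa> / t ^ \<kappa>) * h \<tau> z + ennreal (B * 2 ^ \<kappa> / t ^ \<kappa>) * f (t - \<tau>) (x - z)" for \<tau> z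
  proof -
    consider "\<tau> \<le> 0" | "t \<le> \<tau>" | "0 < \<tau>" "\<tau> \<le> t / 2" | "t / 2 < \<tau>" "\<tau> < t" by linarith
    then show ?thesis
    proof cases
      case 3
      then have "f (t - \<tau>) (x - z) \<le> ennreal (A * 2 ^ \<kappa> / t ^ \<kappa>)"
        using t AB by (intro order_trans[OF fb half]) auto
      then show ?thesis by (meson add_increasing2 mult_right_mono zero_le)
    next
      case 4
      then have "h \<tau> z \<le> ennreal (B * 2 ^ \<kappa> / t ^ \<kappa>)"
        using t AB by (intro order_trans[OF hb half]) auto
      then have "h \<tau> z * f (t - \<tau>) (x - z) \<le> ennreal (B * 2 ^ \<kappa> / t ^ \<kappa>) * f (t - \<tau>) (x - z)"
        by (rule mult_right_mono) simp
      then show ?thesis by (simp add: mult.commute add_increasing)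
    qed (auto simp: f0 h0)
  qed
  then have "nn_conv f h t x \<le> (\<integral>\<^sup>+\<tau>. (\<integral>\<^sup>+z. ennreal (A * 2 ^ \<kappa> / t ^ \<kappa>) * h \<tau> z
      + ennreal (B * 2 ^ \<kappa> / t ^ \<kappa>) * f (t - \<tau>) (x - z) \<partial>lborel) \<partial>lborel)"
    unfolding nn_conv_def by (intro nn_integral_mono)
  also have "\<dots> = (\<integral>\<^sup>+\<tau>. ennreal (A * 2 ^ \<kappa> / t ^ \<kappa>) * (\<integral>\<^sup>+z. h \<tau> z \<partial>lborel)
      + ennreal (B * 2 ^ \<kappa> / t ^ \<kappa>) * (\<integral>\<^sup>+z. f (t - \<tau>) z \<partial>lborel) \<partial>lborel)"
    by (intro nn_integral_cong)
       (simp add: nn_integral_add nn_integral_cmult nn_integral_lborel_reflect[of "f _"])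
  also have "\<dots> = ennreal (A * 2 ^ \<kappa> / t ^ \<kappa>) * mass h + ennreal (B * 2 ^ \<kappa> / t ^ \<kappa>) * mass f"
    unfolding mass_def
    by (simp add: nn_integral_add nn_integral_cmult nn_integral_lborel_reflect[of "\<lambda>t. \<integral>\<^sup>+x. f t x \<partial>lborel"])
  finally show ?thesis .
qed

lemma abs_integral_le_nn_integral: "ennreal \<bar>\<integral>x. f x \<partial>M\<bar> \<le> (\<integral>\<^sup>+x. ennreal \<bar>f x\<bar> \<partial>M)" for f :: "'a \<Rightarrow> real"
  using integral_norm_bound_ennreal[of M f] not_integrable_integral_eq[of M f]
  by (cases "integrable M f") auto

text \<open>Domination is inherited by convolutions, because the weights multiply to $e^{l(t-\tau)}e^{l\tau} = e^{lt}$ and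
  because $(z - x) + (y - z) = y - x$.\<close>

lemma
  fixes f F :: kernel
  assumes f: "kernel_measurable f" and F: "kernel_measurable F"
    and P: "nn_measurable P" and Q: "nn_measurable Q"
    and fP: "\<And>s x y. 0 < s \<Longrightarrow> s \<le> T \<Longrightarrow> ennreal \<bar>f s x y\<bar> \<le> ennreal (exp (l * s)) * P s (y - x)"
    and FQ: "\<And>s x y. 0 < s \<Longrightarrow> s \<le> T \<Longrightarrow> ennreal \<bar>F s x y\<bar> \<le> ennreal (exp (l * s)) * Q s (y - x)"
    and t: "0 < t" "t \<le> T"
  shows abs_st_conv_le: "ennreal \<bar>st_conv f F t x y\<bar> \<le> ennreal (exp (l * t)) * nn_conv P Q t (y - x)"
    and st_conv_defined_if: "nn_conv P Q t (y - x) < \<infinity> \<Longrightarrow> st_conv_defined f F t x y"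
proof -
  note [measurable (raw)] = kernel_measurableD[OF f] kernel_measurableD[OF F] nn_measurableD[OF P] nn_measurableD[OF Q]
  let ?I = "\<lambda>\<tau> z. indicat_real {0<..<t} \<tau> *\<^sub>R (f (t - \<tau>) x z * F \<tau> z y)"
  have le: "(\<integral>\<^sup>+\<tau>. (\<integral>\<^sup>+z. ennreal \<bar>?I \<tau> z\<bar> \<partial>lborel) \<partial>lborel) \<le> ennreal (exp (l * t)) * nn_conv P Q t (y - x)"
  proof -
    have "(\<integral>\<^sup>+z. ennreal \<bar>?I \<tau> z\<bar> \<partial>lborel) \<le> ennreal (exp (l * t)) * (\<integral>\<^sup>+z. P (t - \<tau>) (y - x - z) * Q \<tau> z \<partial>lborel)" for \<tau>
    proof (cases "0 < \<tau> \<and> \<tau> < t")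
      case True
      have "(\<integral>\<^sup>+z. ennreal \<bar>?I \<tau> z\<bar> \<partial>lborel) \<le> (\<integral>\<^sup>+z. ennreal (exp (l * t)) * (P (t - \<tau>) (y - x - (y - z)) * Q \<tau> (y - z)) \<partial>lborel)"
      proof (rule nn_integral_mono)
        fix z
        have "ennreal \<bar>?I \<tau> z\<bar> = ennreal \<bar>f (t - \<tau>) x z\<bar> * ennreal \<bar>F \<tau> z y\<bar>"
          using True by (simp add: abs_mult ennreal_mult)
        also have "\<dots> \<le> (ennreal (exp (l * (t - \<tau>))) * P (t - \<tau>) (z - x)) * (ennreal (exp (l * \<tau>)) * Q \<tau> (y - z))"
          using True t by (intro mult_mono fP FQ) auto
        also have "\<dots> = (ennreal (exp (l * (t - \<tau>))) * ennreal (exp (l * \<tau>))) * (P (t - \<tau>) (z - x) * Q \<tau> (y - z))"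
          by (simp add: mult_ac)
        also have "ennreal (exp (l * (t - \<tau>))) * ennreal (exp (l * \<tau>)) = ennreal (exp (l * t))"
          by (simp add: ennreal_mult[symmetric] exp_add[symmetric] algebra_simps)
        finally show "ennreal \<bar>?I \<tau> z\<bar> \<le> ennreal (exp (l * t)) * (P (t - \<tau>) (y - x - (y - z)) * Q \<tau> (y - z))"
          by simp
      qed
      also have "\<dots> = ennreal (exp (l * t)) * (\<integral>\<^sup>+z. P (t - \<tau>) (y - x - z) * Q \<tau> z \<partial>lborel)"
        by (subst nn_integral_lborel_reflect[of "\<lambda>z. ennreal (exp (l * t)) * (P (t - \<tau>) (y - x - z) * Q \<tau> z)" y])
           (auto intro!: nn_integral_cmult)
      finally show ?thesis .
    qed auto
    then have "(\<integral>\<^sup>+\<tau>. (\<integral>\<^sup>+z. ennreal \<bar>?I \<tau> z\<bar> \<partial>lborel) \<partial>lborel)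
      \<le> (\<integral>\<^sup>+\<tau>. ennreal (exp (l * t)) * (\<integral>\<^sup>+z. P (t - \<tau>) (y - x - z) * Q \<tau> z \<partial>lborel) \<partial>lborel)"
      by (intro nn_integral_mono)
    also have "\<dots> = ennreal (exp (l * t)) * nn_conv P Q t (y - x)"
      unfolding nn_conv_def by (rule nn_integral_cmult) measurable
    finally show ?thesis .
  qed
  have "ennreal \<bar>st_conv f F t x y\<bar> \<le> (\<integral>\<^sup>+\<tau>. ennreal \<bar>\<integral>z. ?I \<tau> z \<partial>lborel\<bar> \<partial>lborel)"
    unfolding st_conv_def set_lebesgue_integral_def
    using abs_integral_le_nn_integral[of lborel "\<lambda>\<tau>. \<integral>z. ?I \<tau> z \<partial>lborel"] by simp
  also have "\<dots> \<le> (\<integral>\<^sup>+\<tau>. (\<integral>\<^sup>+z. ennreal \<bar>?I \<tau> z\<bar> \<partial>lborel) \<partial>lborel)"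
    by (intro nn_integral_mono abs_integral_le_nn_integral)
  finally show "ennreal \<bar>st_conv f F t x y\<bar> \<le> ennreal (exp (l * t)) * nn_conv P Q t (y - x)"
    using le by (rule order_trans)
  assume fin: "nn_conv P Q t (y - x) < \<infinity>"
  show "st_conv_defined f F t x y"
    unfolding st_conv_defined_def set_integrable_def
  proof (rule integrableI_bounded)
    let ?J = "\<lambda>p. indicat_real ({0<..<t} \<times> UNIV) p *\<^sub>R (case p of (\<tau>, z) \<Rightarrow> f (t - \<tau>) x z * F \<tau> z y)"
    have J: "?J = (\<lambda>(\<tau>, z). ?I \<tau> z)" by (auto simp: indicator_def)
    show [measurable]: "?J \<in> borel_measurable (lborel \<Otimes>\<^sub>M lborel)" unfolding J by measurable
    have JI: "?J (\<tau>, z) = ?I \<tau> z" for \<tau> z by (simp add: indicator_def)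
    have "(\<integral>\<^sup>+p. ennreal (norm (?J p)) \<partial>(lborel \<Otimes>\<^sub>M lborel))
        = (\<integral>\<^sup>+\<tau>. (\<integral>\<^sup>+z. ennreal (norm (?J (\<tau>, z))) \<partial>lborel) \<partial>lborel)"
      by (rule lborel.nn_integral_fst[symmetric]) measurable
    also have "\<dots> = (\<integral>\<^sup>+\<tau>. (\<integral>\<^sup>+z. ennreal \<bar>?I \<tau> z\<bar> \<partial>lborel) \<partial>lborel)"
      unfolding JI real_norm_def ..
    also have "\<dots> \<le> ennreal (exp (l * t)) * nn_conv P Q t (y - x)" by (rule le)
    also have "\<dots> < \<infinity>" using fin by (simp add: ennreal_mult_less_top)
    finally show "(\<integral>\<^sup>+p. ennreal (norm (?J p)) \<partial>(lborel \<Otimes>\<^sub>M lborel)) < \<infinity>" .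
  qed
qed

text \<open>
  The weight $e^{-lt}$ is multiplicative in time, hence compatible with convolution. Cutting off at $T$ makes the mass
  finite.
\<close>

definition weighted :: "real \<Rightarrow> real \<Rightarrow> (real \<Rightarrow> real \<Rightarrow> ennreal) \<Rightarrow> real \<Rightarrow> real \<Rightarrow> ennreal" where
  "weighted T l g t x = (if 0 < t \<and> t \<le> T then ennreal (exp (- l * t)) * g t x else 0)"

lemma nn_measurable_weighted:
  assumes "nn_measurable g"
  shows "nn_measurable (weighted T l g)"
proof -
  note [measurable (raw)] = nn_measurableD[OF assms]
  show ?thesis unfolding nn_measurable_def weighted_def by measurable
qed

lemma weighted_le:
  assumes "0 \<le> l"
  shows "weighted T l g t x \<le> g t x"
proof (cases "0 < t \<and> t \<le> T")
  case True
  then have "exp (- l * t) \<le> 1" using assms by simp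
  then have "ennreal (exp (- l * t)) * g t x \<le> 1 * g t x"
    by (intro mult_right_mono) (auto simp: ennreal_le_1)
  then show ?thesis using True by (simp add: weighted_def)
qed (auto simp: weighted_def)

lemma exp_times_weighted: "0 < t \<Longrightarrow> t \<le> T \<Longrightarrow> ennreal (exp (l * t)) * weighted T l g t x = g t x"
proof -
  assume t: "0 < t" "t \<le> T"
  have "ennreal (exp (l * t)) * ennreal (exp (- l * t)) = 1"
    by (simp add: ennreal_mult[symmetric] exp_add[symmetric])
  then show ?thesis using t by (simp add: weighted_def mult.assoc[symmetric])
qed

lemma mass_weighted:
  assumes g: "nn_measurable g"
  shows "mass (weighted T l g) = (\<integral>\<^sup>+t. ennreal (exp (- l * t)) * (indicator {0<..T} t * (\<integral>\<^sup>+x. g t x \<partial>lborel)) \<partial>lborel)"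
proof -
  note [measurable (raw)] = nn_measurableD[OF g]
  have "(\<integral>\<^sup>+x. weighted T l g t x \<partial>lborel) = ennreal (exp (- l * t)) * (indicator {0<..T} t * (\<integral>\<^sup>+x. g t x \<partial>lborel))" for t
    unfolding weighted_def by (cases "0 < t \<and> t \<le> T") (auto simp: nn_integral_cmult)
  then show ?thesis by (simp add: mass_def)
qed

text \<open>Dominated convergence along $l = n \to \infty$: the weight $e^{-nt}$ tends to $0$ for every $t > 0$.\<close>

lemma mass_weighted_small:
  assumes g: "nn_measurable g" and fin: "mass (weighted T 0 g) < \<infinity>" and e: "0 < e"
  shows "\<exists>l\<ge>0. mass (weighted T l g) < ennreal e"
proof -
  note [measurable (raw)] = nn_measurableD[OF g]
  define w where "w t = indicator {0<..T} t * (\<integral>\<^sup>+x. g t x \<partial>lborel)" for t :: real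
  have [measurable]: "w \<in> borel_measurable borel" unfolding w_def[abs_def] by measurable
  have w: "(\<integral>\<^sup>+t. w t \<partial>lborel) < \<infinity>" using fin by (simp add: mass_weighted[OF g] w_def)
  have "(\<lambda>n. \<integral>\<^sup>+t. ennreal (exp (- real n * t)) * w t \<partial>lborel) \<longlonglongrightarrow> (\<integral>\<^sup>+t. 0 \<partial>(lborel :: real measure))"
  proof (rule nn_integral_dominated_convergence[where w = w and u = "\<lambda>n t. ennreal (exp (- real n * t)) * w t" and u' = "\<lambda>_. 0"])
    show "AE t in lborel. ennreal (exp (- real n * t)) * w t \<le> w t" for n
    proof (rule AE_I2)
      fix t
      show "ennreal (exp (- real n * t)) * w t \<le> w t"
      proof (cases "0 < t")
        case True
        then have "ennreal (exp (- real n * t)) * w t \<le> 1 * w t"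
          by (intro mult_right_mono) (auto simp: ennreal_le_1)
        then show ?thesis by simp
      qed (simp add: w_def)
    qed
    have "AE t in lborel. w t \<noteq> \<infinity>" using w by (intro nn_integral_PInf_AE) auto
    then show "AE t in lborel. (\<lambda>n. ennreal (exp (- real n * t)) * w t) \<longlonglongrightarrow> 0"
    proof eventually_elim
      fix t assume fin: "w t \<noteq> \<infinity>"
      show "(\<lambda>n. ennreal (exp (- real n * t)) * w t) \<longlonglongrightarrow> 0"
      proof (cases "0 < t")
        case True
        have "(\<lambda>n. exp (- real n * t)) \<longlonglongrightarrow> 0" using True by real_asymp
        then have "(\<lambda>n. ennreal (exp (- real n * t))) \<longlonglongrightarrow> ennreal 0" by (rule tendsto_ennrealI)
        then have "(\<lambda>n. ennreal (exp (- real n * t)) * w t) \<longlonglongrightarrow> ennreal 0 * w t"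
          using fin by (intro tendsto_mult_ennreal) (auto simp: less_top)
        then show ?thesis by simp
      qed (simp add: w_def)
    qed
  qed (use w in auto)
  then have "\<forall>\<^sub>F n in sequentially. (\<integral>\<^sup>+t. ennreal (exp (- real n * t)) * w t \<partial>lborel) < ennreal e"
    by (rule order_tendstoD) (use e in simp)
  then obtain n where "(\<integral>\<^sup>+t. ennreal (exp (- real n * t)) * w t \<partial>lborel) < ennreal e"
    by (auto simp: eventually_sequentially)
  then show ?thesis by (intro exI[of _ "real n"]) (simp add: mass_weighted[OF g] w_def)
qed

text \<open>Indexed from $0$, so that the $k$-th entry dominates the convolution power with exponent $k + 1$.\<close>

primrec nn_power :: "(real \<Rightarrow> real \<Rightarrow> ennreal) \<Rightarrow> nat \<Rightarrow> real \<Rightarrow> real \<Rightarrow> ennreal" where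
  "nn_power g 0 = g"
| "nn_power g (Suc k) = nn_conv (nn_power g k) g"

lemma nn_measurable_power: "nn_measurable g \<Longrightarrow> nn_measurable (nn_power g k)"
  by (induction k) (auto intro: nn_measurable_conv)

lemma mass_nn_power: "nn_measurable g \<Longrightarrow> mass (nn_power g k) = mass g ^ Suc k"
  by (induction k) (simp_all add: mass_nn_conv nn_measurable_power mult.commute)

lemma nn_conv_eq_0:
  assumes "\<And>s x. s \<le> 0 \<Longrightarrow> f s x = 0" "\<And>s x. s \<le> 0 \<Longrightarrow> h s x = 0" "t \<le> 0"
  shows "nn_conv f h t x = 0"
proof -
  have zero: "f (t - \<tau>) (x - z) * h \<tau> z = 0" for \<tau> z
    using assms(1)[of "t - \<tau>" "x - z"] assms(2)[of \<tau> z] assms(3) by (cases "\<tau> \<le> 0") auto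
  show ?thesis unfolding nn_conv_def zero by simp
qed

lemma nn_power_eq_0:
  assumes "\<And>s x. s \<le> 0 \<Longrightarrow> g s x = 0" "t \<le> 0"
  shows "nn_power g k t x = 0"
  using assms(2)
proof (induction k arbitrary: t x)
  case (Suc k)
  then show ?case using assms(1) by (simp add: nn_conv_eq_0)
qed (use assms(1) in simp)

text \<open>The splitting bound gives $N_{k+1} \le 2^\kappa(N_k \theta + N \theta^{k+1})$ for the constants in front of
  $t^{-\kappa}$ when $\theta$ bounds the mass. With $2^\kappa\theta = \frac14$ both terms are at most
  $\frac14 N 2^{-k}$, which keeps $N_k = N 2^{-k}$ going.\<close>

lemma nn_power_le:
  assumes g: "nn_measurable g" and g0: "\<And>s x. s \<le> 0 \<Longrightarrow> g s x = 0"
    and gb: "\<And>s x. 0 < s \<Longrightarrow> s \<le> T \<Longrightarrow> g s x \<le> ennreal (N / s ^ \<kappa>)"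
    and N: "0 \<le> N" and small: "mass g \<le> ennreal (1 / (4 * 2 ^ \<kappa>))"
    and t: "0 < t" "t \<le> T"
  shows "nn_power g k t x \<le> ennreal (N / 2 ^ k / t ^ \<kappa>)"
  using t
proof (induction k arbitrary: t x)
  case (Suc k)
  let ?\<theta> = "1 / (4 * 2 ^ \<kappa>) :: real"
  have p: "mass (nn_power g k) \<le> ennreal (?\<theta> / 2 ^ k)"
  proof -
    have "mass (nn_power g k) \<le> ennreal ?\<theta> ^ Suc k"
      unfolding mass_nn_power[OF g] by (intro power_mono small) auto
    also have "\<dots> = ennreal (?\<theta> * ?\<theta> ^ k)" by (subst ennreal_power) (simp_all only: power_Suc, simp)
    also have "\<dots> \<le> ennreal (?\<theta> * (1 / 2) ^ k)"
    proof (intro ennreal_leI mult_left_mono power_mono)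
      have "(1::real) \<le> 2 ^ \<kappa>" by simp
      then have "(1::real) \<le> 2 * 2 ^ \<kappa>" by linarith
      then show "?\<theta> \<le> 1 / 2" by (simp add: field_simps)
    qed auto
    finally show ?thesis by (simp add: power_one_over)
  qed
  have "nn_power g (Suc k) t x \<le> ennreal (N / 2 ^ k * 2 ^ \<kappa> / t ^ \<kappa>) * mass g + ennreal (N * 2 ^ \<kappa> / t ^ \<kappa>) * mass (nn_power g k)"
    unfolding nn_power.simps
    by (rule nn_conv_le[OF nn_measurable_power[OF g] g nn_power_eq_0[OF g0] g0 Suc.IH gb])
       (use N Suc.prems in auto)
  also have "\<dots> \<le> ennreal (N / 2 ^ k * 2 ^ \<kappa> / t ^ \<kappa>) * ennreal ?\<theta> + ennreal (N * 2 ^ \<kappa> / t ^ \<kappa>) * ennreal (?\<theta> / 2 ^ k)"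
    by (intro add_mono mult_left_mono small p) auto
  also have "\<dots> = ennreal (N / 2 ^ k * 2 ^ \<kappa> / t ^ \<kappa> * ?\<theta> + N * 2 ^ \<kappa> / t ^ \<kappa> * (?\<theta> / 2 ^ k))"
    using N Suc.prems by (simp add: ennreal_mult[symmetric] ennreal_plus[symmetric] del: ennreal_plus)
  also have "N / 2 ^ k * 2 ^ \<kappa> / t ^ \<kappa> * ?\<theta> + N * 2 ^ \<kappa> / t ^ \<kappa> * (?\<theta> / 2 ^ k) = N / 2 ^ Suc k / t ^ \<kappa>"
    by simp
  finally show ?case .
qed (use gb in simp)

text \<open>Convergence of the series for any kernel \<open>F\<close> with a translation invariant majorant of finite mass on $(0,T]$ and at most
  polynomial blow-up of the supremum as $t \to 0$. The power \<open>\<kappa>\<close> is arbitrary, so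
  the supremum need not be integrable in time: the smallness of the mass replaces the usual gain of
  integrability from one convolution power to the next.\<close>

theorem parametrix_series:
  fixes F p :: kernel and g h :: "real \<Rightarrow> real \<Rightarrow> ennreal"
  assumes F: "kernel_measurable F" and p: "kernel_measurable p"
    and g: "nn_measurable g" and h: "nn_measurable h"
    and Fg: "\<And>t x y. 0 < t \<Longrightarrow> t \<le> T \<Longrightarrow> ennreal \<bar>F t x y\<bar> \<le> g t (y - x)"
    and ph: "\<And>t x y. 0 < t \<Longrightarrow> t \<le> T \<Longrightarrow> ennreal \<bar>p t x y\<bar> \<le> h t (y - x)"
    and gb: "\<And>t x. 0 < t \<Longrightarrow> t \<le> T \<Longrightarrow> g t x \<le> ennreal (N / t ^ \<kappa>)"
    and hb: "\<And>t x. 0 < t \<Longrightarrow> t \<le> T \<Longrightarrow> h t x \<le> ennreal (A / t ^ \<kappa>)"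
    and NA: "0 \<le> N" "0 \<le> A"
    and gm: "(\<integral>\<^sup>+t. indicator {0<..T} t * (\<integral>\<^sup>+x. g t x \<partial>lborel) \<partial>lborel) < \<infinity>"
    and hm: "(\<integral>\<^sup>+t. indicator {0<..T} t * (\<integral>\<^sup>+x. h t x \<partial>lborel) \<partial>lborel) < \<infinity>"
    and t: "0 < t" "t \<le> T"
  shows "\<forall>k\<ge>1. st_conv_defined (st_power F k) F t x y"
    and "summable (\<lambda>k. st_power F (Suc k) t x y)"
    and "st_conv_defined p (\<lambda>t x y. \<Sum>k. st_power F (Suc k) t x y) t x y"
proof -
  have "mass (weighted T 0 g) < \<infinity>" using gm by (simp add: mass_weighted[OF g])
  then obtain l where l: "0 \<le> l" and small: "mass (weighted T l g) < ennreal (1 / (4 * 2 ^ \<kappa>))"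
    using mass_weighted_small[OF g, of T "1 / (4 * 2 ^ \<kappa>)"] by auto
  define w where "w = weighted T l g"
  have w: "nn_measurable w" unfolding w_def by (rule nn_measurable_weighted[OF g])
  have w0: "w s x = 0" if "s \<le> 0" for s x using that by (simp add: w_def weighted_def)
  have wb: "w s x \<le> ennreal (N / s ^ \<kappa>)" if "0 < s" "s \<le> T" for s x
    unfolding w_def by (rule order_trans[OF weighted_le]) (use l that gb in auto)
  define G where "G k = nn_power w k" for k
  have G: "nn_measurable (G k)" for k unfolding G_def by (rule nn_measurable_power[OF w])
  \<comment> \<open>The geometric factor makes the series converge, uniformly in space.\<close>
  have Gb: "G k s x \<le> ennreal (N / 2 ^ k / s ^ \<kappa>)" if "0 < s" "s \<le> T" for k s x
    unfolding G_def by (rule nn_power_le[OF w w0 wb]) (use NA small that in \<open>auto simp: w_def\<close>)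
  have Gfin: "G k s x < \<infinity>" if "0 < s" "s \<le> T" for k s x
    using Gb[OF that, of k x] by (rule le_less_trans) simp
  have Fw: "ennreal \<bar>F s x y\<bar> \<le> ennreal (exp (l * s)) * w s (y - x)" if "0 < s" "s \<le> T" for s x y
    unfolding w_def exp_times_weighted[OF that] by (rule Fg[OF that])
  have PG: "ennreal \<bar>st_power F (Suc k) s x y\<bar> \<le> ennreal (exp (l * s)) * G k s (y - x)"
    if "0 < s" "s \<le> T" for k s x y
    using that
  proof (induction k arbitrary: s x y)
    case 0
    then show ?case using Fw by (simp add: G_def)
  next
    case (Suc k)
    have "ennreal \<bar>st_conv (st_power F (Suc k)) F s x y\<bar> \<le> ennreal (exp (l * s)) * nn_conv (G k) w s (y - x)"
      by (rule abs_st_conv_le[OF kernel_measurable_st_power[OF F] F G w Suc.IH Fw]) (use Suc.prems in auto)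
    then show ?case by (simp add: G_def)
  qed
  show "\<forall>k\<ge>1. st_conv_defined (st_power F k) F t x y"
  proof (intro allI impI)
    fix k :: nat assume "1 \<le> k"
    then obtain j where k: "k = Suc j" by (cases k) auto
    have "nn_conv (G j) w t (y - x) < \<infinity>" using Gfin[OF t, of "Suc j"] by (simp add: G_def)
    then show "st_conv_defined (st_power F k) F t x y"
      unfolding k
      by (intro st_conv_defined_if[where T = T and l = l and P = "G j" and Q = w] kernel_measurable_st_power F G w PG Fw t)
  qed
  have Pb: "\<bar>st_power F (Suc k) s x y\<bar> \<le> exp (l * s) * (N / s ^ \<kappa>) * (1 / 2) ^ k" if "0 < s" "s \<le> T" for k s x y
  proof -
    have "ennreal \<bar>st_power F (Suc k) s x y\<bar> \<le> ennreal (exp (l * s)) * ennreal (N / 2 ^ k / s ^ \<kappa>)"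
      by (rule order_trans[OF PG[OF that] mult_left_mono[OF Gb[OF that]]]) simp
    also have "\<dots> = ennreal (exp (l * s) * (N / s ^ \<kappa>) * (1 / 2) ^ k)"
      using NA that by (simp add: ennreal_mult[symmetric] power_one_over)
    finally show ?thesis using NA that by (subst (asm) ennreal_le_iff) auto
  qed
  have gs: "summable (\<lambda>k. exp (l * s) * (N / s ^ \<kappa>) * (1 / 2) ^ k)" for s
    by (intro summable_mult summable_geometric) auto
  have abs_sum: "summable (\<lambda>k. \<bar>st_power F (Suc k) s x y\<bar>)" if "0 < s" "s \<le> T" for s x y
    by (rule summable_comparison_test'[OF gs[of s]]) (use Pb[OF that] in auto)
  then show "summable (\<lambda>k. st_power F (Suc k) t x y)" by (rule summable_rabs_cancel[OF _ ]) (fact t)+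
  define S where "S s x = (\<Sum>k. G k s x)" for s x
  have S: "nn_measurable S"
  proof -
    note [measurable (raw)] = nn_measurableD[OF G]
    show ?thesis unfolding nn_measurable_def S_def by measurable
  qed
  have S0: "S s x = 0" if "s \<le> 0" for s x
    using nn_power_eq_0[OF w0 that] by (simp add: S_def G_def)
  have Sb: "S s x \<le> ennreal (2 * N / s ^ \<kappa>)" if "0 < s" "s \<le> T" for s x
  proof -
    have "S s x \<le> (\<Sum>k. ennreal (N / s ^ \<kappa> * (1 / 2) ^ k))"
      unfolding S_def
    proof (intro suminf_le allI)
      show "G k s x \<le> ennreal (N / s ^ \<kappa> * (1 / 2) ^ k)" for k
        using Gb[OF that, of k x] by (simp add: power_one_over mult.commute)
    qed (rule summableI)+
    also have "\<dots> = ennreal (N / s ^ \<kappa> * 2)"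
    proof (rule suminf_ennreal_eq)
      show "0 \<le> N / s ^ \<kappa> * (1 / 2) ^ k" for k using NA that by simp
      show "(\<lambda>k. N / s ^ \<kappa> * (1 / 2) ^ k) sums (N / s ^ \<kappa> * 2)"
        using geometric_sums[of "1 / 2 :: real"] by (intro sums_mult) simp
    qed
    finally show ?thesis by (simp add: mult.commute)
  qed
  have Smass: "mass S < \<infinity>"
  proof -
    note [measurable (raw)] = nn_measurableD[OF G]
    have "mass S = (\<Sum>k. mass (G k))"
      unfolding mass_def S_def by (subst nn_integral_suminf, measurable, subst nn_integral_suminf, measurable)
    also have "\<dots> \<le> (\<Sum>k. ennreal ((1 / 2) ^ Suc k))"
    proof (intro suminf_le allI)
      fix k
      have "(1::real) \<le> 2 ^ \<kappa>" by simp
      then have "(1::real) \<le> 2 * 2 ^ \<kappa>" by linarith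
      then have "1 / (4 * 2 ^ \<kappa>) \<le> (1 / 2 :: real)" by (simp add: field_simps)
      then have "mass w \<le> ennreal (1 / 2)"
        using small unfolding w_def by (meson ennreal_leI less_imp_le order_trans)
      then have "mass w ^ Suc k \<le> ennreal (1 / 2) ^ Suc k" by (intro power_mono) auto
      also have "\<dots> = ennreal ((1 / 2) ^ Suc k)" by (rule ennreal_power) simp
      finally show "mass (G k) \<le> ennreal ((1 / 2) ^ Suc k)"
        unfolding G_def mass_nn_power[OF w] .
    qed (rule summableI)+
    also have "\<dots> = ennreal 1"
      by (rule suminf_ennreal_eq[OF _ power_half_series]) simp
    finally show ?thesis by (rule le_less_trans) simp
  qed
  define P where "P = weighted T l h"
  have P: "nn_measurable P" unfolding P_def by (rule nn_measurable_weighted[OF h])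
  have pP: "ennreal \<bar>p s x y\<bar> \<le> ennreal (exp (l * s)) * P s (y - x)" if "0 < s" "s \<le> T" for s x y
    unfolding P_def exp_times_weighted[OF that] by (rule ph[OF that])
  have Pmass: "mass P < \<infinity>"
  proof -
    have "weighted T l h s x \<le> weighted T 0 h s x" for s x
      using weighted_le[OF l, of T h s x] by (auto simp: weighted_def)
    then have "mass P \<le> mass (weighted T 0 h)"
      unfolding mass_def P_def by (intro nn_integral_mono)
    also have "\<dots> < \<infinity>" using hm by (simp add: mass_weighted[OF h])
    finally show ?thesis .
  qed
  have FS: "ennreal \<bar>\<Sum>k. st_power F (Suc k) s x y\<bar> \<le> ennreal (exp (l * s)) * S s (y - x)"
    if "0 < s" "s \<le> T" for s x y
  proof -
    have "\<bar>\<Sum>k. st_power F (Suc k) s x y\<bar> \<le> (\<Sum>k. \<bar>st_power F (Suc k) s x y\<bar>)"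
      by (rule summable_rabs[OF abs_sum[OF that]])
    then have "ennreal \<bar>\<Sum>k. st_power F (Suc k) s x y\<bar> \<le> (\<Sum>k. ennreal \<bar>st_power F (Suc k) s x y\<bar>)"
      using abs_sum[OF that] by (subst suminf_ennreal2) (auto intro: ennreal_leI)
    also have "\<dots> \<le> (\<Sum>k. ennreal (exp (l * s)) * G k s (y - x))"
      by (intro suminf_le allI PG that) (rule summableI)+
    also have "\<dots> = ennreal (exp (l * s)) * S s (y - x)" by (simp add: S_def)
    finally show ?thesis .
  qed
  have "nn_conv P S t (y - x)
      \<le> ennreal (A * 2 ^ \<kappa> / t ^ \<kappa>) * mass S + ennreal (2 * N * 2 ^ \<kappa> / t ^ \<kappa>) * mass P"
  proof (rule nn_conv_le[OF P S _ S0 _ Sb _ _ t])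
    show "P s x = 0" if "s \<le> 0" for s x using that by (simp add: P_def weighted_def)
    show "P s x \<le> ennreal (A / s ^ \<kappa>)" if "0 < s" "s \<le> T" for s x
      unfolding P_def by (rule order_trans[OF weighted_le]) (use l that hb in auto)
  qed (use NA in auto)
  also have "\<dots> < \<infinity>" using Smass Pmass by (simp add: ennreal_mult_less_top)
  finally show "st_conv_defined p (\<lambda>t x y. \<Sum>k. st_power F (Suc k) t x y) t x y"
    using st_conv_defined_if[OF p kernel_measurable_suminf[OF kernel_measurable_st_power[OF F]] P S pP FS t] by blast
qed

section \<open>Integrating the bounds over the jump size\<close>

lemma le_powr_of_le:
  fixes x y a :: real
  assumes "0 \<le> x" "x \<le> 1" "x \<le> y" "0 \<le> a" "a \<le> 1"
  shows "x \<le> y powr a"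
proof (cases "x = 0")
  case False
  then have "x powr 1 \<le> x powr a" using assms by (intro powr_mono') auto
  also have "\<dots> \<le> y powr a" using assms False by (intro powr_mono2) auto
  finally show ?thesis using assms False by simp
qed simp

context levy_setting
begin

lemma measurable_q_upper [measurable]: "q_upper \<mu> \<in> borel_measurable borel"
  unfolding q_upper_def[abs_def] by measurable

end

context levy_scaling
begin

lemma q_upper_pos_everywhere:
  assumes "0 < \<xi>" shows "0 < q_upper \<mu> \<xi>"
proof (cases "\<xi>0 \<le> \<xi>")
  case False
  then have "q_upper \<mu> ((\<xi>0 / \<xi>) * \<xi>) \<le> (\<xi>0 / \<xi>)\<^sup>2 * q_upper \<mu> \<xi>"
    using assms by (intro q_upper_scale_le) auto
  then have "0 < (\<xi>0 / \<xi>)\<^sup>2 * q_upper \<mu> \<xi>" using assms q_upper_pos by simp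
  then show ?thesis by (simp add: zero_less_mult_iff)
qed (rule q_upper_pos_above)

text \<open>On the shell $2^{-n-1} < |u| \le 2^{-n}$ the integrand is at most $2^{-n\delta}/q^U(2^n)$, and the shell has mass at most
  $q^U(2^{n+1}) \le 4 q^U(2^n)$. What remains is the geometric series of $2^{-n\delta}$.\<close>

lemma nn_integral_powr_over_q_upper:
  assumes \<delta>: "0 < \<delta>"
  shows "(\<integral>\<^sup>+u. (if u \<noteq> 0 \<and> \<bar>u\<bar> \<le> 1 then ennreal (\<bar>u\<bar> powr \<delta> / q_upper \<mu> (1 / \<bar>u\<bar>)) else 0) \<partial>\<mu>) < \<infinity>"
proof -
  define r where "r = (2::real) powr (- \<delta>)"
  have r: "0 < r" "r < 1" using \<delta> powr_less_mono[of "-\<delta>" 0 2] by (auto simp: r_def)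
  define c where "c n = r ^ n / q_upper \<mu> (2 ^ n)" for n :: nat
  define B where "B n = {u::real. \<bar>u\<bar> > 1 / 2 ^ Suc n}" for n :: nat
  have [measurable]: "B n \<in> sets borel" for n unfolding B_def by measurable
  have c: "0 \<le> c n" for n using r by (simp add: c_def q_upper_nonneg)
  have le: "(if u \<noteq> 0 \<and> \<bar>u\<bar> \<le> 1 then ennreal (\<bar>u\<bar> powr \<delta> / q_upper \<mu> (1 / \<bar>u\<bar>)) else 0)
      \<le> (\<Sum>n. ennreal (c n) * indicator (B n) u)" for u
  proof (cases "u \<noteq> 0 \<and> \<bar>u\<bar> \<le> 1")
    case True
    then have "1 \<le> 1 / \<bar>u\<bar>" by simp
    then obtain n where n: "2 ^ n \<le> 1 / \<bar>u\<bar>" "1 / \<bar>u\<bar> < 2 ^ Suc n" by (rule dyadic_bracket)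
    have "u \<in> B n" using n True by (simp add: B_def field_simps)
    have "\<bar>u\<bar> \<le> 2 powr (- real n)"
      using n True by (simp add: powr_minus powr_realpow field_simps)
    then have "\<bar>u\<bar> powr \<delta> \<le> (2 powr (- real n)) powr \<delta>" using \<delta> by (intro powr_mono2) auto
    also have "\<dots> = r ^ n" by (simp add: r_def powr_powr powr_realpow[symmetric] mult.commute)
    finally have a: "\<bar>u\<bar> powr \<delta> \<le> r ^ n" .
    have "q_upper \<mu> (2 ^ n) \<le> q_upper \<mu> (1 / \<bar>u\<bar>)" using n by (intro q_upper_mono) auto
    then have "\<bar>u\<bar> powr \<delta> / q_upper \<mu> (1 / \<bar>u\<bar>) \<le> c n"
      unfolding c_def using a r q_upper_pos_everywhere[of "2 ^ n"] by (intro frac_le) auto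
    then have "ennreal (\<bar>u\<bar> powr \<delta> / q_upper \<mu> (1 / \<bar>u\<bar>)) \<le> ennreal (c n) * indicator (B n) u"
      using \<open>u \<in> B n\<close> by (simp add: ennreal_leI)
    also have "\<dots> \<le> (\<Sum>n. ennreal (c n) * indicator (B n) u)"
    proof -
      have "(\<Sum>k\<in>{n}. ennreal (c k) * indicator (B k) u) \<le> (\<Sum>k. ennreal (c k) * indicator (B k) u)"
        by (rule sum_le_suminf) (auto intro: summableI)
      then show ?thesis by (simp only: sum.insert sum.empty finite.emptyI empty_iff not_False_eq_True add_0_right)
    qed
    finally show ?thesis using True by simp
  qed auto
  have "(\<integral>\<^sup>+u. (if u \<noteq> 0 \<and> \<bar>u\<bar> \<le> 1 then ennreal (\<bar>u\<bar> powr \<delta> / q_upper \<mu> (1 / \<bar>u\<bar>)) else 0) \<partial>\<mu>)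
      \<le> (\<integral>\<^sup>+u. (\<Sum>n. ennreal (c n) * indicator (B n) u) \<partial>\<mu>)"
    by (intro nn_integral_mono le)
  also have "\<dots> = (\<Sum>n. ennreal (c n) * emeasure \<mu> (B n))"
    by (subst nn_integral_suminf, measurable) (simp add: nn_integral_cmult_indicator)
  also have "\<dots> \<le> (\<Sum>n. ennreal (4 * r ^ n))"
  proof (intro suminf_le allI)
    fix n
    have "emeasure \<mu> (B n) \<le> ennreal (q_upper \<mu> (2 * 2 ^ n))"
      using emeasure_outside_le_q_upper[of "2 ^ Suc n"] by (simp add: B_def)
    also have "\<dots> \<le> ennreal (4 * q_upper \<mu> (2 ^ n))"
      using q_upper_scale_le[of 2 "2 ^ n"] by (intro ennreal_leI) simp
    finally have "ennreal (c n) * emeasure \<mu> (B n) \<le> ennreal (c n) * ennreal (4 * q_upper \<mu> (2 ^ n))"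
      by (rule mult_left_mono) simp
    also have "\<dots> = ennreal (4 * r ^ n)"
      using c[of n] q_upper_pos_everywhere[of "2 ^ n"]
      by (subst ennreal_mult[symmetric]) (auto simp: c_def mult.commute)
    finally show "ennreal (c n) * emeasure \<mu> (B n) \<le> ennreal (4 * r ^ n)" .
  qed (rule summableI)+
  also have "\<dots> = ennreal (4 * (1 / (1 - r)))"
  proof (rule suminf_ennreal_eq)
    show "(\<lambda>n. 4 * r ^ n) sums (4 * (1 / (1 - r)))" using r by (intro sums_mult geometric_sums) auto
  qed (use r in simp)
  finally show ?thesis by (rule le_less_trans) simp
qed

definition weight :: "real \<Rightarrow> real \<Rightarrow> real" where "weight \<epsilon> u = min 1 (\<bar>u\<bar> powr \<epsilon>)"

lemma weight_nonneg: "0 \<le> weight \<epsilon> u" by (simp add: weight_def)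

lemma measurable_weight [measurable]: "weight \<epsilon> \<in> borel_measurable borel"
  unfolding weight_def[abs_def] by measurable

text \<open>Compare the scales $\rho$ and $1/|u|$. If $\rho$ is the larger one, monotonicity of $q^U$ suffices; otherwise
  $q^U(1/|u|) \le (|u|\rho)^{-2} q^U(\rho)$. This removes $\rho$ from the estimate and leaves an explicit function
  of $t$ and $u$.\<close>

abbreviation damped :: "real \<Rightarrow> real \<Rightarrow> real \<Rightarrow> ennreal" where
  "damped \<epsilon> \<rho> u \<equiv> ennreal (weight \<epsilon> u * min 1 (\<rho>\<^sup>2 * u\<^sup>2))"

lemma min_1_scaled_square_le:
  assumes u: "u \<noteq> 0" and \<rho>: "0 < \<rho>" and t: "0 < t" and C: "1 / t \<le> q_upper \<mu> \<rho>" "q_upper \<mu> \<rho> \<le> C / t"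
  shows "min 1 (\<rho>\<^sup>2 * u\<^sup>2) \<le> C / (t * q_upper \<mu> (1 / \<bar>u\<bar>))"
proof -
  have K: "0 < q_upper \<mu> (1 / \<bar>u\<bar>)" using u by (intro q_upper_pos_everywhere) auto
  have "min 1 (\<rho>\<^sup>2 * u\<^sup>2) * q_upper \<mu> (1 / \<bar>u\<bar>) \<le> q_upper \<mu> \<rho>"
  proof (cases "\<rho> \<le> 1 / \<bar>u\<bar>")
    case True
    then have "1 \<le> 1 / (\<bar>u\<bar> * \<rho>)" using u \<rho> by (simp add: field_simps)
    then have "q_upper \<mu> (1 / (\<bar>u\<bar> * \<rho>) * \<rho>) \<le> (1 / (\<bar>u\<bar> * \<rho>))\<^sup>2 * q_upper \<mu> \<rho>"
      by (rule q_upper_scale_le)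
    then have "\<rho>\<^sup>2 * u\<^sup>2 * q_upper \<mu> (1 / \<bar>u\<bar>) \<le> q_upper \<mu> \<rho>"
      using u \<rho> by (simp add: power_divide power_mult_distrib field_simps)
    moreover have "min 1 (\<rho>\<^sup>2 * u\<^sup>2) * q_upper \<mu> (1 / \<bar>u\<bar>) \<le> \<rho>\<^sup>2 * u\<^sup>2 * q_upper \<mu> (1 / \<bar>u\<bar>)"
      using K by (intro mult_right_mono) auto
    ultimately show ?thesis by linarith
  next
    case False
    have "min 1 (\<rho>\<^sup>2 * u\<^sup>2) * q_upper \<mu> (1 / \<bar>u\<bar>) \<le> 1 * q_upper \<mu> (1 / \<bar>u\<bar>)"
      using K by (intro mult_right_mono) auto
    also have "\<dots> \<le> q_upper \<mu> \<rho>" using False u unfolding mult_1 by (intro q_upper_mono) auto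
    finally show ?thesis .
  qed
  then have "min 1 (\<rho>\<^sup>2 * u\<^sup>2) * q_upper \<mu> (1 / \<bar>u\<bar>) \<le> C / t" using C by linarith
  then show ?thesis using K t by (simp add: field_simps)
qed

text \<open>Bounding $1 \wedge \rho^2u^2$ by the full power of $1/(t\,q^U(1/|u|))$ would give $t^{-1}$, which is not integrable at
  $0$. The power $1 - \eta$ is used instead. The price $q^U(1/|u|)^\eta \le \mathrm{const}\cdot|u|^{-2\eta}$ is paid by the weight
  $|u|^\epsilon$, as $2\eta < \epsilon$. Jumps with $|u| > 1$ have finite total mass.\<close>

lemma weight_integral_bound:
  assumes \<epsilon>: "0 < \<epsilon>" and T: "0 < T" and C1: "0 < C"
  shows "\<exists>K0\<ge>0. \<exists>\<eta>>0. \<forall>t \<rho>. 0 < t \<longrightarrow> t \<le> T \<longrightarrow> 0 < \<rho> \<longrightarrow> 1 / t \<le> q_upper \<mu> \<rho> \<longrightarrow> q_upper \<mu> \<rho> \<le> C / t \<longrightarrow>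
    (\<integral>\<^sup>+u. damped \<epsilon> \<rho> u \<partial>\<mu>) \<le> ennreal (K0 * t powr (\<eta> - 1))"
proof -
  define \<eta> where "\<eta> = min \<epsilon> 1 / 4"
  have \<eta>: "0 < \<eta>" "\<eta> \<le> 1" "2 * \<eta> < \<epsilon>" using \<epsilon> by (auto simp: \<eta>_def min_def)
  define h where "h u = (if u \<noteq> 0 \<and> \<bar>u\<bar> \<le> 1 then ennreal (\<bar>u\<bar> powr (\<epsilon> - 2 * \<eta>) / q_upper \<mu> (1 / \<bar>u\<bar>)) else 0)" for u
  have [measurable]: "h \<in> borel_measurable borel" unfolding h_def[abs_def] by measurable
  have hfin: "(\<integral>\<^sup>+u. h u \<partial>\<mu>) < \<infinity>" unfolding h_def by (rule nn_integral_powr_over_q_upper) (use \<eta> in simp)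
  define H where "H = enn2real (\<integral>\<^sup>+u. h u \<partial>\<mu>)"
  have H: "(\<integral>\<^sup>+u. h u \<partial>\<mu>) = ennreal H" "0 \<le> H" using hfin by (auto simp: H_def)
  define L where "L = C powr (1 - \<eta>) * q_upper \<mu> 1 powr \<eta>"
  define R where "R = q_upper \<mu> 1 * T powr (1 - \<eta>)"
  have L: "0 \<le> L" and R: "0 \<le> R" by (auto simp: L_def R_def q_upper_nonneg)
  have "(\<integral>\<^sup>+u. damped \<epsilon> \<rho> u \<partial>\<mu>) \<le> ennreal ((L * H + R) * t powr (\<eta> - 1))"
    if t: "0 < t" "t \<le> T" and \<rho>: "0 < \<rho>" and q: "1 / t \<le> q_upper \<mu> \<rho>" "q_upper \<mu> \<rho> \<le> C / t" for t \<rho>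
  proof -
    have pw: "damped \<epsilon> \<rho> u \<le> ennreal (L * t powr (\<eta> - 1)) * h u + indicator {u. \<bar>u\<bar> > 1 / 1} u" for u
    proof -
      consider "u = 0" | "\<bar>u\<bar> > 1" | "u \<noteq> 0" "\<bar>u\<bar> \<le> 1" by linarith
      then show ?thesis
      proof cases
        case 1
        then show ?thesis by (simp add: weight_def)
      next
        case 2
        have "weight \<epsilon> u * min 1 (\<rho>\<^sup>2 * u\<^sup>2) \<le> 1 * 1" by (intro mult_mono) (auto simp: weight_def)
        then have "damped \<epsilon> \<rho> u \<le> 1" by (simp add: ennreal_le_1)
        then show ?thesis using 2 by (simp add: add_increasing)
      next
        case 3
        define K where "K = q_upper \<mu> (1 / \<bar>u\<bar>)"
        have K: "0 < K" unfolding K_def using 3 by (intro q_upper_pos_everywhere) auto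
        have "K \<le> (1 / \<bar>u\<bar>)\<^sup>2 * q_upper \<mu> 1"
          unfolding K_def using q_upper_scale_le[of "1 / \<bar>u\<bar>" 1] 3 by simp
        then have "K powr \<eta> \<le> ((1 / \<bar>u\<bar>)\<^sup>2 * q_upper \<mu> 1) powr \<eta>"
          using K \<eta> by (intro powr_mono2) auto
        also have "\<dots> = \<bar>u\<bar> powr (- 2 * \<eta>) * q_upper \<mu> 1 powr \<eta>"
        proof -
          have "(1 / \<bar>u\<bar>)\<^sup>2 = \<bar>u\<bar> powr (- 2)"
            using 3 by (simp add: powr_minus power_divide inverse_eq_divide)
          then show ?thesis by (simp add: powr_mult powr_powr q_upper_nonneg)
        qed
        finally have Ke: "K powr \<eta> \<le> \<bar>u\<bar> powr (- 2 * \<eta>) * q_upper \<mu> 1 powr \<eta>" .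
        have "min 1 (\<rho>\<^sup>2 * u\<^sup>2) \<le> (C / (t * K)) powr (1 - \<eta>)"
          unfolding K_def using \<eta> min_1_scaled_square_le[OF 3(1) \<rho> t(1) q] by (intro le_powr_of_le) auto
        also have "\<dots> = C powr (1 - \<eta>) * t powr (\<eta> - 1) * K powr (\<eta> - 1)"
          using C1 t K by (simp add: powr_divide powr_mult powr_diff mult_ac)
        also have "K powr (\<eta> - 1) = K powr \<eta> / K" using K by (simp add: powr_diff)
        also have "C powr (1 - \<eta>) * t powr (\<eta> - 1) * (K powr \<eta> / K)
            \<le> C powr (1 - \<eta>) * t powr (\<eta> - 1) * ((\<bar>u\<bar> powr (- 2 * \<eta>) * q_upper \<mu> 1 powr \<eta>) / K)"
          using K by (intro mult_left_mono divide_right_mono Ke) auto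
        finally have m: "min 1 (\<rho>\<^sup>2 * u\<^sup>2) \<le> C powr (1 - \<eta>) * t powr (\<eta> - 1) * ((\<bar>u\<bar> powr (- 2 * \<eta>) * q_upper \<mu> 1 powr \<eta>) / K)" .
        have "weight \<epsilon> u * min 1 (\<rho>\<^sup>2 * u\<^sup>2)
            \<le> \<bar>u\<bar> powr \<epsilon> * (C powr (1 - \<eta>) * t powr (\<eta> - 1) * ((\<bar>u\<bar> powr (- 2 * \<eta>) * q_upper \<mu> 1 powr \<eta>) / K))"
          using m by (intro mult_mono) (auto simp: weight_def)
        also have "\<dots> = (L * t powr (\<eta> - 1)) * ((\<bar>u\<bar> powr \<epsilon> * \<bar>u\<bar> powr (- 2 * \<eta>)) / K)"
          by (simp add: L_def)
        also have "\<bar>u\<bar> powr \<epsilon> * \<bar>u\<bar> powr (- 2 * \<eta>) = \<bar>u\<bar> powr (\<epsilon> - 2 * \<eta>)"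
          by (simp add: powr_add[symmetric])
        finally have "damped \<epsilon> \<rho> u
            \<le> ennreal ((L * t powr (\<eta> - 1)) * (\<bar>u\<bar> powr (\<epsilon> - 2 * \<eta>) / K))" by (rule ennreal_leI)
        also have "\<dots> = ennreal (L * t powr (\<eta> - 1)) * h u"
          using 3 L K by (simp add: h_def K_def[symmetric] ennreal_mult[symmetric])
        finally show ?thesis by (rule order_trans) simp
      qed
    qed
    have "(\<integral>\<^sup>+u. damped \<epsilon> \<rho> u \<partial>\<mu>)
        \<le> (\<integral>\<^sup>+u. ennreal (L * t powr (\<eta> - 1)) * h u + indicator {u. \<bar>u\<bar> > 1 / 1} u \<partial>\<mu>)"
      by (intro nn_integral_mono pw)
    also have "\<dots> = ennreal (L * t powr (\<eta> - 1)) * ennreal H + emeasure \<mu> {u. \<bar>u\<bar> > 1 / 1}"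
      by (subst nn_integral_add, measurable, subst nn_integral_cmult, measurable)
         (simp add: H(1))
    also have "\<dots> \<le> ennreal (L * t powr (\<eta> - 1)) * ennreal H + ennreal (R * t powr (\<eta> - 1))"
    proof (rule add_left_mono)
      have "emeasure \<mu> {u. \<bar>u\<bar> > 1 / 1} \<le> ennreal (q_upper \<mu> 1)" by (rule emeasure_outside_le_q_upper) simp
      also have "\<dots> \<le> ennreal (R * t powr (\<eta> - 1))"
      proof (rule ennreal_leI)
        have "1 = t powr (1 - \<eta>) * t powr (\<eta> - 1)" using t by (simp add: powr_add[symmetric])
        also have "\<dots> \<le> T powr (1 - \<eta>) * t powr (\<eta> - 1)"
          using t \<eta> by (intro mult_right_mono powr_mono2) auto
        finally have "q_upper \<mu> 1 * 1 \<le> q_upper \<mu> 1 * (T powr (1 - \<eta>) * t powr (\<eta> - 1))"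
          by (rule mult_left_mono) (rule q_upper_nonneg)
        then show "q_upper \<mu> 1 \<le> R * t powr (\<eta> - 1)" by (simp add: R_def mult.assoc)
      qed
      finally show "emeasure \<mu> {u. \<bar>u\<bar> > 1 / 1} \<le> ennreal (R * t powr (\<eta> - 1))" .
    qed
    also have "\<dots> = ennreal (L * t powr (\<eta> - 1) * H + R * t powr (\<eta> - 1))"
      using L R H by (simp add: ennreal_mult)
    also have "L * t powr (\<eta> - 1) * H + R * t powr (\<eta> - 1) = (L * H + R) * t powr (\<eta> - 1)"
      by (simp add: algebra_simps)
    finally show ?thesis .
  qed
  then show ?thesis using L R H \<eta> by (intro exI[of _ "L * H + R"] conjI exI[of _ \<eta>]) auto
qed

end

lemma nn_integral_powr_near_0:
  assumes "0 < \<eta>" "0 \<le> T"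
  shows "(\<integral>\<^sup>+t. indicator {0<..T} t * ennreal (t powr (\<eta> - 1)) \<partial>lborel) < \<infinity>"
proof -
  have hi: "((\<lambda>t. t powr (\<eta> - 1)) has_integral (T powr (\<eta> - 1 + 1) / (\<eta> - 1 + 1))) {0..T}"
    using assms by (intro has_integral_powr_from_0) auto
  have "(\<integral>\<^sup>+t. indicator {0<..T} t * ennreal (t powr (\<eta> - 1)) \<partial>lborel)
      \<le> (\<integral>\<^sup>+t. ennreal (t powr (\<eta> - 1)) * indicator {0..T} t \<partial>lborel)"
    by (intro nn_integral_mono) (auto simp: indicator_def)
  also have "\<dots> = ennreal (T powr (\<eta> - 1 + 1) / (\<eta> - 1 + 1))"
    by (rule nn_integral_has_integral_lebesgue'[OF _ hi]) simp
  finally show ?thesis by (rule le_less_trans) simp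
qed

section \<open>The kernel $\<Phi>$ and its majorant\<close>

context levy_setting
begin

lemma measurable_levy_density:
  assumes [measurable]: "a \<in> borel_measurable M" "b \<in> borel_measurable M"
  shows "(\<lambda>w. levy_density \<mu> (a w) (b w)) \<in> borel_measurable M"
  unfolding levy_density_def fourier_integrand_def by measurable

lemma perturb_integrand_p_zero:
  "perturb_integrand m (\<lambda>z. p_zero \<mu> t z y) x u = second_diff (levy_density \<mu> t) u (y - x) * m x u"
  by (simp add: perturb_integrand_def p_zero_def second_diff_def algebra_simps)

lemma kernel_measurable_p_zero: "kernel_measurable (p_zero \<mu>)"
proof -
  note [measurable (raw)] = measurable_levy_density
  show ?thesis unfolding kernel_measurable_def p_zero_def by measurable
qed

lemma kernel_measurable_Phi:
  assumes m: "(\<lambda>(x, u). m x u) \<in> borel_measurable borel"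
  shows "kernel_measurable (Phi \<mu> m)"
proof -
  have m': "(\<lambda>w. m (a w) (b w)) \<in> borel_measurable M"
    if [measurable]: "a \<in> borel_measurable M" "b \<in> borel_measurable M" for a b and M :: "'c measure"
  proof -
    have "(\<lambda>w. (a w, b w)) \<in> M \<rightarrow>\<^sub>M borel" unfolding borel_prod[symmetric] by measurable
    from measurable_compose[OF this m] show ?thesis by simp
  qed
  note [measurable (raw)] = measurable_levy_density m'
  show ?thesis
    unfolding kernel_measurable_def Phi_def perturb_op_def perturb_integrand_p_zero second_diff_def
    by measurable
qed

end

context levy_scaling
begin

text \<open>The function $G_t$ of the introduction, with \<open>second_diff\<close> in place of $D^2_u$.\<close>

definition Phi_majorant :: "real \<Rightarrow> real \<Rightarrow> real \<Rightarrow> real \<Rightarrow> ennreal" where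
  "Phi_majorant c \<epsilon> t x
    = (\<integral>\<^sup>+u. ennreal (c * weight \<epsilon> u) * ennreal \<bar>second_diff (levy_density \<mu> t) u x\<bar> \<partial>\<mu>)"

lemma nn_measurable_Phi_majorant: "nn_measurable (Phi_majorant c \<epsilon>)"
proof -
  note [measurable (raw)] = measurable_levy_density
  show ?thesis unfolding nn_measurable_def Phi_majorant_def second_diff_def by measurable
qed

lemma
  assumes m: "(\<lambda>(x, u). m x u) \<in> borel_measurable borel"
    and mb: "\<And>x u. 0 \<le> m x u" "\<And>x u. m x u \<le> c * min 1 (\<bar>u\<bar> powr \<epsilon>)"
  shows abs_Phi_le: "ennreal \<bar>Phi \<mu> m t x y\<bar> \<le> Phi_majorant c \<epsilon> t (y - x)"
    and perturb_op_defined_if: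
    "Phi_majorant c \<epsilon> t (y - x) < \<infinity> \<Longrightarrow> perturb_op_defined \<mu> m (\<lambda>z. p_zero \<mu> t z y) x"
proof -
  have [measurable]: "m x \<in> borel_measurable borel"
  proof -
    have "(\<lambda>u::real. (x, u)) \<in> borel \<rightarrow>\<^sub>M borel" unfolding borel_prod[symmetric] by measurable
    from measurable_compose[OF this m] show ?thesis by simp
  qed
  note [measurable (raw)] = measurable_levy_density
  have meas: "perturb_integrand m (\<lambda>z. p_zero \<mu> t z y) x \<in> borel_measurable \<mu>"
    unfolding perturb_integrand_p_zero[abs_def] second_diff_def by measurable
  have le: "(\<integral>\<^sup>+u. ennreal \<bar>perturb_integrand m (\<lambda>z. p_zero \<mu> t z y) x u\<bar> \<partial>\<mu>) \<le> Phi_majorant c \<epsilon> t (y - x)"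
    unfolding Phi_majorant_def
  proof (rule nn_integral_mono)
    fix u
    have "ennreal \<bar>perturb_integrand m (\<lambda>z. p_zero \<mu> t z y) x u\<bar>
        = ennreal (m x u) * ennreal \<bar>second_diff (levy_density \<mu> t) u (y - x)\<bar>"
      using mb(1)[of x u] by (simp add: perturb_integrand_p_zero abs_mult ennreal_mult mult.commute)
    also have "\<dots> \<le> ennreal (c * weight \<epsilon> u) * ennreal \<bar>second_diff (levy_density \<mu> t) u (y - x)\<bar>"
      using mb(2)[of x u] by (intro mult_right_mono ennreal_leI) (auto simp: weight_def)
    finally show "ennreal \<bar>perturb_integrand m (\<lambda>z. p_zero \<mu> t z y) x u\<bar>
        \<le> ennreal (c * weight \<epsilon> u) * ennreal \<bar>second_diff (levy_density \<mu> t) u (y - x)\<bar>" .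
  qed
  have "ennreal \<bar>Phi \<mu> m t x y\<bar> \<le> ennreal \<bar>\<integral>u. perturb_integrand m (\<lambda>z. p_zero \<mu> t z y) x u \<partial>\<mu>\<bar>"
    unfolding Phi_def perturb_op_def by (intro ennreal_leI) (simp add: abs_mult)
  also have "\<dots> \<le> (\<integral>\<^sup>+u. ennreal \<bar>perturb_integrand m (\<lambda>z. p_zero \<mu> t z y) x u\<bar> \<partial>\<mu>)"
    by (rule abs_integral_le_nn_integral)
  finally show "ennreal \<bar>Phi \<mu> m t x y\<bar> \<le> Phi_majorant c \<epsilon> t (y - x)"
    using le by (rule order_trans)
  assume "Phi_majorant c \<epsilon> t (y - x) < \<infinity>"
  then show "perturb_op_defined \<mu> m (\<lambda>z. p_zero \<mu> t z y) x"
    unfolding perturb_op_defined_def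
    by (intro integrableI_bounded meas) (use le in \<open>auto intro: le_less_trans\<close>)
qed

lemma scaled_time_exists:
  assumes T: "0 < T"
  shows "\<exists>C>0. \<exists>D m. \<forall>t. 0 < t \<longrightarrow> t \<le> T \<longrightarrow>
    (\<exists>\<rho>. scaled_time \<mu> t \<rho> C D \<and> 1 / t \<le> q_upper \<mu> \<rho> \<and> q_upper \<mu> \<rho> \<le> C / t \<and> \<rho> \<le> 2 * \<xi>0 * (C / q_upper \<mu> \<xi>0) ^ m / t ^ m)"
proof -
  define C where "C = 4 + T * q_upper \<mu> \<xi>0"
  have C: "0 < C" using T q_upper_pos by (simp add: C_def add_pos_pos)
  obtain D where D: "\<And>t \<rho> \<xi>. 0 < t \<Longrightarrow> \<xi>0 \<le> \<rho> \<Longrightarrow> 1 / t \<le> q_upper \<mu> \<rho> \<Longrightarrow>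
     exp (- t * levy_exponent \<mu> \<xi>) \<le> D / (1 + (\<xi> / \<rho>)\<^sup>2) ^ 3"
    using exp_levy_exponent_decay by blast
  obtain m where m: "\<And>\<rho>. \<xi>0 \<le> \<rho> \<Longrightarrow> \<rho> \<le> 2 * \<xi>0 * (q_upper \<mu> \<rho> / q_upper \<mu> \<xi>0) ^ m"
    using scale_le_power_q_upper by blast
  have "\<exists>\<rho>. scaled_time \<mu> t \<rho> C D \<and> 1 / t \<le> q_upper \<mu> \<rho> \<and> q_upper \<mu> \<rho> \<le> C / t \<and> \<rho> \<le> 2 * \<xi>0 * (C / q_upper \<mu> \<xi>0) ^ m / t ^ m"
    if t: "0 < t" "t \<le> T" for t
  proof -
    obtain \<rho> where \<rho>: "\<xi>0 \<le> \<rho>" "1 / t \<le> q_upper \<mu> \<rho>" "q_upper \<mu> \<rho> \<le> C / t"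
      using exists_scale[OF t] unfolding C_def by blast
    have "scaled_time \<mu> t \<rho> C D"
    proof unfold_locales
      show "t * q_upper \<mu> \<rho> \<le> C" using \<rho> t by (simp add: field_simps)
      show "exp (- t * levy_exponent \<mu> \<xi>) \<le> D / (1 + (\<xi> / \<rho>)\<^sup>2) ^ 3" for \<xi> using D t \<rho> by blast
    qed (use t \<rho> \<xi>0_pos C in auto)
    moreover have "\<rho> \<le> 2 * \<xi>0 * (C / q_upper \<mu> \<xi>0) ^ m / t ^ m"
    proof -
      have "(q_upper \<mu> \<rho> / q_upper \<mu> \<xi>0) ^ m \<le> (C / t / q_upper \<mu> \<xi>0) ^ m"
        using \<rho> q_upper_pos by (intro power_mono divide_right_mono) (auto simp: q_upper_nonneg)
      then have "2 * \<xi>0 * (q_upper \<mu> \<rho> / q_upper \<mu> \<xi>0) ^ m \<le> 2 * \<xi>0 * (C / t / q_upper \<mu> \<xi>0) ^ m"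
        using \<xi>0_pos by (intro mult_left_mono) auto
      also have "\<dots> = 2 * \<xi>0 * (C / q_upper \<mu> \<xi>0) ^ m / t ^ m" by (simp add: power_divide power_mult_distrib mult.commute)
      finally show ?thesis using m[OF \<rho>(1)] by linarith
    qed
    ultimately show ?thesis using \<rho> by blast
  qed
  then show ?thesis using C by blast
qed

text \<open>The estimates at a single time, made uniform on $(0,T]$: the scale $\rho$ is replaced by its bound $R t^{-m}$ in the
  suprema, and the integral over the jump sizes contributes $t^{\eta-1}$. In the suprema $t^{\eta-1}$ is
  weakened to a multiple of $1/t$ so that one natural exponent \<open>\<kappa>\<close> serves all of them.\<close>

lemma heat_kernel_bounds:
  assumes T: "0 < T" and \<epsilon>: "0 < \<epsilon>" and c: "0 \<le> c"
  shows "\<exists>N\<ge>0. \<exists>\<kappa>. \<exists>\<eta>>0. \<forall>t. 0 < t \<longrightarrow> t \<le> T \<longrightarrow>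
    (\<forall>x. integrable lborel (fourier_integrand \<mu> t x)) \<and>
    (\<forall>x. ennreal \<bar>levy_density \<mu> t x\<bar> \<le> ennreal (N / t ^ \<kappa>)) \<and>
    L1_norm (levy_density \<mu> t) \<le> ennreal N \<and>
    (\<forall>x. Phi_majorant c \<epsilon> t x \<le> ennreal (N / t ^ \<kappa>)) \<and>
    (\<integral>\<^sup>+x. Phi_majorant c \<epsilon> t x \<partial>lborel) \<le> ennreal (N * t powr (\<eta> - 1))"
proof -
  obtain C D m where C: "0 < C" and ex: "\<And>t. 0 < t \<Longrightarrow> t \<le> T \<Longrightarrow>
    (\<exists>\<rho>. scaled_time \<mu> t \<rho> C D \<and> 1 / t \<le> q_upper \<mu> \<rho> \<and> q_upper \<mu> \<rho> \<le> C / t \<and> \<rho> \<le> 2 * \<xi>0 * (C / q_upper \<mu> \<xi>0) ^ m / t ^ m)"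
    using scaled_time_exists[OF T] by blast
  obtain K \<eta> where K: "0 \<le> K" and \<eta>: "0 < \<eta>" and Kb: "\<And>t \<rho>. 0 < t \<Longrightarrow> t \<le> T \<Longrightarrow> 0 < \<rho> \<Longrightarrow>
      1 / t \<le> q_upper \<mu> \<rho> \<Longrightarrow> q_upper \<mu> \<rho> \<le> C / t \<Longrightarrow>
      (\<integral>\<^sup>+u. damped \<epsilon> \<rho> u \<partial>\<mu>) \<le> ennreal (K * t powr (\<eta> - 1))"
    using weight_integral_bound[OF \<epsilon> T C] by blast
  define M where "M = (1 + 3 * C + C\<^sup>2) * (exp (2 * C) * D)"
  have M: "0 \<le> M"
  proof -
    obtain \<rho> where "scaled_time \<mu> T \<rho> C D" using ex[OF T] by auto
    then interpret scaled_time \<mu> T \<rho> C D .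
    show ?thesis using M_nonneg unfolding M_def E_def \<open>M \<equiv> _\<close> .
  qed
  define R where "R = 2 * \<xi>0 * (C / q_upper \<mu> \<xi>0) ^ m"
  have R: "0 \<le> R" using \<xi>0_pos C q_upper_pos by (simp add: R_def)
  define N1 where "N1 = M * R * T"
  define N2 where "N2 = M * pi"
  define N3 where "N3 = c * (4 * M) * R * K * T powr \<eta>"
  define N4 where "N4 = c * (4 * M * pi) * K"
  have N: "0 \<le> N1" "0 \<le> N2" "0 \<le> N3" "0 \<le> N4"
    using M R K c T by (auto simp: N1_def N2_def N3_def N4_def)
  define N where "N = N1 + N2 + N3 + N4"
  have NN: "N1 \<le> N" "N2 \<le> N" "N3 \<le> N" "N4 \<le> N" "0 \<le> N" using N by (auto simp: N_def)
  have "(\<forall>x. integrable lborel (fourier_integrand \<mu> t x)) \<and>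
    (\<forall>x. ennreal \<bar>levy_density \<mu> t x\<bar> \<le> ennreal (N / t ^ Suc m)) \<and>
    L1_norm (levy_density \<mu> t) \<le> ennreal N \<and>
    (\<forall>x. Phi_majorant c \<epsilon> t x \<le> ennreal (N / t ^ Suc m)) \<and>
    (\<integral>\<^sup>+x. Phi_majorant c \<epsilon> t x \<partial>lborel) \<le> ennreal (N * t powr (\<eta> - 1))"
    if t: "0 < t" "t \<le> T" for t
  proof -
    obtain \<rho> where st: "scaled_time \<mu> t \<rho> C D" and q: "1 / t \<le> q_upper \<mu> \<rho>" "q_upper \<mu> \<rho> \<le> C / t"
      and \<rho>R: "\<rho> \<le> R / t ^ m"
      using ex[OF t] unfolding R_def by blast
    interpret S: scaled_time \<mu> t \<rho> C D by (rule st)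
    have SM: "S.M = M" unfolding S.M_def S.E_def M_def ..
    note [measurable (raw)] = measurable_levy_density
    note Kt = Kb[OF t S.\<rho> q]
    have le1: "N1 / t ^ Suc m \<le> N / t ^ Suc m" "N3 / t ^ Suc m \<le> N / t ^ Suc m"
      using NN t by (auto intro!: divide_right_mono)
    have 1: "ennreal \<bar>levy_density \<mu> t x\<bar> \<le> ennreal (N / t ^ Suc m)" for x
    proof (rule ennreal_leI)
      have "\<bar>levy_density \<mu> t x\<bar> \<le> M * \<rho>" using S.abs_levy_density_le unfolding SM .
      also have "\<dots> \<le> M * (R / t ^ m)" by (intro mult_left_mono \<rho>R M)
      also have "\<dots> = M * R * t / t ^ Suc m" using t by simp
      also have "\<dots> \<le> N1 / t ^ Suc m"
        unfolding N1_def using M R t by (intro divide_right_mono mult_left_mono) auto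
      finally show "\<bar>levy_density \<mu> t x\<bar> \<le> N / t ^ Suc m" using le1 by linarith
    qed
    have 2: "L1_norm (levy_density \<mu> t) \<le> ennreal N"
      using S.L1_levy_density_le NN(2) unfolding SM N2_def by (meson ennreal_leI order_trans)
    have 3: "Phi_majorant c \<epsilon> t x \<le> ennreal (N / t ^ Suc m)" for x
    proof -
      have "Phi_majorant c \<epsilon> t x
          \<le> (\<integral>\<^sup>+u. ennreal (c * (4 * M * \<rho>)) * damped \<epsilon> \<rho> u \<partial>\<mu>)"
        unfolding Phi_majorant_def
      proof (rule nn_integral_mono)
        fix u
        have "ennreal \<bar>second_diff (levy_density \<mu> t) u x\<bar> \<le> ennreal (4 * M * \<rho> * min 1 (\<rho>\<^sup>2 * u\<^sup>2))"
          using S.abs_second_diff_levy_density_le unfolding SM by (intro ennreal_leI)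
        then have "ennreal (c * weight \<epsilon> u) * ennreal \<bar>second_diff (levy_density \<mu> t) u x\<bar>
            \<le> ennreal (c * weight \<epsilon> u) * ennreal (4 * M * \<rho> * min 1 (\<rho>\<^sup>2 * u\<^sup>2))" by (rule mult_left_mono) simp
        also have "\<dots> = ennreal (c * (4 * M * \<rho>)) * damped \<epsilon> \<rho> u"
          using c M S.\<rho> weight_nonneg[of \<epsilon> u] by (simp add: ennreal_mult[symmetric] mult_ac)
        finally show "ennreal (c * weight \<epsilon> u) * ennreal \<bar>second_diff (levy_density \<mu> t) u x\<bar>
            \<le> ennreal (c * (4 * M * \<rho>)) * damped \<epsilon> \<rho> u" .
      qed
      also have "\<dots> = ennreal (c * (4 * M * \<rho>)) * (\<integral>\<^sup>+u. damped \<epsilon> \<rho> u \<partial>\<mu>)"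
        by (rule nn_integral_cmult) measurable
      also have "\<dots> \<le> ennreal (c * (4 * M * \<rho>)) * ennreal (K * t powr (\<eta> - 1))"
        by (intro mult_left_mono Kt) simp
      also have "\<dots> = ennreal (c * (4 * M * \<rho>) * (K * t powr (\<eta> - 1)))"
        using c M K S.\<rho> by (simp add: ennreal_mult[symmetric])
      also have "\<dots> \<le> ennreal (N3 / t ^ Suc m)"
      proof (rule ennreal_leI)
        have "c * (4 * M * \<rho>) * (K * t powr (\<eta> - 1)) \<le> c * (4 * M * (R / t ^ m)) * (K * (T powr \<eta> / t))"
        proof (intro mult_mono mult_left_mono \<rho>R)
          show "t powr (\<eta> - 1) \<le> T powr \<eta> / t"
            using t \<eta> by (simp add: powr_diff divide_right_mono powr_mono2)
        qed (use c M K R t S.\<rho> in auto)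
        also have "\<dots> = N3 / t ^ Suc m" by (simp add: N3_def mult_ac)
        finally show "c * (4 * M * \<rho>) * (K * t powr (\<eta> - 1)) \<le> N3 / t ^ Suc m" .
      qed
      also have "\<dots> \<le> ennreal (N / t ^ Suc m)" using le1 by (intro ennreal_leI)
      finally show ?thesis .
    qed
    have 4: "(\<integral>\<^sup>+x. Phi_majorant c \<epsilon> t x \<partial>lborel) \<le> ennreal (N * t powr (\<eta> - 1))"
    proof -
      interpret P: pair_sigma_finite lborel \<mu> ..
      have "(\<integral>\<^sup>+x. Phi_majorant c \<epsilon> t x \<partial>lborel)
          = (\<integral>\<^sup>+u. (\<integral>\<^sup>+x. ennreal (c * weight \<epsilon> u) * ennreal \<bar>second_diff (levy_density \<mu> t) u x\<bar> \<partial>lborel) \<partial>\<mu>)"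
        unfolding Phi_majorant_def second_diff_def by (rule P.Fubini'[symmetric]) measurable
      also have "\<dots> \<le> (\<integral>\<^sup>+u. ennreal (c * (4 * M * pi)) * damped \<epsilon> \<rho> u \<partial>\<mu>)"
      proof (rule nn_integral_mono)
        fix u
        have "(\<integral>\<^sup>+x. ennreal (c * weight \<epsilon> u) * ennreal \<bar>second_diff (levy_density \<mu> t) u x\<bar> \<partial>lborel)
            = ennreal (c * weight \<epsilon> u) * L1_norm (second_diff (levy_density \<mu> t) u)"
          unfolding second_diff_def by (rule nn_integral_cmult) measurable
        also have "\<dots> \<le> ennreal (c * weight \<epsilon> u) * ennreal (4 * M * pi * min 1 (\<rho>\<^sup>2 * u\<^sup>2))"
          using S.L1_second_diff_levy_density_le unfolding SM by (intro mult_left_mono) auto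
        also have "\<dots> = ennreal (c * (4 * M * pi)) * damped \<epsilon> \<rho> u"
          using c M weight_nonneg[of \<epsilon> u] by (simp add: ennreal_mult[symmetric] mult_ac)
        finally show "(\<integral>\<^sup>+x. ennreal (c * weight \<epsilon> u) * ennreal \<bar>second_diff (levy_density \<mu> t) u x\<bar> \<partial>lborel)
            \<le> ennreal (c * (4 * M * pi)) * damped \<epsilon> \<rho> u" .
      qed
      also have "\<dots> = ennreal (c * (4 * M * pi)) * (\<integral>\<^sup>+u. damped \<epsilon> \<rho> u \<partial>\<mu>)"
        by (rule nn_integral_cmult) measurable
      also have "\<dots> \<le> ennreal (c * (4 * M * pi)) * ennreal (K * t powr (\<eta> - 1))"
        by (intro mult_left_mono Kt) simp
      also have "\<dots> = ennreal (N4 * t powr (\<eta> - 1))"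
        using c M K by (simp add: ennreal_mult[symmetric] N4_def mult.assoc)
      also have "\<dots> \<le> ennreal (N * t powr (\<eta> - 1))"
        using NN by (intro ennreal_leI mult_right_mono) auto
      finally show ?thesis .
    qed
    show ?thesis using 1 2 3 4 S.levy_density_eq(1) by blast
  qed
  then show ?thesis using NN \<eta> by (intro exI[of _ N] conjI exI[of _ "Suc m"] exI[of _ \<eta>]) auto
qed

lemma parametrix_well_defined:
  assumes m: "(\<lambda>(x, u). m x u) \<in> borel_measurable borel"
    and mb: "\<And>x u. 0 \<le> m x u" "\<And>x u. m x u \<le> c * min 1 (\<bar>u\<bar> powr \<epsilon>)"
    and c: "0 \<le> c" and \<epsilon>: "0 < \<epsilon>" and t: "0 < t"
  shows "integrable lborel (fourier_integrand \<mu> t (y - x)) \<and>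
           perturb_op_defined \<mu> m (\<lambda>z. p_zero \<mu> t z y) x \<and>
           (\<forall>k\<ge>1. st_conv_defined (st_power (Phi \<mu> m) k) (Phi \<mu> m) t x y) \<and>
           summable (\<lambda>k. st_power (Phi \<mu> m) (Suc k) t x y) \<and>
           st_conv_defined (p_zero \<mu>) (Psi \<mu> m) t x y"
proof -
  obtain N \<kappa> \<eta> where N: "0 \<le> N" and \<eta>: "0 < \<eta>"
    and four: "\<And>s x. 0 < s \<Longrightarrow> s \<le> t \<Longrightarrow> integrable lborel (fourier_integrand \<mu> s x)"
    and pb: "\<And>s x. 0 < s \<Longrightarrow> s \<le> t \<Longrightarrow> ennreal \<bar>levy_density \<mu> s x\<bar> \<le> ennreal (N / s ^ \<kappa>)"
    and pm: "\<And>s. 0 < s \<Longrightarrow> s \<le> t \<Longrightarrow> L1_norm (levy_density \<mu> s) \<le> ennreal N"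
    and gb: "\<And>s x. 0 < s \<Longrightarrow> s \<le> t \<Longrightarrow> Phi_majorant c \<epsilon> s x \<le> ennreal (N / s ^ \<kappa>)"
    and gm: "\<And>s. 0 < s \<Longrightarrow> s \<le> t \<Longrightarrow> (\<integral>\<^sup>+x. Phi_majorant c \<epsilon> s x \<partial>lborel) \<le> ennreal (N * s powr (\<eta> - 1))"
    using heat_kernel_bounds[OF t \<epsilon> c] by blast
  define h where "h s x = ennreal \<bar>levy_density \<mu> s x\<bar>" for s x
  have h: "nn_measurable h"
  proof -
    note [measurable (raw)] = measurable_levy_density
    show ?thesis unfolding nn_measurable_def h_def by measurable
  qed
  have gmass: "(\<integral>\<^sup>+s. indicator {0<..t} s * (\<integral>\<^sup>+x. Phi_majorant c \<epsilon> s x \<partial>lborel) \<partial>lborel) < \<infinity>"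
  proof -
    have "(\<integral>\<^sup>+s. indicator {0<..t} s * (\<integral>\<^sup>+x. Phi_majorant c \<epsilon> s x \<partial>lborel) \<partial>lborel)
        \<le> (\<integral>\<^sup>+s. ennreal N * (indicator {0<..t} s * ennreal (s powr (\<eta> - 1))) \<partial>lborel)"
    proof (rule nn_integral_mono)
      fix s
      show "indicator {0<..t} s * (\<integral>\<^sup>+x. Phi_majorant c \<epsilon> s x \<partial>lborel)
          \<le> ennreal N * (indicator {0<..t} s * ennreal (s powr (\<eta> - 1)))"
        using gm[of s] N by (auto simp: indicator_def ennreal_mult)
    qed
    also have "\<dots> = ennreal N * (\<integral>\<^sup>+s. indicator {0<..t} s * ennreal (s powr (\<eta> - 1)) \<partial>lborel)"
      by (rule nn_integral_cmult) measurable
    also have "\<dots> < \<infinity>"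
      using nn_integral_powr_near_0[OF \<eta>, of t] t by (simp add: ennreal_mult_less_top)
    finally show ?thesis .
  qed
  have hmass: "(\<integral>\<^sup>+s. indicator {0<..t} s * (\<integral>\<^sup>+x. h s x \<partial>lborel) \<partial>lborel) < \<infinity>"
  proof -
    have "(\<integral>\<^sup>+s. indicator {0<..t} s * (\<integral>\<^sup>+x. h s x \<partial>lborel) \<partial>lborel)
        \<le> (\<integral>\<^sup>+s. ennreal N * indicator {0<..t} s \<partial>lborel)"
    proof (rule nn_integral_mono)
      fix s
      show "indicator {0<..t} s * (\<integral>\<^sup>+x. h s x \<partial>lborel) \<le> ennreal N * indicator {0<..t} s"
        using pm[of s] by (auto simp: indicator_def h_def)
    qed
    also have "\<dots> = ennreal N * ennreal t"
      using t by (subst nn_integral_cmult_indicator) auto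
    also have "\<dots> < \<infinity>" by (simp add: ennreal_mult_less_top)
    finally show ?thesis .
  qed
  have fin: "Phi_majorant c \<epsilon> t (y - x) < \<infinity>"
    using gb[OF t order_refl] by (rule le_less_trans) simp
  have ph: "ennreal \<bar>p_zero \<mu> s x y\<bar> \<le> h s (y - x)" for s x y
    by (simp add: p_zero_def h_def)
  have Psi: "Psi \<mu> m = (\<lambda>t x y. \<Sum>k. st_power (Phi \<mu> m) (Suc k) t x y)"
    by (intro ext) (simp add: Psi_def)
  note series = parametrix_series[OF kernel_measurable_Phi[OF m] kernel_measurable_p_zero
      nn_measurable_Phi_majorant[of c \<epsilon>] h abs_Phi_le[OF m mb] ph gb _ N N gmass hmass t order_refl, where x = x and y = y]
  show ?thesis
    unfolding Psi
  proof (intro conjI)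
    show "integrable lborel (fourier_integrand \<mu> t (y - x))" by (rule four[OF t order_refl])
    show "perturb_op_defined \<mu> m (\<lambda>z. p_zero \<mu> t z y) x" by (rule perturb_op_defined_if[OF m mb fin])
  qed (use series pb in \<open>auto simp: h_def\<close>)
qed

end

theorem theorem2p1:
  fixes \<mu> :: "real measure" and m :: "real \<Rightarrow> real \<Rightarrow> real"
  assumes levy: "levy_measure \<mu>" and sym: "symmetric_measure \<mu>"
    and m_meas: "(\<lambda>(x, u). m x u) \<in> borel_measurable borel"
    and A1: "\<exists>\<beta>>1. \<forall>\<^sub>F \<xi> in at_infinity. q_upper \<mu> \<xi> \<le> \<beta> * q_lower \<mu> \<xi>"
    and A2: "\<forall>x u. 0 \<le> m x u \<and> m x (- u) = m x u"
    and A3: "\<exists>c \<epsilon>. c > 0 \<and> \<epsilon> > 0 \<and>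
               (\<forall>x u. m x u \<le> c * min 1 (\<bar>u\<bar> powr \<epsilon>)) \<and>
               (\<integral>\<^sup>+u. ennreal (min (\<bar>u\<bar> powr \<epsilon>) 1) \<partial>\<mu>) = \<infinity>"
  shows "\<forall>t>0. \<forall>x y.
           integrable lborel (fourier_integrand \<mu> t (y - x)) \<and>
           perturb_op_defined \<mu> m (\<lambda>z. p_zero \<mu> t z y) x \<and>
           (\<forall>k\<ge>1. st_conv_defined (st_power (Phi \<mu> m) k) (Phi \<mu> m) t x y) \<and>
           summable (\<lambda>k. st_power (Phi \<mu> m) (Suc k) t x y) \<and>
           st_conv_defined (p_zero \<mu>) (Psi \<mu> m) t x y"
proof -
  interpret levy_setting \<mu> by standard (rule levy)
  obtain \<beta> b where \<beta>: "1 < \<beta>" and b: "\<And>\<xi>. b \<le> norm \<xi> \<Longrightarrow> q_upper \<mu> \<xi> \<le> \<beta> * q_lower \<mu> \<xi>"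
    using A1 unfolding eventually_at_infinity by blast
  obtain c \<epsilon> where c: "0 < c" and \<epsilon>: "0 < \<epsilon>" and mb: "\<And>x u. m x u \<le> c * min 1 (\<bar>u\<bar> powr \<epsilon>)"
    and inf: "(\<integral>\<^sup>+u. ennreal (min (\<bar>u\<bar> powr \<epsilon>) 1) \<partial>\<mu>) = \<infinity>"
    using A3 by blast
  \<comment> \<open>The maximum with $1$ makes the threshold of (A1) positive.\<close>
  define \<xi>0 where "\<xi>0 = max b 1"
  \<comment> \<open>A vanishing $q^U$ would mean that $\mu$ lives on $\{0\}$, where the divergent integral in (A3) vanishes.\<close>
  have "q_upper \<mu> \<xi>0 \<noteq> 0"
  proof
    assume "q_upper \<mu> \<xi>0 = 0"
    then have "AE u in \<mu>. min ((\<xi>0 * u)\<^sup>2) 1 = 0"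
      unfolding q_upper_def using integral_nonneg_eq_0_iff_AE[OF integrable_q_upper[of \<xi>0]] by simp
    then have "AE u in \<mu>. ennreal (min (\<bar>u\<bar> powr \<epsilon>) 1) = 0"
    proof eventually_elim
      fix u assume "min ((\<xi>0 * u)\<^sup>2) 1 = 0"
      then have "\<xi>0 * u = 0" by (auto simp: min_def split: if_splits)
      then have "u = 0" by (auto simp: \<xi>0_def)
      then show "ennreal (min (\<bar>u\<bar> powr \<epsilon>) 1) = 0" by simp
    qed
    then have "(\<integral>\<^sup>+u. ennreal (min (\<bar>u\<bar> powr \<epsilon>) 1) \<partial>\<mu>) = 0"
      by (subst nn_integral_0_iff_AE) auto
    with inf show False by simp
  qed
  then have pos: "0 < q_upper \<mu> \<xi>0" using q_upper_nonneg[of \<xi>0] by simp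
  interpret levy_scaling \<mu> \<beta> \<xi>0
    by standard (use \<beta> b pos in \<open>auto simp: \<xi>0_def\<close>)
  show ?thesis
    using parametrix_well_defined[OF m_meas _ mb _ \<epsilon>] A2 c by auto
qed

end
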